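(* Let $k$ be a positive integer. There exist a computable function $f:\mathbb{N}\to\mathbb{N}$ and an algorithm that takes as input an $n$-vertex graph $G$ and decides in time $f(k)\cdot n^3$ whether $G$ has lettericity at most $k$, and if so outputs a $k$-letter realisation of $G$. Moreover, the same holds for any hereditary class $\mathcal{C}$ of $k$-letter graphs that is MSO-definable: there exist a computable function $f$ and an algorithm that, given an $n$-vertex graph $G$, decides in time $f(k)\cdot n^3$ whether $G\in\mathcal{C}$, and if so outputs a $k$-letter realisation of $G$.
   Context: All graphs are finite, simple and undirected. A decoder is a directed graph $D=(\Sigma,A)$ (loops allowed) on a finite alphabet $\Sigma$. An $n$-vertex graph $G=(V,E)$ is a letter graph over $D$ if there exist a map $\ell:V\to\Sigma$ and a bijection $c:V\to[n]$ such that two distinct vertices $x,y$ are adjacent iff either $(\ell(x),\ell(y))\in A$ and $c(x)<c(y)$, or $(\ell(y),\ell(x))\in A$ and $c(y)<c(x)$; $(\ell,c)$ is then a letter realisation of $G$ over $D$, and a $k$-letter realisation if $|\Sigma|=k$. $G$ is a $k$-letter graph if it admits a $k$-letter realisation, and the lettericity of $G$ is the least such $k$. A class of graphs (closed under isomorphism) is hereditary if closed under vertex deletion. MSO (monadic second-order logic) formulas over graphs are built from atomic formulas $x=y$, $\mathsf{edg}(x,y)$ (adjacency) and $x\in X$ (with vertex variables $x,y$ and set variables $X$) using $\wedge,\vee,\neg$ and existential quantification over vertex variables and over set variables, with the usual semantics; a class is MSO-definable if there is an MSO sentence satisfied exactly by the graphs of the class. *)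

theory Defs
  imports "Graph_Theory.Graph_Theory"
begin

section \<open>Letter graphs\<close>

text \<open>
  A finite simple undirected graph is a \<^locale>\<open>pair_graph\<close> (a finite, symmetric, loop-free
  digraph whose arcs are pairs of vertices); a decoder is a \<^locale>\<open>pair_fin_digraph\<close>, in which
  loops are allowed, its vertex set being the alphabet.
\<close>

definition letter_realisation ::
    "'s pair_pre_digraph \<Rightarrow> ('a \<Rightarrow> 's) \<Rightarrow> ('a \<Rightarrow> nat) \<Rightarrow> 'a pair_pre_digraph \<Rightarrow> bool" where
  "letter_realisation D l c G \<longleftrightarrow>
     pair_fin_digraph D \<and>
     l ` pverts G \<subseteq> pverts D \<and>
     bij_betw c (pverts G) {1..card (pverts G)} \<and>
     (\<forall>x\<in>pverts G. \<forall>y\<in>pverts G. x \<noteq> y \<longrightarrow>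
        ((x, y) \<in> parcs G \<longleftrightarrow>
           (l x, l y) \<in> parcs D \<and> c x < c y \<or> (l y, l x) \<in> parcs D \<and> c y < c x))"

definition k_letter_realisation ::
    "nat \<Rightarrow> 's pair_pre_digraph \<Rightarrow> ('a \<Rightarrow> 's) \<Rightarrow> ('a \<Rightarrow> nat) \<Rightarrow> 'a pair_pre_digraph \<Rightarrow> bool" where
  "k_letter_realisation k D l c G \<longleftrightarrow> card (pverts D) = k \<and> letter_realisation D l c G"

text \<open>
  The letters are taken from \<^typ>\<open>nat\<close>, which is no restriction since alphabets are finite.
\<close>

definition k_letter_graph :: "nat \<Rightarrow> 'a pair_pre_digraph \<Rightarrow> bool" where
  "k_letter_graph k G \<longleftrightarrow>
     (\<exists>(D :: nat pair_pre_digraph) l c. k_letter_realisation k D l c G)"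

definition lettericity :: "'a pair_pre_digraph \<Rightarrow> nat" where
  "lettericity G = (LEAST k. k_letter_graph k G)"

section \<open>Graph classes\<close>

text \<open>
  Every finite graph is isomorphic to one with vertices in \<^typ>\<open>nat\<close>, so an isomorphism-closed
  class is represented by its members of this type.
\<close>

definition graph_class :: "nat pair_pre_digraph set \<Rightarrow> bool" where
  "graph_class C \<longleftrightarrow>
     (\<forall>G\<in>C. pair_graph G) \<and>
     (\<forall>G\<in>C. \<forall>H. pair_graph H \<and> digraph_iso (with_proj G) (with_proj H) \<longrightarrow> H \<in> C)"

definition hereditary :: "nat pair_pre_digraph set \<Rightarrow> bool" where
  "hereditary C \<longleftrightarrow>
     (\<forall>G\<in>C. \<forall>v\<in>pverts G. \<forall>H.
        with_proj H = pre_digraph.del_vert (with_proj G) v \<longrightarrow> H \<in> C)"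

section \<open>Monadic second-order logic over graphs\<close>

text \<open>
  Vertex variables and set variables are two separate supplies, each indexed by \<^typ>\<open>nat\<close>.
\<close>

datatype mso =
    MEq nat nat
  | MEdg nat nat
  | MIn nat nat  \<comment> \<open>vertex variable, set variable\<close>
  | MAnd mso mso
  | MOr mso mso
  | MNot mso
  | MExV nat mso
  | MExS nat mso

primrec mso_sat ::
    "'a pair_pre_digraph \<Rightarrow> (nat \<Rightarrow> 'a) \<Rightarrow> (nat \<Rightarrow> 'a set) \<Rightarrow> mso \<Rightarrow> bool" where
  "mso_sat G e E (MEq x y) \<longleftrightarrow> e x = e y"
| "mso_sat G e E (MEdg x y) \<longleftrightarrow> (e x, e y) \<in> parcs G"
| "mso_sat G e E (MIn x X) \<longleftrightarrow> e x \<in> E X"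
| "mso_sat G e E (MAnd p q) \<longleftrightarrow> mso_sat G e E p \<and> mso_sat G e E q"
| "mso_sat G e E (MOr p q) \<longleftrightarrow> mso_sat G e E p \<or> mso_sat G e E q"
| "mso_sat G e E (MNot p) \<longleftrightarrow> \<not> mso_sat G e E p"
| "mso_sat G e E (MExV x p) \<longleftrightarrow> (\<exists>v\<in>pverts G. mso_sat G (e(x := v)) E p)"
| "mso_sat G e E (MExS X p) \<longleftrightarrow> (\<exists>S\<subseteq>pverts G. mso_sat G e (E(X := S)) p)"

primrec mso_free_v :: "mso \<Rightarrow> nat set" where
  "mso_free_v (MEq x y) = {x, y}"
| "mso_free_v (MEdg x y) = {x, y}"
| "mso_free_v (MIn x X) = {x}"
| "mso_free_v (MAnd p q) = mso_free_v p \<union> mso_free_v q"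
| "mso_free_v (MOr p q) = mso_free_v p \<union> mso_free_v q"
| "mso_free_v (MNot p) = mso_free_v p"
| "mso_free_v (MExV x p) = mso_free_v p - {x}"
| "mso_free_v (MExS X p) = mso_free_v p"

primrec mso_free_s :: "mso \<Rightarrow> nat set" where
  "mso_free_s (MEq x y) = {}"
| "mso_free_s (MEdg x y) = {}"
| "mso_free_s (MIn x X) = {X}"
| "mso_free_s (MAnd p q) = mso_free_s p \<union> mso_free_s q"
| "mso_free_s (MOr p q) = mso_free_s p \<union> mso_free_s q"
| "mso_free_s (MNot p) = mso_free_s p"
| "mso_free_s (MExV x p) = mso_free_s p"
| "mso_free_s (MExS X p) = mso_free_s p - {X}"

definition mso_sentence :: "mso \<Rightarrow> bool" where
  "mso_sentence p \<longleftrightarrow> mso_free_v p = {} \<and> mso_free_s p = {}"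

text \<open>The truth of a sentence does not depend on the assignment chosen here.\<close>

definition mso_models :: "'a pair_pre_digraph \<Rightarrow> mso \<Rightarrow> bool" where
  "mso_models G p \<longleftrightarrow> mso_sat G (\<lambda>_. undefined) (\<lambda>_. {}) p"

definition mso_definable :: "nat pair_pre_digraph set \<Rightarrow> bool" where
  "mso_definable C \<longleftrightarrow>
     (\<exists>p. mso_sentence p \<and> (\<forall>G. pair_graph G \<longrightarrow> (G \<in> C \<longleftrightarrow> mso_models G p)))"

section \<open>Algorithms: random access machines\<close>

text \<open>
  The model is the usual RAM with uniform cost: registers are indexed by \<^typ>\<open>nat\<close> and hold
  natural numbers, input is read and output is written sequentially, and the machine halts when
  the program counter leaves the program. Subtraction is truncated, division rounds down, and
  division by zero yields zero.
\<close>

datatype arith = Plus | Minus | Times | Divide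

primrec arith_op :: "arith \<Rightarrow> nat \<Rightarrow> nat \<Rightarrow> nat" where
  "arith_op Plus x y = x + y"
| "arith_op Minus x y = x - y"
| "arith_op Times x y = x * y"
| "arith_op Divide x y = x div y"

datatype instr =
    Const nat nat            \<comment> \<open>\<open>Const r m\<close>: \<open>r := m\<close>\<close>
  | Arith arith nat nat nat  \<comment> \<open>\<open>Arith b r x y\<close>: \<open>r := x b y\<close>\<close>
  | Load nat nat             \<comment> \<open>\<open>Load r x\<close>: \<open>r :=\<close> content of the register with number \<open>x\<close>\<close>
  | Store nat nat            \<comment> \<open>\<open>Store x r\<close>: register with number \<open>x\<close> \<open>:= r\<close>\<close>
  | Read nat                 \<comment> \<open>yields zero if the input is exhausted\<close>
  | Write nat
  | JumpZero nat nat         \<comment> \<open>\<open>JumpZero r m\<close>: if \<open>r = 0\<close> go to instruction \<open>m\<close>\<close>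

record ram =
  ram_pc :: nat
  ram_mem :: "nat \<Rightarrow> nat"
  ram_in :: "nat list"
  ram_out :: "nat list"

primrec exec :: "instr \<Rightarrow> ram \<Rightarrow> ram" where
  "exec (Const r m) s =
     s\<lparr>ram_pc := Suc (ram_pc s), ram_mem := (ram_mem s)(r := m)\<rparr>"
| "exec (Arith b r x y) s =
     s\<lparr>ram_pc := Suc (ram_pc s),
       ram_mem := (ram_mem s)(r := arith_op b (ram_mem s x) (ram_mem s y))\<rparr>"
| "exec (Load r x) s =
     s\<lparr>ram_pc := Suc (ram_pc s), ram_mem := (ram_mem s)(r := ram_mem s (ram_mem s x))\<rparr>"
| "exec (Store x r) s =
     s\<lparr>ram_pc := Suc (ram_pc s), ram_mem := (ram_mem s)(ram_mem s x := ram_mem s r)\<rparr>"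
| "exec (Read r) s =
     s\<lparr>ram_pc := Suc (ram_pc s),
       ram_mem := (ram_mem s)(r := (case ram_in s of [] \<Rightarrow> 0 | m # _ \<Rightarrow> m)),
       ram_in := tl (ram_in s)\<rparr>"
| "exec (Write r) s =
     s\<lparr>ram_pc := Suc (ram_pc s), ram_out := ram_out s @ [ram_mem s r]\<rparr>"
| "exec (JumpZero r m) s =
     s\<lparr>ram_pc := (if ram_mem s r = 0 then m else Suc (ram_pc s))\<rparr>"

definition halted :: "instr list \<Rightarrow> ram \<Rightarrow> bool" where
  "halted P s \<longleftrightarrow> length P \<le> ram_pc s"

definition ram_step :: "instr list \<Rightarrow> ram \<Rightarrow> ram" where
  "ram_step P s = (if halted P s then s else exec (P ! ram_pc s) s)"

definition run :: "instr list \<Rightarrow> nat list \<Rightarrow> nat \<Rightarrow> ram" where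
  "run P xs t =
     (ram_step P ^^ t) \<lparr>ram_pc = 0, ram_mem = (\<lambda>_. 0), ram_in = xs, ram_out = []\<rparr>"

definition computes :: "instr list \<Rightarrow> nat list \<Rightarrow> nat list \<Rightarrow> bool" where
  "computes P xs ys \<longleftrightarrow> (\<exists>t. halted P (run P xs t) \<and> ram_out (run P xs t) = ys)"

text \<open>
  In a computation of time at most \<open>T\<close> the registers may only ever hold numbers up to \<open>T\<close>, that
  is, words of \<open>O(log T)\<close> bits. Without a bound of this kind, the uniform cost of arithmetic on
  huge numbers would make the time measure unrealistic.
\<close>

definition computes_in_time :: "nat \<Rightarrow> instr list \<Rightarrow> nat list \<Rightarrow> nat list \<Rightarrow> bool" where
  "computes_in_time T P xs ys \<longleftrightarrow>
     (\<exists>t\<le>T. halted P (run P xs t) \<and> ram_out (run P xs t) = ys \<and>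
        (\<forall>s\<le>t. \<forall>r. ram_mem (run P xs s) r \<le> T))"

definition computable :: "(nat \<Rightarrow> nat) \<Rightarrow> bool" where
  "computable f \<longleftrightarrow> (\<exists>P. \<forall>x. computes P [x] [f x])"

section \<open>Recognition algorithms with certificates\<close>

text \<open>
  An input graph has vertex set \<open>{0..<n}\<close> and is given by \<open>n\<close> and its adjacency matrix, row by
  row, preceded by the parameter \<open>k\<close>. A realisation over an alphabet \<open>{0..<k}\<close> is written as the
  adjacency matrix of the decoder followed by the letters and then the positions of the vertices.
\<close>

definition adj_matrix :: "nat \<Rightarrow> nat pair_pre_digraph \<Rightarrow> nat list" where
  "adj_matrix n G =
     concat (map (\<lambda>i. map (\<lambda>j. if (i, j) \<in> parcs G then 1 else 0) [0..<n]) [0..<n])"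

definition encode_input :: "nat \<Rightarrow> nat \<Rightarrow> nat pair_pre_digraph \<Rightarrow> nat list" where
  "encode_input k n G = [k, n] @ adj_matrix n G"

definition encode_realisation ::
    "nat \<Rightarrow> nat \<Rightarrow> nat pair_pre_digraph \<Rightarrow> (nat \<Rightarrow> nat) \<Rightarrow> (nat \<Rightarrow> nat) \<Rightarrow> nat list" where
  "encode_realisation k n D l c = adj_matrix k D @ map l [0..<n] @ map c [0..<n]"

definition correct_answer ::
    "nat \<Rightarrow> nat pair_pre_digraph set \<Rightarrow> nat \<Rightarrow> nat pair_pre_digraph \<Rightarrow> nat list \<Rightarrow> bool" where
  "correct_answer k C n G ys \<longleftrightarrow>
     (if G \<in> C
      then \<exists>D l c. pverts D = {0..<k} \<and> k_letter_realisation k D l c G \<and>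
             ys = 1 # encode_realisation k n D l c
      else ys = [0])"

text \<open>
  For the null graph the bound \<open>f k * n ^ 3\<close> is zero, which no program that writes an answer can
  meet; there only a correct answer is required.
\<close>

definition decides_with_realisation ::
    "instr list \<Rightarrow> (nat \<Rightarrow> nat) \<Rightarrow> nat \<Rightarrow> nat pair_pre_digraph set \<Rightarrow> bool" where
  "decides_with_realisation P f k C \<longleftrightarrow>
     (\<forall>n G. pair_graph G \<and> pverts G = {0..<n} \<longrightarrow>
        (\<exists>ys. correct_answer k C n G ys \<and>
           computes P (encode_input k n G) ys \<and>
           (n > 0 \<longrightarrow> computes_in_time (f k * n ^ 3) P (encode_input k n G) ys)))"

end

theory Submission
  imports Defs "HOL-Library.Sublist" "HOL-Library.Ramsey"
begin

text \<open>
  The graph is built up vertex by vertex. A realisation over \<open>K\<close> letters of the graph seen so far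
  becomes, when the next vertex is appended, a word over \<open>2 K + 1\<close> types, each old letter being
  split according to the adjacency to the new vertex. For given new letters and a given decoder, a
  suitable order of the vertices is a linear extension of the relation ``must precede'', so it
  exists iff this relation is acyclic. Since the arcs between two positions of the word depend only
  on their types and letters, acyclicity can be decided by a deterministic finite automaton reading
  the word, whose states are the reachability relations between classes of vertices; a table of
  the states from which the rest of the word can be completed yields the letters, and a topological
  sort the order. Each of the \<open>n\<close> rounds takes quadratic time.

  If a hereditary class consists of \<open>K\<close>-letter graphs, the words that describe its members are
  closed under taking subwords. By Higman's lemma they are given by finitely many forbidden
  subwords, which are hardwired into the program and searched for in the realisation found.
\<close>

section \<open>Higman's lemma over a finite alphabet\<close>

text \<open>The order of the vertices cannot be enumerated, and an automaton must be given some word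
  to read; the realisation of the smaller graph supplies it. That realisation only serves to present
  the larger graph: the new letters, decoder and order owe nothing to the old ones. Since
  realisability passes to induced subgraphs, failure in one round is final. For a class, the single
  realisation found is enough to decide membership, because the graph is isomorphic to the graph of
  its word under the decoder; forbidden words are kept separately for each decoder. The other
  difficulty is the time measure, which also caps the contents of every register. Programs are
  written in a language with counted loops only, and syntactic tests bound values and time: every
  variable is at most Q or Q n with Q depending on k alone, and at most three loops up to n are
  nested, which gives the cube. The minima in the program never take effect; they make the bounds
  visible in the syntax. With N = (2 K + 1) K classes there are 2^(N^2) states and 2^(K^2) decoders,
  which leads to Q = 2^((3 k + 3)^4).\<close>

definition wq :: "'a list set \<Rightarrow> bool" where
  "wq S \<longleftrightarrow> (\<forall>f::nat \<Rightarrow> 'a list. range f \<subseteq> S \<longrightarrow>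
     (\<exists>r::nat \<Rightarrow> nat. strict_mono r \<and> (\<forall>i j. i < j \<longrightarrow> subseq (f (r i)) (f (r j)))))"

lemma wqE:
  fixes f :: "nat \<Rightarrow> 'a list"
  assumes "wq S" "range f \<subseteq> S"
  obtains r :: "nat \<Rightarrow> nat" where "strict_mono r" "\<And>i j. i < j \<Longrightarrow> subseq (f (r i)) (f (r j))"
proof -
  have "range f \<subseteq> S \<longrightarrow> (\<exists>r::nat \<Rightarrow> nat. strict_mono r \<and>
      (\<forall>i j. i < j \<longrightarrow> subseq (f (r i)) (f (r j))))"
    using assms(1) unfolding wq_def by (rule spec)
  with assms(2) have "\<exists>r::nat \<Rightarrow> nat. strict_mono r \<and>
      (\<forall>i j. i < j \<longrightarrow> subseq (f (r i)) (f (r j)))" by (rule rev_mp)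
  then show ?thesis by (elim exE conjE) (erule that, simp)
qed

text \<open>\<open>wq\<close> asks for an infinite ascending subsequence, a form that can be applied
  repeatedly to thin out a sequence. By Ramsey's theorem one good pair in every sequence suffices: a
  homogeneous subsequence without good pairs would itself violate the assumption.\<close>

lemma wqI_weak:
  assumes "\<And>f::nat \<Rightarrow> 'a list. range f \<subseteq> S \<Longrightarrow> \<exists>i j. i < j \<and> subseq (f i) (f j)"
  shows "wq S"
  unfolding wq_def
proof (intro allI impI)
  fix f :: "nat \<Rightarrow> 'a list"
  assume f: "range f \<subseteq> S"
  \<comment> \<open>Ramsey's theorem colours unordered pairs; \<open>Min\<close> and
    \<open>Max\<close> restore the order of the two indices.\<close>
  define col where "col X = (if subseq (f (Min X)) (f (Max X)) then 1 else 0::nat)" for X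
  have "\<forall>x\<in>UNIV. \<forall>y\<in>UNIV. x \<noteq> y \<longrightarrow> col {x, y} < 2" by (simp add: col_def)
  from Ramsey2[OF infinite_UNIV_nat this] obtain Y t where Y: "infinite Y"
    "\<forall>x\<in>Y. \<forall>y\<in>Y. x \<noteq> y \<longrightarrow> col {x, y} = t" by blast
  obtain r :: "nat \<Rightarrow> nat" where r: "strict_mono r" "\<And>n. r n \<in> Y"
    using infinite_enumerate[OF Y(1)] by blast
  have lt: "r i < r j" if "i < j" for i j using r(1) that by (simp add: strict_mono_less)
  have col: "col {r i, r j} = (if subseq (f (r i)) (f (r j)) then 1 else 0)" if "i < j" for i j
    using lt[OF that] by (simp add: col_def)
  have "range (f \<circ> r) \<subseteq> S" using f by auto
  from assms[OF this] obtain i j where ij: "i < j" "subseq (f (r i)) (f (r j))" by auto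
  have t: "col {r i, r j} = t" if "i < j" for i j
  proof -
    have "r i \<noteq> r j" using lt[OF that] by simp
    with Y(2) r(2) show ?thesis by blast
  qed
  have t1: "t = 1" using t[OF ij(1)] col[OF ij(1)] ij(2) by simp
  have "subseq (f (r i)) (f (r j))" if "i < j" for i j
  proof (rule ccontr)
    assume "\<not> ?thesis"
    then have "col {r i, r j} = 0" by (simp only: col[OF that] if_False)
    with t[OF that] t1 show False by simp
  qed
  with r(1) show "\<exists>r::nat \<Rightarrow> nat. strict_mono r \<and> (\<forall>i j. i < j \<longrightarrow> subseq (f (r i)) (f (r j)))"
    by (intro exI[of _ r]) simp
qed

text \<open>A word avoiding \<open>a # u\<close> either lacks \<open>a\<close> or factors at its
  first \<open>a\<close> as \<open>x @ a # y\<close>, where \<open>x\<close> lacks \<open>a\<close>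
  and \<open>y\<close> avoids \<open>u\<close>. In the second case the sequence is thinned for the
  parts \<open>x\<close> and then for the parts \<open>y\<close>, and the ascending factors are
  concatenated.\<close>

lemma wq_avoid:
  assumes "a \<in> A" "wq (lists (A - {a}))" "wq {w \<in> lists A. \<not> subseq u w}"
  shows "wq {w \<in> lists A. \<not> subseq (a # u) w}"
  unfolding wq_def
proof (intro allI impI)
  fix f :: "nat \<Rightarrow> 'a list"
  assume f: "range f \<subseteq> {w \<in> lists A. \<not> subseq (a # u) w}"
  have fA: "f i \<in> lists A" and fu: "\<not> subseq (a # u) (f i)" for i using f by auto
  let ?P = "\<lambda>i. a \<in> set (f i)"
  show "\<exists>r::nat \<Rightarrow> nat. strict_mono r \<and> (\<forall>i j. i < j \<longrightarrow> subseq (f (r i)) (f (r j)))"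
  proof (cases "infinite {i. ?P i}")
    case False
    then have "infinite {i. \<not> ?P i}"
      using infinite_UNIV_nat by (simp add: Collect_neg_eq)
    then obtain r :: "nat \<Rightarrow> nat" where r: "strict_mono r" "\<And>n. a \<notin> set (f (r n))"
      using infinite_enumerate by blast
    have "range (f \<circ> r) \<subseteq> lists (A - {a})" using fA r(2) by (auto simp: in_lists_conv_set)
    then obtain r' :: "nat \<Rightarrow> nat" where "strict_mono r'" "\<And>i j. i < j \<Longrightarrow> subseq ((f \<circ> r) (r' i)) ((f \<circ> r) (r' j))"
      by (rule wqE[OF assms(2)]) (erule that, blast)
    then show ?thesis using strict_mono_o[OF r(1)] by (intro exI[of _ "r \<circ> r'"]) simp
  next
    case True
    then obtain r :: "nat \<Rightarrow> nat" where r: "strict_mono r" "\<And>n. a \<in> set (f (r n))"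
      using infinite_enumerate by blast
    have "\<exists>x y. f (r n) = x @ a # y \<and> a \<notin> set x" for n
      using split_list_first[OF r(2)] by blast
    then obtain x y where xy: "\<And>n. f (r n) = x n @ a # y n" "\<And>n. a \<notin> set (x n)" by metis
    have xA: "x n \<in> lists (A - {a})" and yA: "y n \<in> lists A" for n
      using fA[of "r n"] xy[of n] by (auto simp: in_lists_conv_set)
    have yu: "\<not> subseq u (y n)" for n
      using fu[of "r n"] xy(1)[of n] by (auto intro: list_emb_append2)
    have "range x \<subseteq> lists (A - {a})" using xA by auto
    then obtain p :: "nat \<Rightarrow> nat" where p: "strict_mono p" "\<And>i j. i < j \<Longrightarrow> subseq (x (p i)) (x (p j))"
      by (rule wqE[OF assms(2)]) (erule that, blast)
    have "range (y \<circ> p) \<subseteq> {w \<in> lists A. \<not> subseq u w}" using yA yu by auto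
    then obtain q :: "nat \<Rightarrow> nat" where q: "strict_mono q" "\<And>i j. i < j \<Longrightarrow> subseq ((y \<circ> p) (q i)) ((y \<circ> p) (q j))"
      by (rule wqE[OF assms(3)]) (erule that, blast)
    have "subseq (f (r (p (q i)))) (f (r (p (q j))))" if "i < j" for i j
    proof -
      have "subseq (x (p (q i))) (x (p (q j)))"
        using p(2) q(1) that by (simp add: strict_mono_less)
      moreover have "subseq (a # y (p (q i))) (a # y (p (q j)))" using q(2) that by auto
      ultimately show ?thesis unfolding xy(1) by (rule list_emb_append_mono)
    qed
    then show ?thesis
      using strict_mono_o[OF r(1) strict_mono_o[OF p(1) q(1)]]
      by (intro exI[of _ "r \<circ> (p \<circ> q)"]) simp
  qed
qed

text \<open>Outer induction on the alphabet, inner induction on the word to be avoided. Avoiding one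
  word is enough, since in a sequence without good pairs all later words avoid the first.\<close>

lemma higman: "finite A \<Longrightarrow> wq (lists A)"
proof (induction A rule: finite_psubset_induct)
  case (psubset A)
  have avoid: "u \<in> lists A \<Longrightarrow> wq {w \<in> lists A. \<not> subseq u w}" for u
  proof (induction u)
    case (Cons a u)
    then have "a \<in> A" by simp
    moreover from this have "wq (lists (A - {a}))" by (intro psubset.IH) auto
    ultimately show ?case using Cons by (intro wq_avoid) auto
  qed (simp add: wq_def)
  show ?case
  proof (rule wqI_weak)
    fix f :: "nat \<Rightarrow> 'a list"
    assume f: "range f \<subseteq> lists A"
    show "\<exists>i j. i < j \<and> subseq (f i) (f j)"
    proof (rule ccontr)
      assume "\<nexists>i j. i < j \<and> subseq (f i) (f j)"
      then have bad: "\<not> subseq (f i) (f j)" if "i < j" for i j using that by blast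
      have "range (f \<circ> Suc) \<subseteq> {w \<in> lists A. \<not> subseq (f 0) w}" using f bad by auto
      then obtain r :: "nat \<Rightarrow> nat" where r: "strict_mono r"
        "\<And>i j. i < j \<Longrightarrow> subseq ((f \<circ> Suc) (r i)) ((f \<circ> Suc) (r j))"
        using wqE[OF avoid[of "f 0"], of "f \<circ> Suc"] f by blast
      then have "subseq (f (Suc (r 0))) (f (Suc (r 1)))" "r 0 < r 1"
        using r(2)[of 0 1] by (auto simp: strict_mono_less)
      with bad[of "Suc (r 0)" "Suc (r 1)"] show False by simp
    qed
  qed
qed

text \<open>The minimal elements of \<open>U\<close> are pairwise incomparable, so by Higman's lemma
  there are finitely many; an element of least length below a given word is minimal.\<close>

lemma finite_basis:
  assumes "finite A" "U \<subseteq> lists A"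
  shows "\<exists>F. finite F \<and> F \<subseteq> U \<and> (\<forall>w\<in>U. \<exists>u\<in>F. subseq u w)"
proof -
  define F where "F = {u \<in> U. \<forall>v\<in>U. subseq v u \<longrightarrow> v = u}"
  have "\<exists>u\<in>F. subseq u w" if "w \<in> U" for w
  proof -
    have "\<exists>u. (u \<in> U \<and> subseq u w) \<and> (\<forall>v. v \<in> U \<and> subseq v w \<longrightarrow> length u \<le> length v)"
      using ex_has_least_nat[of "\<lambda>v. v \<in> U \<and> subseq v w" w length] that by auto
    then obtain u where u: "u \<in> U" "subseq u w" "\<forall>v. v \<in> U \<and> subseq v w \<longrightarrow> length u \<le> length v"
      by blast
    have "u \<in> F" unfolding F_def
    proof (intro CollectI conjI ballI impI u(1))
      fix v assume v: "v \<in> U" "subseq v u"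
      then have "length u \<le> length v" using u by (meson subseq_order.trans)
      with v(2) show "v = u" by (meson le_antisym list_emb_length subseq_same_length)
    qed
    with u(2) show ?thesis by blast
  qed
  moreover have "finite F"
  proof (rule ccontr)
    assume "infinite F"
    then obtain f :: "nat \<Rightarrow> 'a list" where f: "inj f" "range f \<subseteq> F"
      using infinite_countable_subset by blast
    have "range f \<subseteq> lists A" using f(2) assms(2) by (auto simp: F_def)
    then obtain r :: "nat \<Rightarrow> nat" where r: "strict_mono r" "\<And>i j. i < j \<Longrightarrow> subseq (f (r i)) (f (r j))"
      by (rule wqE[OF higman[OF assms(1)]]) (erule that, blast)
    then have "subseq (f (r 0)) (f (r 1))" "r 0 < r 1" by (auto simp: strict_mono_less)
    moreover have "f (r 0) \<in> F" "f (r 1) \<in> F" using f(2) by auto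
    ultimately have "f (r 0) = f (r 1)" unfolding F_def by blast
    with f(1) \<open>r 0 < r 1\<close> show False by (auto dest: injD)
  qed
  ultimately show ?thesis by (intro exI[of _ F]) (auto simp: F_def)
qed

section \<open>Realisations as linear extensions\<close>

text \<open>
  An arc from \<open>x\<close> to \<open>y\<close> says that \<open>y\<close> must not precede \<open>x\<close>, because the decoder would then give
  the wrong adjacency. If the labels rule out both orders, there are arcs in both directions.
\<close>

definition arc :: "('a \<Rightarrow> 'a \<Rightarrow> bool) \<Rightarrow> ('s \<Rightarrow> 's \<Rightarrow> bool) \<Rightarrow> ('a \<Rightarrow> 's) \<Rightarrow> 'a \<Rightarrow> 'a \<Rightarrow> bool" where
  "arc adj D l x y \<longleftrightarrow> x \<noteq> y \<and> adj x y \<noteq> D (l y) (l x)"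

definition arcs_on :: "('a \<Rightarrow> 'a \<Rightarrow> bool) \<Rightarrow> ('s \<Rightarrow> 's \<Rightarrow> bool) \<Rightarrow> ('a \<Rightarrow> 's) \<Rightarrow> 'a set \<Rightarrow> 'a rel" where
  "arcs_on adj D l W = {(x, y). x \<in> W \<and> y \<in> W \<and> arc adj D l x y}"

definition realises :: "('a \<Rightarrow> 'a \<Rightarrow> bool) \<Rightarrow> ('s \<Rightarrow> 's \<Rightarrow> bool) \<Rightarrow> ('a \<Rightarrow> 's) \<Rightarrow> ('a \<Rightarrow> nat) \<Rightarrow> 'a set \<Rightarrow> bool"
  where "realises adj D l c W \<longleftrightarrow> inj_on c W \<and> (\<forall>x\<in>W. \<forall>y\<in>W. x \<noteq> y \<longrightarrow>
     (adj x y \<longleftrightarrow> D (l x) (l y) \<and> c x < c y \<or> D (l y) (l x) \<and> c y < c x))"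

text \<open>With distinct positions each pair occurs in just one order, and placing \<open>y\<close>
  before \<open>x\<close> yields the wrong adjacency exactly if there is an arc from
  \<open>x\<close> to \<open>y\<close>.\<close>

lemma realises_iff:
  assumes "\<And>x y. adj x y = adj y x"
  shows "realises adj D l c W \<longleftrightarrow>
    inj_on c W \<and> (\<forall>x\<in>W. \<forall>y\<in>W. arc adj D l x y \<longrightarrow> c x < c y)" (is "_ \<longleftrightarrow> _ \<and> ?R")
proof -
  have "(\<forall>x\<in>W. \<forall>y\<in>W. x \<noteq> y \<longrightarrow>
     (adj x y \<longleftrightarrow> D (l x) (l y) \<and> c x < c y \<or> D (l y) (l x) \<and> c y < c x)) \<longleftrightarrow> ?R" (is "?L \<longleftrightarrow> _")
    if c: "inj_on c W"
  proof
    assume ?L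
    then show ?R using c unfolding arc_def inj_on_def by (metis linorder_neqE_nat less_asym)
  next
    assume R: ?R
    show ?L
    proof (intro ballI impI)
      fix x y assume xy: "x \<in> W" "y \<in> W" "x \<noteq> y"
      then have "c x < c y \<or> c y < c x" using c by (metis inj_onD linorder_neqE_nat)
      then show "adj x y \<longleftrightarrow> D (l x) (l y) \<and> c x < c y \<or> D (l y) (l x) \<and> c y < c x"
        using R xy assms[of x y] unfolding arc_def by (metis less_asym)
    qed
  qed
  then show ?thesis unfolding realises_def by blast
qed

lemma realises_acyclic:
  assumes "\<And>x y. adj x y = adj y x" "realises adj D l c W"
  shows "acyclic (arcs_on adj D l W)"
proof -
  have arc: "(x, y) \<in> arcs_on adj D l W \<Longrightarrow> c x < c y" for x y
    using assms(2) unfolding realises_iff[OF assms(1)] arcs_on_def by auto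
  have "(x, y) \<in> (arcs_on adj D l W)\<^sup>+ \<Longrightarrow> c x < c y" for x y
    by (induction rule: trancl_induct) (auto dest: arc intro: less_trans)
  then show ?thesis unfolding acyclic_def by blast
qed

lemma arcs_on_mono: "W \<subseteq> W' \<Longrightarrow> arcs_on adj D l W \<subseteq> arcs_on adj D l W'"
  by (auto simp: arcs_on_def)

text \<open>Supplies the next vertex of the topological sort.\<close>

lemma acyclic_source:
  assumes "finite W" "W \<noteq> {}" "acyclic (arcs_on adj D l W)"
  shows "\<exists>z\<in>W. \<forall>x\<in>W. \<not> arc adj D l x z"
proof -
  have "finite (arcs_on adj D l W)"
    by (rule finite_subset[of _ "W \<times> W"]) (auto simp: arcs_on_def assms(1))
  then have "wf (arcs_on adj D l W)" using assms(3) by (rule finite_acyclic_wf)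
  then show ?thesis
  proof (rule wfE_min'[OF _ assms(2)])
    fix z assume z: "z \<in> W" "\<And>y. (y, z) \<in> arcs_on adj D l W \<Longrightarrow> y \<notin> W"
    have "\<not> arc adj D l x z" if "x \<in> W" for x
      using z(1) z(2)[of x] that by (auto simp: arcs_on_def)
    with z(1) show ?thesis by blast
  qed
qed

section \<open>Acyclicity by a finite automaton\<close>

text \<open>
  When vertices are appended one at a time and the arcs between an old vertex and the new one
  only depend on the class of the old vertex, all that has to be remembered is between which
  classes there are paths.
\<close>

definition reach :: "'a set \<Rightarrow> 'a rel \<Rightarrow> ('a \<Rightarrow> 'g) \<Rightarrow> 'g rel" where
  "reach W F g = {(g x, g y) |x y. x \<in> W \<and> y \<in> W \<and> (x, y) \<in> F\<^sup>*}"

text \<open>\<open>fw\<close> tells from which classes the new vertex receives an arc,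
  \<open>bw\<close> to which classes it sends one. The condition describes a closed walk through the
  new vertex.\<close>

definition dead :: "('g \<Rightarrow> bool) \<Rightarrow> ('g \<Rightarrow> bool) \<Rightarrow> 'g rel \<Rightarrow> bool" where
  "dead fw bw R \<longleftrightarrow> (\<exists>d c. bw d \<and> (d, c) \<in> R \<and> fw c)"

text \<open>New paths run through the new vertex, whose class \<open>\<gamma>\<close> counts both as
  reaching it and as reached. Two paths are never joined at a mere class, which would be unsound as
  they may end and start at different vertices; an arc to the new vertex, however, exists at every
  vertex of a class satisfying \<open>fw\<close>, in particular at the end of the path recorded in
  \<open>R\<close>.\<close>

definition upd :: "('g \<Rightarrow> bool) \<Rightarrow> ('g \<Rightarrow> bool) \<Rightarrow> 'g \<Rightarrow> 'g rel \<Rightarrow> 'g rel" where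
  "upd fw bw \<gamma> R = R \<union>
     insert \<gamma> {a. \<exists>c. (a, c) \<in> R \<and> fw c} \<times> insert \<gamma> {b. \<exists>d. bw d \<and> (d, b) \<in> R}"

locale append_vertex =
  fixes W :: "'a set" and z :: 'a and F :: "'a rel" and g :: "'a \<Rightarrow> 'g"
    and fw bw :: "'g \<Rightarrow> bool" and F' :: "'a rel"
  assumes F: "F \<subseteq> W \<times> W" and z: "z \<notin> W"
    and F': "F' = F \<union> {(x, z) |x. x \<in> W \<and> fw (g x)} \<union> {(z, x) |x. x \<in> W \<and> bw (g x)}"
begin

lemma FF': "(x, y) \<in> F\<^sup>* \<Longrightarrow> (x, y) \<in> F'\<^sup>*"
  using rtrancl_mono[of F F'] F' by auto

lemma in_W: "(x, y) \<in> F\<^sup>* \<Longrightarrow> x \<in> W \<Longrightarrow> y \<in> W"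
  by (induction rule: rtrancl_induct) (use F in auto)

text \<open>Cutting the path at its first visit to \<open>z\<close> leaves a path of old
  arcs.\<close>

lemma to_z:
  assumes "(x, z) \<in> F'\<^sup>*"
  shows "x = z \<or> (\<exists>c. (x, c) \<in> F\<^sup>* \<and> c \<in> W \<and> fw (g c))"
  using assms
proof (induction rule: converse_rtrancl_induct)
  case (step x y)
  show ?case
  proof (cases "x = z")
    case False
    with step(1) F' consider "(x, y) \<in> F" | "y = z" "x \<in> W" "fw (g x)" by auto
    then show ?thesis
    proof cases
      case 1
      then have "y \<noteq> z" using F z by auto
      with step(3) 1 show ?thesis by (meson converse_rtrancl_into_rtrancl)
    qed blast
  qed simp
qed simp

lemma from_z:
  assumes "(z, y) \<in> F'\<^sup>*"
  shows "y = z \<or> (\<exists>d. (d, y) \<in> F\<^sup>* \<and> d \<in> W \<and> bw (g d))"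
  using assms
proof (induction rule: rtrancl_induct)
  case (step x y)
  show ?case
  proof (cases "y = z")
    case False
    with step(2) F' consider "(x, y) \<in> F" | "x = z" "y \<in> W" "bw (g y)" by auto
    then show ?thesis
    proof cases
      case 1
      then have "x \<noteq> z" using F z by auto
      with step(3) 1 show ?thesis by (meson rtrancl.rtrancl_into_rtrancl)
    qed blast
  qed simp
qed simp

lemma through_z:
  assumes "(x, y) \<in> F'\<^sup>*"
  shows "(x, y) \<in> F\<^sup>* \<or> (x, z) \<in> F'\<^sup>* \<and> (z, y) \<in> F'\<^sup>*"
  using assms
proof (induction rule: rtrancl_induct)
  case (step y w)
  have yw: "(y, w) \<in> F'\<^sup>*" using step(2) by blast
  from step(3) show ?case
  proof
    assume xy: "(x, y) \<in> F\<^sup>*"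
    show ?thesis
    proof (cases "(y, w) \<in> F")
      case True
      with xy show ?thesis by (meson rtrancl.rtrancl_into_rtrancl)
    next
      case False
      with step(2) F' have "y = z \<or> w = z" by auto
      with step(1) yw show ?thesis by (auto intro: rtrancl_trans)
    qed
  qed (use yw in \<open>auto intro: rtrancl_trans\<close>)
qed simp

lemma to_zI: "(x, c) \<in> F\<^sup>* \<Longrightarrow> c \<in> W \<Longrightarrow> fw (g c) \<Longrightarrow> (x, z) \<in> F'\<^sup>*"
  using F' FF'[of x c] by (auto intro: rtrancl_into_rtrancl)

lemma from_zI: "(d, y) \<in> F\<^sup>* \<Longrightarrow> d \<in> W \<Longrightarrow> bw (g d) \<Longrightarrow> (z, y) \<in> F'\<^sup>*"
  using F' FF'[of d y] by (auto intro: converse_rtrancl_into_rtrancl)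

text \<open>A path avoiding \<open>z\<close> is old, and any other splits at \<open>z\<close> into a
  part entering it and a part leaving it; both parts are described by classes alone.\<close>

lemma reach_insert: "reach (insert z W) F' g = upd fw bw (g z) (reach W F g)"
proof -
  let ?In = "insert (g z) {a. \<exists>c. (a, c) \<in> reach W F g \<and> fw c}"
  let ?Out = "insert (g z) {b. \<exists>d. bw d \<and> (d, b) \<in> reach W F g}"
  have In: "a \<in> ?In \<longleftrightarrow> (\<exists>x\<in>insert z W. g x = a \<and> (x, z) \<in> F'\<^sup>*)" for a
  proof
    assume "a \<in> ?In"
    then show "\<exists>x\<in>insert z W. g x = a \<and> (x, z) \<in> F'\<^sup>*"
      by (auto simp: reach_def intro: to_zI)
  next
    assume "\<exists>x\<in>insert z W. g x = a \<and> (x, z) \<in> F'\<^sup>*"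
    then show "a \<in> ?In" using to_z by (fastforce simp: reach_def)
  qed
  have Out: "b \<in> ?Out \<longleftrightarrow> (\<exists>y\<in>insert z W. g y = b \<and> (z, y) \<in> F'\<^sup>*)" for b
  proof
    assume "b \<in> ?Out"
    then show "\<exists>y\<in>insert z W. g y = b \<and> (z, y) \<in> F'\<^sup>*"
      by (auto simp: reach_def intro: from_zI)
  next
    assume "\<exists>y\<in>insert z W. g y = b \<and> (z, y) \<in> F'\<^sup>*"
    then show "b \<in> ?Out" using from_z in_W by (fastforce simp: reach_def)
  qed
  show ?thesis
  proof (intro set_eqI iffI)
    fix p assume "p \<in> reach (insert z W) F' g"
    then obtain x y where p: "p = (g x, g y)" "x \<in> insert z W" "y \<in> insert z W" "(x, y) \<in> F'\<^sup>*"
      by (auto simp: reach_def)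
    show "p \<in> upd fw bw (g z) (reach W F g)"
    proof (cases "(x, z) \<in> F'\<^sup>* \<and> (z, y) \<in> F'\<^sup>*")
      case True
      then have "g x \<in> ?In" "g y \<in> ?Out" using In Out p by blast+
      then show ?thesis unfolding upd_def p(1) by blast
    next
      case False
      with through_z[OF p(4)] p(4) have "(x, y) \<in> F\<^sup>*" "x \<noteq> z" "y \<noteq> z" by auto
      with p show ?thesis by (auto simp: upd_def reach_def)
    qed
  next
    fix p assume "p \<in> upd fw bw (g z) (reach W F g)"
    then have "p \<in> reach W F g \<or> p \<in> ?In \<times> ?Out" unfolding upd_def by (rule UnE) auto
    then consider "p \<in> reach W F g" | "fst p \<in> ?In" "snd p \<in> ?Out"
      unfolding mem_Times_iff by blast
    then show "p \<in> reach (insert z W) F' g"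
    proof cases
      case 1
      then show ?thesis by (auto simp: reach_def intro: FF')
    next
      case 2
      then obtain x y where xy: "x \<in> insert z W" "g x = fst p" "(x, z) \<in> F'\<^sup>*"
        "y \<in> insert z W" "g y = snd p" "(z, y) \<in> F'\<^sup>*" unfolding In Out by blast
      then have "(x, y) \<in> F'\<^sup>*" by (blast intro: rtrancl_trans)
      with xy(1,4) have "(g x, g y) \<in> reach (insert z W) F' g" unfolding reach_def by blast
      then show ?thesis using xy(2,5) by simp
    qed
  qed
qed

text \<open>A cycle that is not old passes through \<open>z\<close>; it leaves \<open>z\<close>
  along a \<open>bw\<close> arc and returns along an \<open>fw\<close> arc.\<close>

lemma acyclic_insert: "acyclic F' \<longleftrightarrow> acyclic F \<and> \<not> dead fw bw (reach W F g)"
proof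
  assume a: "acyclic F'"
  have "acyclic F" using a F' by (auto intro: acyclic_subset)
  moreover have "\<not> dead fw bw (reach W F g)"
  proof
    assume "dead fw bw (reach W F g)"
    then obtain d c where "d \<in> W" "c \<in> W" "(d, c) \<in> F\<^sup>*" "bw (g d)" "fw (g c)"
      by (auto simp: dead_def reach_def)
    then have "(z, d) \<in> F'" "(d, z) \<in> F'\<^sup>*" using F' to_zI[of d c] by blast+
    then have "(z, z) \<in> F'\<^sup>+" by (rule rtrancl_into_trancl2)
    with a show False by (auto simp: acyclic_def)
  qed
  ultimately show "acyclic F \<and> \<not> dead fw bw (reach W F g)" ..
next
  assume a: "acyclic F \<and> \<not> dead fw bw (reach W F g)"
  \<comment> \<open>Another vertex on a closed walk through \<open>z\<close> would witness
    \<open>dead\<close>. Every cycle below reduces to this case or to a cycle of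
    \<open>F\<close>.\<close>
  have nz: "\<not> ((z, d) \<in> F'\<^sup>* \<and> (d, z) \<in> F'\<^sup>* \<and> d \<noteq> z)" for d
  proof
    assume "(z, d) \<in> F'\<^sup>* \<and> (d, z) \<in> F'\<^sup>* \<and> d \<noteq> z"
    with to_z from_z obtain e c where "(d, c) \<in> F\<^sup>*" "c \<in> W" "fw (g c)" "(e, d) \<in> F\<^sup>*" "e \<in> W" "bw (g e)"
      by metis
    then have "dead fw bw (reach W F g)"
      unfolding dead_def reach_def by (blast intro: rtrancl_trans)
    with a show False by blast
  qed
  show "acyclic F'" unfolding acyclic_def
  proof (intro allI notI)
    fix x assume "(x, x) \<in> F'\<^sup>+"
    then obtain y where y: "(x, y) \<in> F'" "(y, x) \<in> F'\<^sup>*" by (meson tranclD)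
    have zz: "(z, z) \<notin> F'" using F' F z by auto
    show False
    proof (cases "x = z")
      case True
      with y zz nz[of y] show ?thesis by (metis r_into_rtrancl)
    next
      case False
      with y nz[of x] have "(y, x) \<in> F\<^sup>*" using through_z[OF y(2)]
        by (meson converse_rtrancl_into_rtrancl)
      moreover have "y \<noteq> z" using False nz[of x] y by (metis r_into_rtrancl)
      with y(1) False F' have "(x, y) \<in> F" by auto
      ultimately have "(x, x) \<in> F\<^sup>+" by (rule rtrancl_into_trancl2[rotated])
      with a show ?thesis by (auto simp: acyclic_def)
    qed
  qed
qed

end

text \<open>
  The class of a vertex of type \<open>t\<close> and label \<open>a < K\<close> is the number \<open>t * K + a\<close>; \<open>T t t'\<close> is the
  adjacency of a vertex of type \<open>t\<close> to any later vertex of type \<open>t'\<close>.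
\<close>

locale labelling =
  fixes K :: nat and T D :: "nat \<Rightarrow> nat \<Rightarrow> bool" and ty :: "nat \<Rightarrow> nat"
  assumes K: "0 < K"
begin

definition fwd :: "nat \<Rightarrow> nat \<Rightarrow> bool" where
  "fwd \<gamma> h \<longleftrightarrow> T (h div K) (\<gamma> div K) \<noteq> D (\<gamma> mod K) (h mod K)"

definition bwd :: "nat \<Rightarrow> nat \<Rightarrow> bool" where
  "bwd \<gamma> h \<longleftrightarrow> T (h div K) (\<gamma> div K) \<noteq> D (h mod K) (\<gamma> mod K)"

abbreviation dies :: "nat \<Rightarrow> nat rel \<Rightarrow> bool" where
  "dies \<gamma> R \<equiv> dead (fwd \<gamma>) (bwd \<gamma>) R"

abbreviation nxt :: "nat \<Rightarrow> nat rel \<Rightarrow> nat rel" where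
  "nxt \<gamma> R \<equiv> upd (fwd \<gamma>) (bwd \<gamma>) \<gamma> R"

primrec alive :: "(nat \<Rightarrow> nat) \<Rightarrow> nat list \<Rightarrow> nat rel \<Rightarrow> bool" where
  "alive l [] R \<longleftrightarrow> True"
| "alive l (x # xs) R \<longleftrightarrow>
     \<not> dies (ty x * K + l x) R \<and> alive l xs (nxt (ty x * K + l x) R)"

primrec good :: "nat list \<Rightarrow> nat rel \<Rightarrow> bool" where
  "good [] R \<longleftrightarrow> True"
| "good (x # xs) R \<longleftrightarrow> (\<exists>a<K. \<not> dies (ty x * K + a) R \<and> good xs (nxt (ty x * K + a) R))"

lemma alive_cong: "(\<And>x. x \<in> set xs \<Longrightarrow> l x = l' x) \<Longrightarrow> alive l xs R \<longleftrightarrow> alive l' xs R"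
  by (induction xs arbitrary: R) auto

text \<open>\<open>good\<close> guesses a letter whenever a vertex is read; since no vertex is read
  twice, the guesses combine to one labelling.\<close>

lemma good_iff:
  "distinct xs \<Longrightarrow> good xs R \<longleftrightarrow> (\<exists>l. (\<forall>x\<in>set xs. l x < K) \<and> alive l xs R)"
proof (induction xs arbitrary: R)
  case (Cons x xs)
  show ?case
  proof
    assume "good (x # xs) R"
    then obtain a l where "a < K" "\<not> dies (ty x * K + a) R" "\<forall>y\<in>set xs. l y < K"
      "alive l xs (nxt (ty x * K + a) R)" using Cons by auto
    moreover from this Cons.prems have "alive (l(x := a)) xs (nxt (ty x * K + a) R)"
      by (subst alive_cong[of _ _ l]) auto
    ultimately show "\<exists>l. (\<forall>y\<in>set (x # xs). l y < K) \<and> alive l (x # xs) R"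
      by (intro exI[of _ "l(x := a)"]) auto
  qed (use Cons in auto)
qed simp

text \<open>The state after reading \<open>ys\<close> is the reachability relation of its classes.
  \<open>T\<close> may replace \<open>adj\<close> because types determine adjacency along the word,
  and a cycle once closed persists in every longer word.\<close>

lemma alive_iff_acyclic:
  assumes sym: "\<And>x y. adj x y = adj y x"
    and lK: "\<And>x. x \<in> set (ys @ xs) \<Longrightarrow> l x < K"
    and "distinct (ys @ xs)"
    and "sorted_wrt (\<lambda>x z. T (ty x) (ty z) = adj x z) (ys @ xs)"
    and "acyclic (arcs_on adj D l (set ys))"
  shows "alive l xs (reach (set ys) (arcs_on adj D l (set ys)) (\<lambda>x. ty x * K + l x)) \<longleftrightarrow>
    acyclic (arcs_on adj D l (set (ys @ xs)))"
  using assms(2-)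
proof (induction xs arbitrary: ys)
  case (Cons z xs)
  let ?g = "\<lambda>x. ty x * K + l x"
  let ?F = "\<lambda>ys. arcs_on adj D l (set ys)"
  have g: "?g x div K = ty x" "?g x mod K = l x" if "x \<in> set (ys @ z # xs)" for x
    using Cons.prems(1)[OF that] by auto
  have T: "T (ty x) (ty z) = adj x z" if "x \<in> set ys" for x
    using Cons.prems(3) that by (auto simp: sorted_wrt_append)
  have fw: "fwd (?g z) (?g x) \<longleftrightarrow> arc adj D l x z" and bw: "bwd (?g z) (?g x) \<longleftrightarrow> arc adj D l z x"
    if "x \<in> set ys" for x
    using that g[of x] g[of z] T[OF that] sym[of x z] Cons.prems(2)
    by (auto simp: fwd_def bwd_def arc_def)
  interpret append_vertex "set ys" z "?F ys" ?g "fwd (?g z)" "bwd (?g z)" "?F (ys @ [z])"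
  proof
    show "?F ys \<subseteq> set ys \<times> set ys" by (auto simp: arcs_on_def)
    show "z \<notin> set ys" using Cons.prems(2) by auto
    have "\<not> arc adj D l z z" by (simp add: arc_def)
    then show "?F (ys @ [z]) = ?F ys \<union> {(x, z) |x. x \<in> set ys \<and> fwd (?g z) (?g x)} \<union>
        {(z, x) |x. x \<in> set ys \<and> bwd (?g z) (?g x)}"
      using fw bw by (auto simp: arcs_on_def)
  qed
  have ins: "set (ys @ [z]) = insert z (set ys)" by simp
  have sub: "acyclic (?F (ys @ z # xs)) \<Longrightarrow> acyclic (?F (ys @ [z]))"
    by (rule acyclic_subset) (auto intro!: arcs_on_mono)
  show ?case
  proof (cases "dies (?g z) (reach (set ys) (?F ys) ?g)")
    case True
    then show ?thesis using acyclic_insert sub by auto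
  next
    case False
    then have "acyclic (?F (ys @ [z]))" using acyclic_insert Cons.prems(4) by simp
    from Cons.IH[of "ys @ [z]", OF _ _ _ this] Cons.prems False show ?thesis
      using reach_insert by simp
  qed
qed simp

lemma good_iff_acyclic:
  assumes "\<And>x y. adj x y = adj y x" "distinct xs"
    "sorted_wrt (\<lambda>x z. T (ty x) (ty z) = adj x z) xs"
  shows "good xs {} \<longleftrightarrow> (\<exists>l. (\<forall>x\<in>set xs. l x < K) \<and> acyclic (arcs_on adj D l (set xs)))"
proof -
  have "alive l xs {} \<longleftrightarrow> acyclic (arcs_on adj D l (set xs))" if "\<forall>x\<in>set xs. l x < K" for l
    using alive_iff_acyclic[of adj "[]" xs l] assms that by (simp add: reach_def arcs_on_def acyclic_def)
  then show ?thesis unfolding good_iff[OF assms(2)] by blast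
qed

end

section \<open>Letter graphs as words\<close>

lemma pair_graph_iff:
  "pair_graph G \<longleftrightarrow> finite (pverts G) \<and> parcs G \<subseteq> pverts G \<times> pverts G \<and> sym (parcs G) \<and>
     (\<forall>x. (x, x) \<notin> parcs G)"
proof
  assume "pair_graph G"
  then interpret pair_graph G .
  have "sym (parcs G)" using pair_sym_arcs by (simp add: symmetric_def)
  then show "finite (pverts G) \<and> parcs G \<subseteq> pverts G \<times> pverts G \<and> sym (parcs G) \<and>
     (\<forall>x. (x, x) \<notin> parcs G)"
    using pair_finite_verts by (auto dest: in_arcsD1 in_arcsD2 pair_no_loops)
next
  assume G: "finite (pverts G) \<and> parcs G \<subseteq> pverts G \<times> pverts G \<and> sym (parcs G) \<and>
     (\<forall>x. (x, x) \<notin> parcs G)"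
  then have "finite (parcs G)" by (meson finite_SigmaI finite_subset)
  with G show "pair_graph G"
    by unfold_locales (auto simp: symmetric_def)
qed

text \<open>Replaces the library's isomorphisms, which map vertices, arcs, heads and tails, by
  bijections that preserve adjacency.\<close>

lemma class_iso:
  assumes C: "graph_class C" and G: "G \<in> C" and H: "pair_graph H"
    and f: "bij_betw f (pverts G) (pverts H)"
    and arcs: "\<And>x y. x \<in> pverts G \<Longrightarrow> y \<in> pverts G \<Longrightarrow> (x, y) \<in> parcs G \<longleftrightarrow> (f x, f y) \<in> parcs H"
  shows "H \<in> C"
proof -
  have pG: "pair_graph G" using C G by (simp add: graph_class_def)
  have sG: "parcs G \<subseteq> pverts G \<times> pverts G" and sH: "parcs H \<subseteq> pverts H \<times> pverts H"
    using pG H by (simp_all add: pair_graph_iff)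
  interpret pair_graph G by (rule pG)
  define h :: "(nat, nat \<times> nat, nat, nat \<times> nat) digraph_isomorphism" where
    "h = \<lparr>iso_verts = f, iso_arcs = map_prod f f, iso_head = snd, iso_tail = fst\<rparr>"
  have inj: "inj_on f (pverts G)" and im: "f ` pverts G = pverts H" using f by (auto simp: bij_betw_def)
  have "map_prod f f ` parcs G = parcs H"
  proof (intro set_eqI iffI)
    fix e assume "e \<in> map_prod f f ` parcs G"
    then show "e \<in> parcs H" using arcs sG by auto
  next
    fix e assume e: "e \<in> parcs H"
    then have "fst e \<in> f ` pverts G" "snd e \<in> f ` pverts G" using sH im by auto
    then obtain x y where xy: "x \<in> pverts G" "y \<in> pverts G" "e = (f x, f y)"
      by (metis imageE prod.collapse)
    then have "(x, y) \<in> parcs G" using arcs e by simp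
    moreover have "e = map_prod f f (x, y)" using xy(3) by simp
    ultimately show "e \<in> map_prod f f ` parcs G" by (rule rev_image_eqI)
  qed
  then have "with_proj H = app_iso h (with_proj G)"
    by (simp add: app_iso_def h_def with_proj_def im)
  moreover have "inj_on (map_prod f f) (parcs G)"
    using inj_on_subset[OF map_prod_inj_on[OF inj inj] sG] .
  then have "pre_digraph.digraph_isomorphism (with_proj G) h"
    using inj by (simp add: pre_digraph.digraph_isomorphism_def h_def wf_digraph_wp_iff pair_wf_digraph_axioms)
  ultimately have "digraph_iso (with_proj G) (with_proj H)" by (auto simp: digraph_iso_def)
  then show ?thesis using C G H unfolding graph_class_def by blast
qed

section \<open>Graphs of words and forbidden subwords\<close>

definition word_graph :: "('s \<Rightarrow> 's \<Rightarrow> bool) \<Rightarrow> 's list \<Rightarrow> nat pair_pre_digraph" where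
  "word_graph D w = \<lparr>pverts = {0..<length w}, parcs = {(i, j). i < length w \<and> j < length w \<and>
     (i < j \<and> D (w ! i) (w ! j) \<or> j < i \<and> D (w ! j) (w ! i))}\<rparr>"

lemma pair_graph_word: "pair_graph (word_graph D w)"
  by (auto simp: pair_graph_iff word_graph_def sym_def)

lemma word_graph_delete:
  assumes C: "graph_class C" "hereditary C" and G: "word_graph D (xs @ a # ys) \<in> C"
  shows "word_graph D (xs @ ys) \<in> C"
proof -
  let ?G = "word_graph D (xs @ a # ys)" and ?p = "length xs"
  define H where "H = \<lparr>pverts = pverts ?G - {?p}, parcs = {e \<in> parcs ?G. fst e \<noteq> ?p \<and> snd e \<noteq> ?p}\<rparr>"
  have "with_proj H = pre_digraph.del_vert (with_proj ?G) ?p"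
    by (simp add: H_def pre_digraph.del_vert_def with_proj_def)
  moreover have "?p \<in> pverts ?G" by (simp add: word_graph_def)
  ultimately have "H \<in> C" using C(2) G unfolding hereditary_def by blast
  \<comment> \<open>\<open>f\<close> closes the gap left by the deleted position and keeps the order
    of the others.\<close>
  moreover define f where "f i = (if i < ?p then i else i - 1)" for i
  have inj: "inj_on f (pverts H)" by (auto simp: inj_on_def f_def H_def word_graph_def split: if_splits)
  have le: "f ` pverts H \<subseteq> {0..<length (xs @ ys)}"
    by (auto simp: f_def H_def word_graph_def)
  have "card (pverts H) = length (xs @ ys)" by (simp add: H_def word_graph_def)
  then have "card (f ` pverts H) = length (xs @ ys)" using inj by (simp add: card_image)
  then have "f ` pverts H = {0..<length (xs @ ys)}"
    using le by (intro card_subset_eq) auto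
  then have bij: "bij_betw f (pverts H) (pverts (word_graph D (xs @ ys)))"
    using inj by (simp add: bij_betw_def word_graph_def)
  have nth: "(xs @ ys) ! f i = (xs @ a # ys) ! i" if "i \<noteq> ?p" for i
    using that by (auto simp: f_def nth_append)
  have less: "f i < f j \<longleftrightarrow> i < j" if "i \<noteq> ?p" "j \<noteq> ?p" for i j
    using that by (auto simp: f_def)
  have "(x, y) \<in> parcs H \<longleftrightarrow> (f x, f y) \<in> parcs (word_graph D (xs @ ys))"
    if "x \<in> pverts H" "y \<in> pverts H" for x y
  proof -
    have "x \<noteq> ?p" "y \<noteq> ?p" "f x < length (xs @ ys)" "f y < length (xs @ ys)"
      using that le by (auto simp: H_def)
    then show ?thesis using that nth less by (auto simp: H_def word_graph_def)
  qed
  ultimately show ?thesis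
    using class_iso[OF C(1) \<open>H \<in> C\<close> pair_graph_word bij] by blast
qed

text \<open>Embeddings are taken apart from the front, whereas vertices are deleted inside the word;
  \<open>pre\<close> collects the letters already kept.\<close>

lemma word_graph_subseq:
  assumes C: "graph_class C" "hereditary C"
  shows "subseq u w \<Longrightarrow> word_graph D (pre @ w) \<in> C \<Longrightarrow> word_graph D (pre @ u) \<in> C"
proof (induction arbitrary: pre rule: list_emb.induct)
  case (list_emb_Nil ys)
  then show ?case
  proof (induction ys)
    case (Cons y ys)
    then show ?case using word_graph_delete[OF C, of D pre y ys] by simp
  qed simp
next
  case (list_emb_Cons xs ys y)
  then show ?case using word_graph_delete[OF C, of D pre y ys] by simp
next
  case (list_emb_Cons2 x y xs ys)
  then show ?case using list_emb_Cons2.IH[of "pre @ [x]"] by simp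
qed

text \<open>The words whose graph lies outside the class are closed under superwords, so a finite
  basis of this set decides membership. The decoder is fixed, hence each decoder gets a list of its
  own.\<close>

lemma forbidden_words:
  assumes C: "graph_class C" "hereditary C" and "finite A"
  shows "\<exists>F. finite F \<and>
    (\<forall>w\<in>lists A. word_graph D w \<in> C \<longleftrightarrow> \<not> (\<exists>u\<in>F. subseq u w))"
proof -
  let ?U = "{w \<in> lists A. word_graph D w \<notin> C}"
  obtain F where F: "finite F" "F \<subseteq> ?U" "\<forall>w\<in>?U. \<exists>u\<in>F. subseq u w"
    using finite_basis[OF assms(3), of ?U] by blast
  have "word_graph D w \<in> C \<longleftrightarrow> \<not> (\<exists>u\<in>F. subseq u w)" if "w \<in> lists A" for w
  proof
    assume "word_graph D w \<in> C"
    then show "\<not> (\<exists>u\<in>F. subseq u w)"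
      using word_graph_subseq[OF C, of _ w D "[]"] F(2) by auto
  next
    assume "\<not> (\<exists>u\<in>F. subseq u w)"
    with F(3) that show "word_graph D w \<in> C" by blast
  qed
  with F(1) show ?thesis by blast
qed

text \<open>Normal form of \<open>k_letter_graph\<close>: the alphabet is an initial segment of the
  numbers and the decoder a predicate on it.\<close>

definition labels_exist :: "nat \<Rightarrow> nat \<Rightarrow> nat pair_pre_digraph \<Rightarrow> bool" where
  "labels_exist K n G \<longleftrightarrow> (\<exists>(D :: nat \<Rightarrow> nat \<Rightarrow> bool) l c. (\<forall>x<n. l x < K) \<and>
     bij_betw c {0..<n} {1..n} \<and> realises (\<lambda>x y. (x, y) \<in> parcs G) D l c {0..<n})"

text \<open>The \<open>k - K\<close> additional letters are isolated in the decoder and label no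
  vertex.\<close>

lemma realisation_from_labels:
  assumes "pverts G = {0..<n}" "\<forall>x<n. l x < K" "K \<le> k" "bij_betw c {0..<n} {1..n}"
    "realises (\<lambda>x y. (x, y) \<in> parcs G) D l c {0..<n}"
  shows "k_letter_realisation k
    \<lparr>pverts = {0..<k}, parcs = {(a, b). a < K \<and> b < K \<and> D a b}\<rparr> l c G"
proof -
  have "finite {(a, b). a < K \<and> b < K \<and> D a b}"
    by (rule finite_subset[of _ "{..<K} \<times> {..<K}"]) auto
  then have "pair_fin_digraph \<lparr>pverts = {0..<k}, parcs = {(a, b). a < K \<and> b < K \<and> D a b}\<rparr>"
    using assms(3) by unfold_locales auto
  moreover have "l ` {0..<n} \<subseteq> {0..<k}" using assms(2,3) by force
  ultimately show ?thesis
    using assms unfolding k_letter_realisation_def letter_realisation_def realises_def by auto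
qed

lemma k_letter_graph_iff:
  assumes "pverts G = {0..<n}"
  shows "k_letter_graph K G \<longleftrightarrow> labels_exist K n G"
proof
  assume "k_letter_graph K G"
  then obtain D :: "nat pair_pre_digraph" and l c where
    D: "card (pverts D) = K" "letter_realisation D l c G"
    by (auto simp: k_letter_graph_def k_letter_realisation_def)
  then have fin: "finite (pverts D)"
    by (auto simp: letter_realisation_def intro: pair_fin_digraph.pair_finite_verts)
  obtain h where h: "bij_betw h (pverts D) {0..<K}"
    using ex_bij_betw_finite_nat[OF fin] D(1) by auto
  define D' where "D' a b \<longleftrightarrow> (\<exists>s\<in>pverts D. \<exists>t\<in>pverts D. h s = a \<and> h t = b \<and> (s, t) \<in> parcs D)" for a b
  have lD: "l x \<in> pverts D" if "x < n" for x
    using D(2) that assms by (auto simp: letter_realisation_def)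
  have D': "D' (h s) (h t) \<longleftrightarrow> (s, t) \<in> parcs D" if "s \<in> pverts D" "t \<in> pverts D" for s t
    using h that by (auto simp: D'_def bij_betw_def dest: inj_onD)
  have "\<forall>x<n. (h \<circ> l) x < K" using lD h by (auto simp: bij_betw_def)
  moreover have c: "bij_betw c {0..<n} {1..n}" using D(2) assms by (simp add: letter_realisation_def)
  moreover have "realises (\<lambda>x y. (x, y) \<in> parcs G) D' (h \<circ> l) c {0..<n}"
    unfolding realises_def
  proof (intro conjI ballI impI)
    show "inj_on c {0..<n}" using c by (simp add: bij_betw_def)
    fix x y assume xy: "x \<in> {0..<n}" "y \<in> {0..<n}" "x \<noteq> y"
    have "D' ((h \<circ> l) x) ((h \<circ> l) y) \<longleftrightarrow> (l x, l y) \<in> parcs D"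
      "D' ((h \<circ> l) y) ((h \<circ> l) x) \<longleftrightarrow> (l y, l x) \<in> parcs D"
      using xy lD by (simp_all add: D')
    then show "(x, y) \<in> parcs G \<longleftrightarrow> D' ((h \<circ> l) x) ((h \<circ> l) y) \<and> c x < c y \<or>
        D' ((h \<circ> l) y) ((h \<circ> l) x) \<and> c y < c x"
      using D(2) xy unfolding letter_realisation_def assms by blast
  qed
  ultimately show "labels_exist K n G" unfolding labels_exist_def by blast
next
  assume "labels_exist K n G"
  then show "k_letter_graph K G"
    using realisation_from_labels[OF assms] unfolding labels_exist_def k_letter_graph_def by blast
qed

lemma labels_exist_mono: "labels_exist K n G \<Longrightarrow> K \<le> K' \<Longrightarrow> labels_exist K' n G"
  unfolding labels_exist_def by (meson less_le_trans)

text \<open>Every vertex is its own letter and the graph its own decoder; by symmetry any order will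
  do. Hence the minimum defining \<open>lettericity\<close> is attained.\<close>

lemma labels_exist_self:
  assumes "pair_graph G"
  shows "labels_exist n n G"
proof -
  have sym: "(x, y) \<in> parcs G \<longleftrightarrow> (y, x) \<in> parcs G" for x y
    using assms by (auto simp: pair_graph_iff dest: symD)
  have "bij_betw Suc {0..<n} {1..n}"
    by (rule bij_betwI[of _ _ _ "\<lambda>x. x - 1"]) auto
  moreover have "realises (\<lambda>x y. (x, y) \<in> parcs G) (\<lambda>x y. (x, y) \<in> parcs G) (\<lambda>x. x) Suc {0..<n}"
    using sym by (auto simp: realises_def)
  ultimately show ?thesis unfolding labels_exist_def
    by (intro exI[of _ "\<lambda>x y. (x, y) \<in> parcs G"] exI[of _ "\<lambda>x. x"] exI[of _ Suc]) simp
qed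

lemma lettericity_le_iff:
  fixes G :: "nat pair_pre_digraph"
  assumes "pair_graph G" "pverts G = {0..<n}"
  shows "lettericity G \<le> k \<longleftrightarrow> k_letter_graph k G"
proof
  assume le: "lettericity G \<le> k"
  have "k_letter_graph (lettericity G) G" unfolding lettericity_def
    by (rule LeastI[of _ n]) (simp add: k_letter_graph_iff[OF assms(2)] labels_exist_self[OF assms(1)])
  with le show "k_letter_graph k G"
    unfolding k_letter_graph_iff[OF assms(2)] by (rule labels_exist_mono[rotated])
next
  assume "k_letter_graph k G"
  then show "lettericity G \<le> k" unfolding lettericity_def by (rule Least_le)
qed

text \<open>\<open>ord\<close> lists the vertices by position and \<open>c\<close> inverts it,
  shifted by one because positions start at 1. Pairs in the opposite order follow by symmetry of
  \<open>adj\<close>.\<close>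

lemma realises_order:
  assumes ord: "bij_betw ord {..<n} {..<n}" and c: "\<And>p. p < n \<Longrightarrow> c (ord p) = Suc p"
    and sym: "\<And>x y. adj x y = adj y x"
    and adj: "\<And>p q. p < n \<Longrightarrow> q < p \<Longrightarrow> adj (ord q) (ord p) = D (lab (ord q)) (lab (ord p))"
  shows "bij_betw c {0..<n} {1..n}" "realises adj D lab c {0..<n}"
proof -
  have ex: "\<exists>p<n. x = ord p" if "x < n" for x
    using ord that unfolding bij_betw_def by (metis imageE lessThan_iff)
  have on: "ord p < n" if "p < n" for p using ord that by (auto simp: bij_betw_def)
  have inj: "inj_on c {..<n}"
    unfolding inj_on_def using ex c by (metis Suc_inject lessThan_iff)
  have "c ` {..<n} = {1..n}"
  proof (intro set_eqI iffI)
    fix i assume "i \<in> c ` {..<n}"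
    then obtain x where "x < n" "i = c x" by auto
    with ex[of x] c show "i \<in> {1..n}" by auto
  next
    fix i assume "i \<in> {1..n}"
    then have i: "i - 1 < n" "i = Suc (i - 1)" by auto
    then have "c (ord (i - 1)) = i" using c by simp
    with on[OF i(1)] show "i \<in> c ` {..<n}" by (auto intro: rev_image_eqI)
  qed
  with inj show bc: "bij_betw c {0..<n} {1..n}" by (simp add: bij_betw_def atLeast0LessThan)
  show "realises adj D lab c {0..<n}"
    unfolding realises_def
  proof (intro conjI ballI impI)
    show "inj_on c {0..<n}" using bc by (simp add: bij_betw_def)
    fix x y assume xy: "x \<in> {0..<n}" "y \<in> {0..<n}" "x \<noteq> y"
    then obtain p q where pq: "p < n" "x = ord p" "q < n" "y = ord q" using ex[of x] ex[of y] by auto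
    then have "p \<noteq> q" using xy by auto
    then consider "p < q" | "q < p" by linarith
    then show "adj x y \<longleftrightarrow> D (lab x) (lab y) \<and> c x < c y \<or> D (lab y) (lab x) \<and> c y < c x"
    proof cases
      case 1
      then show ?thesis using adj[of q p] pq c by simp
    next
      case 2
      then show ?thesis using adj[of p q] pq c sym[of x y] by simp
    qed
  qed
qed

lemma word_labels:
  assumes "pair_graph G" "bij_betw ord {..<n} {..<n}" "\<forall>x<n. lab x < K"
    and "\<And>p q. p < n \<Longrightarrow> q < p \<Longrightarrow> (ord q, ord p) \<in> parcs G \<longleftrightarrow> D (lab (ord q)) (lab (ord p))"
  shows "labels_exist K n G"
proof -
  define c where "c x = Suc (the_inv_into {..<n} ord x)" for x
  have "c (ord p) = Suc p" if "p < n" for p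
    using assms(2) that by (simp add: c_def the_inv_into_f_f bij_betw_def)
  moreover have "(x, y) \<in> parcs G \<longleftrightarrow> (y, x) \<in> parcs G" for x y
    using assms(1) by (auto simp: pair_graph_iff dest: symD)
  ultimately have "bij_betw c {0..<n} {1..n}" "realises (\<lambda>x y. (x, y) \<in> parcs G) D lab c {0..<n}"
    using realises_order[OF assms(2), of c "\<lambda>x y. (x, y) \<in> parcs G" D lab] assms(4) by blast+
  then show ?thesis unfolding labels_exist_def using assms(3) by blast
qed

text \<open>\<open>ord\<close> is an isomorphism from the graph of the word onto \<open>G\<close>,
  so membership can be read off whichever realisation the search returns.\<close>

lemma word_class_iff:
  fixes lab :: "nat \<Rightarrow> 's"
  assumes C: "graph_class C" and G: "pair_graph G" "pverts G = {0..<n}"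
    and ord: "bij_betw ord {..<n} {..<n}"
    and adj: "\<And>p q. p < n \<Longrightarrow> q < p \<Longrightarrow> (ord q, ord p) \<in> parcs G \<longleftrightarrow> D (lab (ord q)) (lab (ord p))"
  shows "G \<in> C \<longleftrightarrow> word_graph D (map (lab \<circ> ord) [0..<n]) \<in> C"
proof -
  let ?W = "word_graph D (map (lab \<circ> ord) [0..<n])"
  have sym: "(x, y) \<in> parcs G \<longleftrightarrow> (y, x) \<in> parcs G" and irr: "(x, x) \<notin> parcs G" for x y
    using G(1) by (auto simp: pair_graph_iff dest: symD)
  have V: "pverts ?W = {..<n}" "pverts G = {..<n}" by (auto simp: word_graph_def G(2))
  have iff: "(p, q) \<in> parcs ?W \<longleftrightarrow> (ord p, ord q) \<in> parcs G" if "p < n" "q < n" for p q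
  proof -
    consider "p < q" | "q < p" | "p = q" by linarith
    then show ?thesis
      using that adj[of p q] adj[of q p] sym[of "ord p" "ord q"] irr
      by cases (auto simp: word_graph_def)
  qed
  show ?thesis
  proof
    assume "?W \<in> C"
    then show "G \<in> C"
      using ord iff by (intro class_iso[OF C _ G(1), of ?W ord]) (auto simp: V)
  next
    assume GC: "G \<in> C"
    define f where "f = the_inv_into {..<n} ord"
    have f: "bij_betw f {..<n} {..<n}" unfolding f_def by (rule bij_betw_the_inv_into[OF ord])
    have of: "ord (f x) = x" if "x < n" for x
      using ord that unfolding f_def by (metis bij_betw_def f_the_inv_into_f lessThan_iff)
    have fn: "f x < n" if "x < n" for x using f that by (auto simp: bij_betw_def)
    show "?W \<in> C"
      using f iff fn of by (intro class_iso[OF C GC pair_graph_word, of f]) (auto simp: V)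
  qed
qed

section \<open>A structured language for random access machines\<close>

text \<open>\<open>A a e\<close> is a cell of array \<open>a\<close>. \<open>EMin\<close> makes a
  bound on the assigned value visible in the syntax.\<close>

datatype exp =
    Num nat
  | V nat
  | A nat exp
  | Bin arith exp exp
  | EMin exp exp

text \<open>\<open>For x y c\<close> runs \<open>x\<close> from 0 to the value of \<open>y\<close>
  at entry, exclusively. With counted loops only, meaning, cost and safety are total and primitively
  recursive.\<close>

datatype com =
    SKIP
  | Asg nat exp
  | AAsg nat exp exp
  | Seq com com (infixr \<open>;;\<close> 60)
  | IF exp com com
  | For nat nat com
  | Rd nat
  | Wr exp

record st =
  sc :: "nat \<Rightarrow> nat"
  ar :: "nat \<Rightarrow> nat \<Rightarrow> nat"
  inp :: "nat list"
  outp :: "nat list"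

definition setv :: "nat \<Rightarrow> nat \<Rightarrow> st \<Rightarrow> st" where
  "setv x v s = s\<lparr>sc := (sc s)(x := v)\<rparr>"

definition seta :: "nat \<Rightarrow> nat \<Rightarrow> nat \<Rightarrow> st \<Rightarrow> st" where
  "seta a i v s = s\<lparr>ar := (ar s)(a := (ar s a)(i := v))\<rparr>"

definition incv :: "nat \<Rightarrow> st \<Rightarrow> st" where
  "incv x s = setv x (Suc (sc s x)) s"

lemma setv_simps [simp]:
  "sc (setv x v s) = (sc s)(x := v)" "ar (setv x v s) = ar s"
  "inp (setv x v s) = inp s" "outp (setv x v s) = outp s"
  by (simp_all add: setv_def)

lemma seta_simps [simp]:
  "sc (seta a i v s) = sc s" "ar (seta a i v s) = (ar s)(a := (ar s a)(i := v))"
  "inp (seta a i v s) = inp s" "outp (seta a i v s) = outp s"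
  by (simp_all add: seta_def)

lemma incv_simps [simp]:
  "sc (incv x s) = (sc s)(x := Suc (sc s x))" "ar (incv x s) = ar s"
  "inp (incv x s) = inp s" "outp (incv x s) = outp s"
  by (simp_all add: incv_def)

primrec eval :: "exp \<Rightarrow> st \<Rightarrow> nat" where
  "eval (Num m) s = m"
| "eval (V x) s = sc s x"
| "eval (A a e) s = ar s a (eval e s)"
| "eval (Bin b e f) s = arith_op b (eval e s) (eval f s)"
| "eval (EMin e f) s = min (eval e s) (eval f s)"

primrec loop :: "nat \<Rightarrow> (st \<Rightarrow> st) \<Rightarrow> nat \<Rightarrow> st \<Rightarrow> st" where
  "loop x f 0 s = setv x 0 s"
| "loop x f (Suc j) s = incv x (f (loop x f j s))"

primrec sem :: "com \<Rightarrow> st \<Rightarrow> st" where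
  "sem SKIP s = s"
| "sem (Asg x e) s = setv x (eval e s) s"
| "sem (AAsg a e f) s = seta a (eval e s) (eval f s) s"
| "sem (c ;; d) s = sem d (sem c s)"
| "sem (IF e c d) s = (if eval e s \<noteq> 0 then sem c s else sem d s)"
| "sem (For x y c) s = loop x (sem c) (sc s y) s"
| "sem (Rd x) s = (setv x (case inp s of [] \<Rightarrow> 0 | m # _ \<Rightarrow> m) s)\<lparr>inp := tl (inp s)\<rparr>"
| "sem (Wr e) s = s\<lparr>outp := outp s @ [eval e s]\<rparr>"

abbreviation iter :: "nat \<Rightarrow> com \<Rightarrow> st \<Rightarrow> nat \<Rightarrow> st" where
  "iter x c s j \<equiv> loop x (sem c) j s"

text \<open>Intermediate values count, including the address \<open>32 * i + a\<close> of an array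
  cell, since it passes through a register. A variable is always safe because the memory bound is an
  invariant, and a minimum adds no condition because both subtractions computing it stay below the
  first operand.\<close>

primrec exp_safe :: "nat \<Rightarrow> exp \<Rightarrow> st \<Rightarrow> bool" where
  "exp_safe B (Num m) s \<longleftrightarrow> m \<le> B"
| "exp_safe B (V x) s \<longleftrightarrow> True"
| "exp_safe B (A a e) s \<longleftrightarrow> exp_safe B e s \<and> 32 * eval e s + a \<le> B"
| "exp_safe B (Bin b e f) s \<longleftrightarrow> exp_safe B e s \<and> exp_safe B f s \<and> arith_op b (eval e s) (eval f s) \<le> B"
| "exp_safe B (EMin e f) s \<longleftrightarrow> exp_safe B e s \<and> exp_safe B f s"

primrec safe :: "nat \<Rightarrow> com \<Rightarrow> st \<Rightarrow> bool" where
  "safe B SKIP s \<longleftrightarrow> True"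
| "safe B (Asg x e) s \<longleftrightarrow> exp_safe B e s"
| "safe B (AAsg a e f) s \<longleftrightarrow> exp_safe B e s \<and> exp_safe B f s \<and> 32 * eval e s + a \<le> B"
| "safe B (c ;; d) s \<longleftrightarrow> safe B c s \<and> safe B d (sem c s)"
| "safe B (IF e c d) s \<longleftrightarrow> exp_safe B e s \<and> (if eval e s \<noteq> 0 then safe B c s else safe B d s)"
| "safe B (For x y c) s \<longleftrightarrow> (\<forall>j<sc s y. safe B c (iter x c s j))"
| "safe B (Rd x) s \<longleftrightarrow> (\<forall>m\<in>set (inp s). m \<le> B)"
| "safe B (Wr e) s \<longleftrightarrow> exp_safe B e s"

primrec exp_time :: "exp \<Rightarrow> nat" where
  "exp_time (Num m) = 1"
| "exp_time (V x) = 2"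
| "exp_time (A a e) = exp_time e + 5"
| "exp_time (Bin b e f) = exp_time e + exp_time f + 1"
| "exp_time (EMin e f) = exp_time e + exp_time f + 2"

text \<open>Counts instructions of the compiled code. A loop has one instruction to start, two per
  test and four to return to the test, hence 6 per round and 3 besides.\<close>

primrec time :: "com \<Rightarrow> st \<Rightarrow> nat" where
  "time SKIP s = 0"
| "time (Asg x e) s = exp_time e + 2"
| "time (AAsg a e f) s = exp_time e + exp_time f + 5"
| "time (c ;; d) s = time c s + time d (sem c s)"
| "time (IF e c d) s = exp_time e + 3 + (if eval e s \<noteq> 0 then time c s else time d s)"
| "time (For x y c) s = 3 + (\<Sum>j<sc s y. time c (iter x c s j) + 6)"
| "time (Rd x) s = 1"
| "time (Wr e) s = exp_time e + 1"

primrec reg_writes :: "com \<Rightarrow> nat set" where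
  "reg_writes SKIP = {}"
| "reg_writes (Asg x e) = {x}"
| "reg_writes (AAsg a e f) = {}"
| "reg_writes (c ;; d) = reg_writes c \<union> reg_writes d"
| "reg_writes (IF e c d) = reg_writes c \<union> reg_writes d"
| "reg_writes (For x y c) = insert x (reg_writes c)"
| "reg_writes (Rd x) = {x}"
| "reg_writes (Wr e) = {}"

primrec arr_writes :: "com \<Rightarrow> nat set" where
  "arr_writes SKIP = {}"
| "arr_writes (Asg x e) = {}"
| "arr_writes (AAsg a e f) = {a}"
| "arr_writes (c ;; d) = arr_writes c \<union> arr_writes d"
| "arr_writes (IF e c d) = arr_writes c \<union> arr_writes d"
| "arr_writes (For x y c) = arr_writes c"
| "arr_writes (Rd x) = {}"
| "arr_writes (Wr e) = {}"

primrec ewf :: "exp \<Rightarrow> bool" where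
  "ewf (Num m) \<longleftrightarrow> True"
| "ewf (V x) \<longleftrightarrow> True"
| "ewf (A a e) \<longleftrightarrow> 0 < a \<and> a < 31 \<and> ewf e"
| "ewf (Bin b e f) \<longleftrightarrow> ewf e \<and> ewf f"
| "ewf (EMin e f) \<longleftrightarrow> ewf e \<and> ewf f"

primrec wf_com :: "com \<Rightarrow> bool" where
  "wf_com SKIP \<longleftrightarrow> True"
| "wf_com (Asg x e) \<longleftrightarrow> ewf e"
| "wf_com (AAsg a e f) \<longleftrightarrow> 0 < a \<and> a < 31 \<and> ewf e \<and> ewf f"
| "wf_com (c ;; d) \<longleftrightarrow> wf_com c \<and> wf_com d"
| "wf_com (IF e c d) \<longleftrightarrow> ewf e \<and> wf_com c \<and> wf_com d"
| "wf_com (For x y c) \<longleftrightarrow> x \<noteq> y \<and> x \<notin> reg_writes c \<and> y \<notin> reg_writes c \<and> wf_com c"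
| "wf_com (Rd x) \<longleftrightarrow> True"
| "wf_com (Wr e) \<longleftrightarrow> ewf e"

primrec io_free :: "com \<Rightarrow> bool" where
  "io_free SKIP \<longleftrightarrow> True"
| "io_free (Asg x e) \<longleftrightarrow> True"
| "io_free (AAsg a e f) \<longleftrightarrow> True"
| "io_free (c ;; d) \<longleftrightarrow> io_free c \<and> io_free d"
| "io_free (IF e c d) \<longleftrightarrow> io_free c \<and> io_free d"
| "io_free (For x y c) \<longleftrightarrow> io_free c"
| "io_free (Rd x) \<longleftrightarrow> False"
| "io_free (Wr e) \<longleftrightarrow> False"

section \<open>Frame properties and loop invariants\<close>

lemma frame_sc: "x \<notin> reg_writes c \<Longrightarrow> sc (sem c s) x = sc s x"
proof (induction c arbitrary: s)
  case (For y z c)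
  have "sc (iter y c s j) x = sc s x" for j
    using For by (induction j) auto
  then show ?case by simp
qed auto

lemma frame_ar: "a \<notin> arr_writes c \<Longrightarrow> ar (sem c s) a = ar s a"
proof (induction c arbitrary: s)
  case (For y z c)
  have "ar (iter y c s j) a = ar s a" for j
    using For by (induction j) auto
  then show ?case by simp
qed auto

lemma frame_io: "io_free c \<Longrightarrow> inp (sem c s) = inp s \<and> outp (sem c s) = outp s"
proof (induction c arbitrary: s)
  case (For y z c)
  have "inp (iter y c s j) = inp s \<and> outp (iter y c s j) = outp s" for j
    using For by (induction j) auto
  then show ?case by simp
qed auto

lemma iter_counter: "x \<notin> reg_writes c \<Longrightarrow> sc (iter x c s j) x = j"
  by (induction j) (auto simp: frame_sc)

lemma iter_frame_sc: "z \<notin> reg_writes c \<Longrightarrow> z \<noteq> x \<Longrightarrow> sc (iter x c s j) z = sc s z"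
  by (induction j) (auto simp: frame_sc)

lemma iter_frame_ar: "a \<notin> arr_writes c \<Longrightarrow> ar (iter x c s j) a = ar s a"
  by (induction j) (auto simp: frame_ar)

definition agree :: "nat set \<Rightarrow> nat set \<Rightarrow> st \<Rightarrow> st \<Rightarrow> bool" where
  "agree X Y s s' \<longleftrightarrow> (\<forall>x. x \<notin> X \<longrightarrow> sc s' x = sc s x) \<and> (\<forall>a. a \<notin> Y \<longrightarrow> ar s' a = ar s a)"

lemma agree_sem: "agree (reg_writes c) (arr_writes c) s (sem c s)"
  by (simp add: agree_def frame_sc frame_ar)

text \<open>\<open>agree\<close> provides the values of everything the loop never writes, so that an
  invariant need only mention what changes.\<close>

lemma For_rule:
  assumes "x \<notin> reg_writes c"
    and "I 0 (setv x 0 s)"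
    and "\<And>j s'. j < sc s y \<Longrightarrow> I j s' \<Longrightarrow> sc s' x = j \<Longrightarrow> agree (insert x (reg_writes c)) (arr_writes c) s s'
      \<Longrightarrow> I (Suc j) (incv x (sem c s'))"
  shows "I (sc s y) (sem (For x y c) s)"
proof -
  have "j \<le> sc s y \<Longrightarrow> I j (iter x c s j)" for j
  proof (induction j)
    case (Suc j)
    have "agree (insert x (reg_writes c)) (arr_writes c) s (iter x c s j)"
      by (simp add: agree_def iter_frame_sc iter_frame_ar)
    with Suc assms(3)[of j "iter x c s j"] show ?case
      using assms(1) by (simp add: iter_counter)
  qed (use assms in simp)
  then show ?thesis by simp
qed

subsection \<open>Compilation\<close>

text \<open>Memory is interleaved modulo 32: offset 0 holds the variables, offsets 1 to 30 the
  arrays, offset 31 a stack of temporaries. In this way arrays whose length depends on the input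
  grow side by side.\<close>

definition tmp :: "nat \<Rightarrow> nat" where "tmp d = 32 * d + 31"

lemma tmp_eq [simp]: "tmp d = tmp e \<longleftrightarrow> d = e"
  by (simp add: tmp_def)

text \<open>The result goes to temporary \<open>d\<close>; only higher ones serve as scratch space.
  Lacking a copy instruction, the machine adds zero. The minimum of \<open>e\<close> and
  \<open>f\<close> is \<open>e - (e - f)\<close> with truncated subtraction.\<close>

primrec compE :: "nat \<Rightarrow> exp \<Rightarrow> instr list" where
  "compE d (Num m) = [Const (tmp d) m]"
| "compE d (V x) = [Const (tmp (Suc d)) 0, Arith Plus (tmp d) (32 * x) (tmp (Suc d))]"
| "compE d (A a e) = compE d e @
     [Const (tmp (Suc d)) 32, Arith Times (tmp d) (tmp d) (tmp (Suc d)),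
      Const (tmp (Suc d)) a, Arith Plus (tmp d) (tmp d) (tmp (Suc d)), Load (tmp d) (tmp d)]"
| "compE d (Bin b e f) = compE d e @ compE (Suc d) f @ [Arith b (tmp d) (tmp d) (tmp (Suc d))]"
| "compE d (EMin e f) = compE d e @ compE (Suc d) f @
     [Arith Minus (tmp (Suc d)) (tmp d) (tmp (Suc d)), Arith Minus (tmp d) (tmp d) (tmp (Suc d))]"

text \<open>Jumps are absolute, so the code depends on its address \<open>p\<close>. An
  unconditional jump tests a register just set to zero.\<close>

primrec compile :: "nat \<Rightarrow> com \<Rightarrow> instr list" where
  "compile p SKIP = []"
| "compile p (Asg x e) = compE 0 e @ [Const (tmp 1) 0, Arith Plus (32 * x) (tmp 0) (tmp 1)]"
| "compile p (AAsg a e f) = compE 0 e @ compE 1 f @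
     [Const (tmp 2) 32, Arith Times (tmp 0) (tmp 0) (tmp 2),
      Const (tmp 2) a, Arith Plus (tmp 0) (tmp 0) (tmp 2), Store (tmp 0) (tmp 1)]"
| "compile p (c ;; d) = compile p c @ compile (p + length (compile p c)) d"
| "compile p (IF e c d) =
     (let q = p + exp_time e + 1; lc = length (compile q c); ld = length (compile (q + lc + 2) d) in
      compE 0 e @ [JumpZero (tmp 0) (q + lc + 2)] @ compile q c @
      [Const (tmp 0) 0, JumpZero (tmp 0) (q + lc + 2 + ld)] @ compile (q + lc + 2) d)"
| "compile p (For x y c) =
     (let lc = length (compile (p + 3) c) in
      [Const (32 * x) 0, Arith Minus (tmp 0) (32 * y) (32 * x), JumpZero (tmp 0) (p + lc + 7)] @
      compile (p + 3) c @
      [Const (tmp 0) 1, Arith Plus (32 * x) (32 * x) (tmp 0), Const (tmp 0) 0,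
       JumpZero (tmp 0) (p + 1)])"
| "compile p (Rd x) = [Read (32 * x)]"
| "compile p (Wr e) = compE 0 e @ [Write (tmp 0)]"

lemma length_compE [simp]: "length (compE d e) = exp_time e"
  by (induction e arbitrary: d) auto

definition code_at :: "instr list \<Rightarrow> nat \<Rightarrow> instr list \<Rightarrow> bool" where
  "code_at P p cs \<longleftrightarrow> (\<forall>i<length cs. p + i < length P \<and> P ! (p + i) = cs ! i)"

lemma code_at_simps [simp]:
  "code_at P p []"
  "code_at P p (c # cs) \<longleftrightarrow> p < length P \<and> P ! p = c \<and> code_at P (Suc p) cs"
  by (auto simp: code_at_def All_less_Suc2)

lemma code_at_append [simp]:
  "code_at P p (xs @ ys) \<longleftrightarrow> code_at P p xs \<and> code_at P (p + length xs) ys"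
  by (induction xs arbitrary: p) auto

definition bounded_by :: "nat \<Rightarrow> (nat \<Rightarrow> nat) \<Rightarrow> bool" where
  "bounded_by B m \<longleftrightarrow> (\<forall>x. m x \<le> B)"

abbreviation mem_le :: "nat \<Rightarrow> ram \<Rightarrow> bool" where
  "mem_le B r \<equiv> bounded_by B (ram_mem r)"

lemma bndm_upd [simp]: "bounded_by B m \<Longrightarrow> v \<le> B \<Longrightarrow> bounded_by B (m(x := v))"
  by (simp add: bounded_by_def)

lemma bndmD: "bounded_by B m \<Longrightarrow> m x \<le> B"
  by (simp add: bounded_by_def)

text \<open>The memory bound is recorded at every intermediate step because
  \<open>computes_in_time\<close> requires it throughout the run.\<close>

definition go :: "instr list \<Rightarrow> nat \<Rightarrow> nat \<Rightarrow> ram \<Rightarrow> ram \<Rightarrow> bool" where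
  "go P B t r r' \<longleftrightarrow> (ram_step P ^^ t) r = r' \<and> (\<forall>j\<le>t. mem_le B ((ram_step P ^^ j) r))"

lemma go_refl: "mem_le B r \<Longrightarrow> go P B 0 r r"
  by (simp add: go_def)

lemma go_bnd: "go P B t r r' \<Longrightarrow> mem_le B r'"
  by (auto simp: go_def)

lemma go_trans:
  assumes "go P B t r r'" "go P B u r' r''"
  shows "go P B (t + u) r r''"
proof -
  have eq: "(ram_step P ^^ (i + t)) r = (ram_step P ^^ i) r'" for i
    using assms(1) by (simp add: go_def funpow_add)
  have "mem_le B ((ram_step P ^^ j) r)" if "j \<le> t + u" for j
  proof (cases "j \<le> t")
    case True
    with assms(1) show ?thesis by (simp add: go_def)
  next
    case False
    with that have "j - t \<le> u" "j = (j - t) + t" by auto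
    with assms(2) eq[of "j - t"] show ?thesis by (simp add: go_def)
  qed
  moreover have "(ram_step P ^^ (t + u)) r = r''"
    using assms(2) eq[of u] by (simp add: go_def add.commute)
  ultimately show ?thesis by (simp add: go_def)
qed

lemma go_Suc:
  assumes "ram_pc r < length P" "mem_le B r" "go P B t (exec (P ! ram_pc r) r) r'"
  shows "go P B (Suc t) r r'"
proof -
  have "go P B 1 r (exec (P ! ram_pc r) r)"
    using assms go_bnd[OF assms(3)]
    by (auto simp: go_def ram_step_def halted_def le_Suc_eq)
  from go_trans[OF this assms(3)] show ?thesis by simp
qed

definition represents :: "st \<Rightarrow> (nat \<Rightarrow> nat) \<Rightarrow> bool" where
  "represents s m \<longleftrightarrow> (\<forall>x. m (32 * x) = sc s x) \<and>
     (\<forall>a i. 0 < a \<and> a < 31 \<longrightarrow> m (32 * i + a) = ar s a i)"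

abbreviation matches :: "st \<Rightarrow> ram \<Rightarrow> bool" where
  "matches s r \<equiv> represents s (ram_mem r) \<and> ram_in r = inp s \<and> ram_out r = outp s"

lemma addr_eq:
  assumes "a < 32" "b < (32::nat)"
  shows "32 * i + a = 32 * j + b \<longleftrightarrow> i = j \<and> a = b"
proof
  assume eq: "32 * i + a = 32 * j + b"
  have "i = (32 * i + a) div 32" "j = (32 * j + b) div 32" using assms by simp_all
  with eq have "i = j" by simp
  with eq show "i = j \<and> a = b" by simp
qed simp

lemma addr_neq [simp]:
  "tmp d \<noteq> 32 * x" "32 * x \<noteq> tmp d"
  "a < 31 \<Longrightarrow> 32 * i + a \<noteq> tmp d" "a < 31 \<Longrightarrow> tmp d \<noteq> 32 * i + a"
  "0 < a \<Longrightarrow> a < 31 \<Longrightarrow> 32 * i + a \<noteq> 32 * x" "0 < a \<Longrightarrow> a < 31 \<Longrightarrow> 32 * x \<noteq> 32 * i + a"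
  using addr_eq[of 31 0 d x] addr_eq[of a 31 i d] addr_eq[of a 0 i x] by (auto simp: tmp_def)

lemma mm_tmp [simp]: "represents s (m(tmp d := v)) \<longleftrightarrow> represents s m"
  by (auto simp: represents_def)

lemma mm_sc: "represents s m \<Longrightarrow> m (32 * x) = sc s x"
  by (simp add: represents_def)

lemma mm_ar: "represents s m \<Longrightarrow> 0 < a \<Longrightarrow> a < 31 \<Longrightarrow> m (32 * i + a) = ar s a i"
  by (simp add: represents_def)

lemma mm_setv [simp]: "represents s m \<Longrightarrow> represents (setv x v s) (m(32 * x := v))"
  by (auto simp: represents_def)

lemma mm_seta [simp]:
  "represents s m \<Longrightarrow> 0 < a \<Longrightarrow> a < 31 \<Longrightarrow> represents (seta a i v s) (m(32 * i + a := v))"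
  by (auto simp: represents_def addr_eq)

lemmas mm_lambda [simp] =
  mm_tmp[unfolded fun_upd_def] mm_setv[unfolded fun_upd_def] mm_seta[unfolded fun_upd_def]

lemma mm_io [simp]: "represents (s\<lparr>inp := q\<rparr>) m \<longleftrightarrow> represents s m" "represents (s\<lparr>outp := q\<rparr>) m \<longleftrightarrow> represents s m"
  by (simp_all add: represents_def)

lemma bnd_sc: "mem_le B r \<Longrightarrow> matches s r \<Longrightarrow> sc s x \<le> B"
  by (metis bndmD mm_sc mm_ar)

lemma bnd_ar: "mem_le B r \<Longrightarrow> matches s r \<Longrightarrow> 0 < a \<Longrightarrow> a < 31 \<Longrightarrow> ar s a i \<le> B"
  by (metis bndmD mm_sc mm_ar)

text \<open>That temporaries below \<open>d\<close> survive protects the left operand while the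
  right one is evaluated.\<close>

lemma compE_correct:
  assumes "code_at P p (compE d e)" "matches s r" "ram_pc r = p" "mem_le B r" "exp_safe B e s"
    "ewf e" "32 \<le> B"
  shows "\<exists>r'. go P B (exp_time e) r r' \<and> ram_pc r' = p + exp_time e \<and> matches s r' \<and>
    ram_mem r' (tmp d) = eval e s \<and> (\<forall>d'<d. ram_mem r' (tmp d') = ram_mem r (tmp d'))"
  using assms
proof (induction e arbitrary: d p r)
  case (Num m)
  then show ?case
    by (intro exI[of _ "exec (Const (tmp d) m) r"] conjI; (simp; fail | auto intro!: go_Suc go_refl))
next
  case (V x)
  let ?r1 = "exec (Const (tmp (Suc d)) 0) r"
  let ?r2 = "exec (Arith Plus (tmp d) (32 * x) (tmp (Suc d))) ?r1"
  have m1: "matches s ?r1" and b1: "mem_le B ?r1"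
    using V by (auto)
  have m2: "matches s ?r2"
    using m1 by simp
  have e2: "ram_mem ?r2 (tmp d) = sc s x" using V by (simp add: mm_sc[of s "ram_mem r"])
  have b2: "mem_le B ?r2"
    using b1 e2 bnd_sc[OF b1 m1, of x] by simp
  show ?case
    using V m1 b1 m2 b2 e2
    by (intro exI[of _ ?r2] conjI; (simp; fail | auto simp: numeral_2_eq_2 intro!: go_Suc go_refl))
next
  case (A a e)
  have "code_at P p (compE d e)" "exp_safe B e s" "ewf e" using A.prems by auto
  from A.IH[OF this(1) A.prems(2-4) this(2,3) A.prems(7)]
  obtain r0 where r0: "go P B (exp_time e) r r0" "ram_pc r0 = p + exp_time e" "matches s r0"
    "ram_mem r0 (tmp d) = eval e s" "\<forall>d'<d. ram_mem r0 (tmp d') = ram_mem r (tmp d')"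
    by blast
  note b0 = go_bnd[OF r0(1)]
  let ?x = "tmp d" and ?y = "tmp (Suc d)"
  let ?r1 = "exec (Const ?y 32) r0"
  let ?r2 = "exec (Arith Times ?x ?x ?y) ?r1"
  let ?r3 = "exec (Const ?y a) ?r2"
  let ?r4 = "exec (Arith Plus ?x ?x ?y) ?r3"
  let ?r5 = "exec (Load ?x ?x) ?r4"
  have le: "32 * eval e s + a \<le> B" "32 * eval e s \<le> B" "a \<le> B" using A by auto
  have "matches s ?r1" "mem_le B ?r1" using r0 b0 A.prems by (auto)
  moreover from this have "matches s ?r2" "mem_le B ?r2" using r0 le
    by (simp_all add: mult.commute)
  moreover have "matches s ?r3" "mem_le B ?r3" using r0 b0 le A.prems
    by (simp_all)
  moreover have m4: "matches s ?r4" "mem_le B ?r4" using r0 b0 le A.prems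
    by (simp_all add: mult.commute)
  moreover have x4: "ram_mem ?r4 ?x = 32 * eval e s + a" using r0 by simp
  moreover have v5: "ram_mem ?r5 ?x = ar s a (eval e s)"
    using m4(1) x4 A.prems(6) by (simp add: mm_ar mult.commute[of _ 32])
  moreover have "matches s ?r5"
    using m4(1) by simp
  moreover have "mem_le B ?r5"
  proof -
    have "ar s a (eval e s) \<le> B" using bnd_ar[OF m4(2,1)] A.prems by auto
    then have "ram_mem ?r5 y \<le> B" for y
      using v5 bndmD[OF m4(2), of y] by (cases "y = ?x") simp_all
    then show ?thesis unfolding bounded_by_def by blast
  qed
  moreover have "\<forall>d'<d. ram_mem ?r5 (tmp d') = ram_mem r (tmp d')"
    using r0(5) by auto
  moreover have "ram_pc ?r5 = p + exp_time (A a e)" using r0 by simp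
  moreover have "go P B 5 r0 ?r5"
  proof -
    have c: "code_at P (ram_pc r0) [Const ?y 32, Arith Times ?x ?x ?y, Const ?y a,
      Arith Plus ?x ?x ?y, Load ?x ?x]" using A.prems(1) r0(2) by simp
    have "go P B (Suc (Suc (Suc (Suc (Suc 0))))) r0 ?r5"
      apply (rule go_Suc) using c b0 apply (simp_all del: exec.simps)
      apply (rule go_Suc) using c calculation apply (simp_all)
      apply (rule go_Suc) using c calculation apply (simp_all)
      apply (rule go_Suc) using c calculation apply (simp_all)
      apply (rule go_Suc) using c calculation apply (simp_all)
      apply (rule go_refl) using c calculation apply (simp_all)
      done
    then show ?thesis by (simp add: eval_nat_numeral)
  qed
  ultimately show ?case
    using go_trans[OF r0(1), of 5 ?r5] by (intro exI[of _ ?r5] conjI; (simp del: exec.simps; fail | simp; fail | auto simp del: exec.simps))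
next
  case (Bin b e f)
  have sub: "code_at P p (compE d e)" "code_at P (p + exp_time e) (compE (Suc d) f)"
    "exp_safe B e s" "exp_safe B f s" "ewf e" "ewf f" using Bin.prems by auto
  from Bin.IH(1)[OF sub(1) Bin.prems(2-4) sub(3,5) Bin.prems(7)]
  obtain r0 where r0: "go P B (exp_time e) r r0" "ram_pc r0 = p + exp_time e" "matches s r0"
    "ram_mem r0 (tmp d) = eval e s" "\<forall>d'<d. ram_mem r0 (tmp d') = ram_mem r (tmp d')"
    by blast
  from Bin.IH(2)[OF sub(2) r0(3,2) go_bnd[OF r0(1)] sub(4,6) Bin.prems(7)]
  obtain r1 where r1: "go P B (exp_time f) r0 r1" "ram_pc r1 = p + exp_time e + exp_time f" "matches s r1"
    "ram_mem r1 (tmp (Suc d)) = eval f s" "\<forall>d'<Suc d. ram_mem r1 (tmp d') = ram_mem r0 (tmp d')"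
    by blast
  let ?r2 = "exec (Arith b (tmp d) (tmp d) (tmp (Suc d))) r1"
  have "go P B 1 r1 ?r2"
    using Bin.prems r1 r0 go_bnd[OF r1(1)] by (auto intro!: go_Suc go_refl)
  moreover have "matches s ?r2" using r1(3) by simp
  ultimately show ?case
    using r0 r1 go_trans[OF r0(1) go_trans[OF r1(1), of 1 ?r2]]
    by (intro exI[of _ ?r2] conjI; (simp; fail | auto simp: add.assoc))
next
  case (EMin e f)
  have sub: "code_at P p (compE d e)" "code_at P (p + exp_time e) (compE (Suc d) f)"
    "exp_safe B e s" "exp_safe B f s" "ewf e" "ewf f" using EMin.prems by auto
  from EMin.IH(1)[OF sub(1) EMin.prems(2-4) sub(3,5) EMin.prems(7)]
  obtain r0 where r0: "go P B (exp_time e) r r0" "ram_pc r0 = p + exp_time e" "matches s r0"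
    "ram_mem r0 (tmp d) = eval e s" "\<forall>d'<d. ram_mem r0 (tmp d') = ram_mem r (tmp d')"
    by blast
  from EMin.IH(2)[OF sub(2) r0(3,2) go_bnd[OF r0(1)] sub(4,6) EMin.prems(7)]
  obtain r1 where r1: "go P B (exp_time f) r0 r1" "ram_pc r1 = p + exp_time e + exp_time f" "matches s r1"
    "ram_mem r1 (tmp (Suc d)) = eval f s" "\<forall>d'<Suc d. ram_mem r1 (tmp d') = ram_mem r0 (tmp d')"
    by blast
  let ?r2 = "exec (Arith Minus (tmp (Suc d)) (tmp d) (tmp (Suc d))) r1"
  let ?r3 = "exec (Arith Minus (tmp d) (tmp d) (tmp (Suc d))) ?r2"
  have v: "ram_mem r1 (tmp d) = eval e s" using r1 r0 by simp
  have eB: "eval e s \<le> B" using go_bnd[OF r1(1)] v by (metis bndmD)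
  have "go P B 2 r1 ?r3"
    using EMin.prems r1 v eB go_bnd[OF r1(1)]
    by (auto simp: numeral_2_eq_2 intro!: go_Suc go_refl)
  moreover have "matches s ?r2" using r1(3) by simp
  then have "matches s ?r3" by simp
  moreover have "ram_mem ?r3 (tmp d) = min (eval e s) (eval f s)" using v r1 by simp
  ultimately show ?case
    using r0 r1 go_trans[OF r0(1) go_trans[OF r1(1), of 2 ?r3]]
    by (intro exI[of _ ?r3] conjI; (simp; fail | auto simp: add.assoc))
qed

lemma jump_correct:
  assumes "code_at P p [Const (tmp 0) 0, JumpZero (tmp 0) q]" "matches s r" "ram_pc r = p" "mem_le B r"
  shows "\<exists>r'. go P B 2 r r' \<and> ram_pc r' = q \<and> matches s r'"
proof -
  let ?r = "exec (JumpZero (tmp 0) q) (exec (Const (tmp 0) 0) r)"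
  have "go P B (Suc (Suc 0)) r ?r"
    using assms by (auto intro!: go_Suc go_refl)
  moreover have "matches s ?r"
    using assms(2) by simp
  ultimately show ?thesis by (intro exI[of _ ?r] conjI; simp add: numeral_2_eq_2)
qed

text \<open>The step count can fall short of \<open>time\<close>: a conditional taking its second
  branch saves the two instructions that skip this branch.\<close>

lemma comp_correct:
  assumes "wf_com c" "code_at P p (compile p c)" "matches s r" "ram_pc r = p" "mem_le B r" "safe B c s"
    "32 \<le> B"
  shows "\<exists>r' t. t \<le> time c s \<and> go P B t r r' \<and> ram_pc r' = p + length (compile p c) \<and>
    matches (sem c s) r'"
  using assms
proof (induction c arbitrary: p s r)
  case SKIP
  then show ?case by (auto intro!: exI[of _ r] exI[of _ "0::nat"] go_refl)
next
  case (Asg x e)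
  obtain r0 where r0: "go P B (exp_time e) r r0" "ram_pc r0 = p + exp_time e" "matches s r0"
    "ram_mem r0 (tmp 0) = eval e s"
    using compE_correct[of P p 0 e s r B] Asg.prems by auto
  let ?r1 = "exec (Const (tmp 1) 0) r0"
  let ?r2 = "exec (Arith Plus (32 * x) (tmp 0) (tmp 1)) ?r1"
  have eB: "eval e s \<le> B" using go_bnd[OF r0(1)] r0(4) by (metis bndmD)
  have "matches s ?r1" using r0(3) by simp
  then have "matches (sem (Asg x e) s) ?r2"
    using r0(4) by simp
  moreover have "go P B (Suc (Suc 0)) r0 ?r2"
    using Asg.prems r0 eB go_bnd[OF r0(1)] by (auto intro!: go_Suc go_refl)
  ultimately show ?case
    using go_trans[OF r0(1), of "Suc (Suc 0)" ?r2] r0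
    by (intro exI[of _ ?r2] exI[of _ "exp_time e + Suc (Suc 0)"] conjI; (simp; fail | auto))
next
  case (AAsg a e f)
  obtain r0 where r0: "go P B (exp_time e) r r0" "ram_pc r0 = p + exp_time e" "matches s r0"
    "ram_mem r0 (tmp 0) = eval e s"
    using compE_correct[of P p 0 e s r B] AAsg.prems by auto
  obtain r1 where r1: "go P B (exp_time f) r0 r1" "ram_pc r1 = p + exp_time e + exp_time f" "matches s r1"
    "ram_mem r1 (tmp 1) = eval f s" "ram_mem r1 (tmp 0) = eval e s"
    using compE_correct[of P "p + exp_time e" 1 f s r0 B] AAsg.prems r0 go_bnd[OF r0(1)] by auto
  let ?x = "tmp 0" and ?y = "tmp 2"
  let ?r2 = "exec (Const ?y 32) r1"
  let ?r3 = "exec (Arith Times ?x ?x ?y) ?r2"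
  let ?r4 = "exec (Const ?y a) ?r3"
  let ?r5 = "exec (Arith Plus ?x ?x ?y) ?r4"
  let ?r6 = "exec (Store ?x (tmp 1)) ?r5"
  note b1 = go_bnd[OF r1(1)]
  have le: "32 * eval e s + a \<le> B" "32 * eval e s \<le> B" "a \<le> B" using AAsg.prems by auto
  have fB: "eval f s \<le> B" using b1 r1(4) by (metis bndmD)
  have "matches s ?r2" "mem_le B ?r2" using r1 b1 AAsg.prems by (auto)
  moreover from this have "matches s ?r3" "mem_le B ?r3" using r1 le
    by (simp_all add: mult.commute)
  moreover have "matches s ?r4" "mem_le B ?r4" using r1 b1 le AAsg.prems
    by (simp_all)
  moreover have m5: "matches s ?r5" and b5: "mem_le B ?r5" using r1 b1 le AAsg.prems
    by (simp_all add: mult.commute)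
  moreover have x5: "ram_mem ?r5 ?x = 32 * eval e s + a" "ram_mem ?r5 (tmp 1) = eval f s"
    using r1 by simp_all
  moreover have "matches (sem (AAsg a e f) s) ?r6"
    using m5 x5 AAsg.prems by (simp add: mult.commute[of _ 32])
  moreover have "mem_le B ?r6"
    using b5 fB x5 by simp
  moreover have "go P B 5 r1 ?r6"
  proof -
    have c: "code_at P (ram_pc r1) [Const ?y 32, Arith Times ?x ?x ?y, Const ?y a,
      Arith Plus ?x ?x ?y, Store ?x (tmp 1)]" using AAsg.prems(2) r1(2) by simp
    have "go P B (Suc (Suc (Suc (Suc (Suc 0))))) r1 ?r6"
      apply (rule go_Suc) using c b1 apply (simp_all del: exec.simps)
      apply (rule go_Suc) using c calculation apply (simp_all)
      apply (rule go_Suc) using c calculation apply (simp_all)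
      apply (rule go_Suc) using c calculation apply (simp_all)
      apply (rule go_Suc) using c calculation apply (simp_all)
      apply (rule go_refl) using c calculation apply (simp_all)
      done
    then show ?thesis by (simp add: eval_nat_numeral)
  qed
  moreover have "ram_pc ?r6 = p + length (compile p (AAsg a e f))" using r1 by simp
  ultimately show ?case
    using go_trans[OF r0(1) go_trans[OF r1(1), of 5 ?r6]]
    by (intro exI[of _ ?r6] exI[of _ "exp_time e + (exp_time f + 5)"] conjI; (simp del: exec.simps; fail | simp; fail | auto simp del: exec.simps))
next
  case (Seq c d)
  obtain r0 t where r0: "t \<le> time c s" "go P B t r r0" "ram_pc r0 = p + length (compile p c)"
    "matches (sem c s) r0"
    using Seq.IH(1)[of p s r] Seq.prems by auto
  obtain r1 u where r1: "u \<le> time d (sem c s)" "go P B u r0 r1"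
    "ram_pc r1 = p + length (compile p c) + length (compile (p + length (compile p c)) d)"
    "matches (sem d (sem c s)) r1"
    using Seq.IH(2)[of "p + length (compile p c)" "sem c s" r0] Seq.prems r0 go_bnd[OF r0(2)] by auto
  show ?case
    using r0 r1 go_trans[OF r0(2) r1(2)]
    by (intro exI[of _ r1] exI[of _ "t + u"] conjI; (simp; fail | auto))
next
  case (IF e c d)
  define q where "q = p + exp_time e + 1"
  define lc where "lc = length (compile q c)"
  define ld where "ld = length (compile (q + lc + 2) d)"
  have code: "compile p (IF e c d) = compE 0 e @ [JumpZero (tmp 0) (q + lc + 2)] @ compile q c @
      [Const (tmp 0) 0, JumpZero (tmp 0) (q + lc + 2 + ld)] @ compile (q + lc + 2) d"
    by (simp add: q_def lc_def ld_def Let_def)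
  have at: "code_at P p (compE 0 e)" "code_at P (p + exp_time e) [JumpZero (tmp 0) (q + lc + 2)]"
    "code_at P q (compile q c)"
    "code_at P (q + lc) [Const (tmp 0) 0, JumpZero (tmp 0) (q + lc + 2 + ld)]"
    "code_at P (q + lc + 2) (compile (q + lc + 2) d)"
    using IF.prems(2) unfolding code by (simp_all add: q_def lc_def)
  have len: "p + length (compile p (IF e c d)) = q + lc + 2 + ld"
    unfolding code by (simp add: q_def lc_def ld_def)
  obtain r0 where r0: "go P B (exp_time e) r r0" "ram_pc r0 = p + exp_time e" "matches s r0"
    "ram_mem r0 (tmp 0) = eval e s"
    using compE_correct[OF at(1) IF.prems(3-5)] IF.prems by auto
  let ?r1 = "exec (JumpZero (tmp 0) (q + lc + 2)) r0"
  have "go P B (Suc 0) r0 ?r1"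
    using at(2) r0 go_bnd[OF r0(1)] by (auto intro!: go_Suc go_refl)
  from go_trans[OF r0(1) this] have r1: "go P B (exp_time e + Suc 0) r ?r1" .
  have m1: "matches s ?r1" using r0 by simp
  show ?case
  proof (cases "eval e s = 0")
    case True
    obtain r2 t where r2: "t \<le> time d s" "go P B t ?r1 r2" "ram_pc r2 = q + lc + 2 + ld"
      "matches (sem d s) r2"
      using IF.IH(2)[OF _ at(5) m1 _ go_bnd[OF r1]] IF.prems True r0 by (auto simp: ld_def)
    show ?thesis
      using r2 go_trans[OF r1 r2(2)] True unfolding len
      by (intro exI[of _ r2] exI[of _ "exp_time e + Suc 0 + t"] conjI; (simp; fail | auto))
  next
    case False
    obtain r2 t where r2: "t \<le> time c s" "go P B t ?r1 r2" "ram_pc r2 = q + lc"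
      "matches (sem c s) r2"
      using IF.IH(1)[OF _ at(3) m1 _ go_bnd[OF r1]] IF.prems False r0 by (auto simp: lc_def q_def)
    obtain r3 where r3: "go P B 2 r2 r3" "ram_pc r3 = q + lc + 2 + ld" "matches (sem c s) r3"
      using jump_correct[OF at(4) r2(4,3) go_bnd[OF r2(2)]] by auto
    show ?thesis
      using r2 r3 go_trans[OF r1 go_trans[OF r2(2) r3(1)]] False unfolding len
      by (intro exI[of _ r3] exI[of _ "exp_time e + Suc 0 + (t + 2)"] conjI; (simp; fail | auto))
  qed
next
  case (For x y c)
  define lc where "lc = length (compile (p + 3) c)"
  have code: "compile p (For x y c) =
      [Const (32 * x) 0, Arith Minus (tmp 0) (32 * y) (32 * x), JumpZero (tmp 0) (p + lc + 7)] @
      compile (p + 3) c @ [Const (tmp 0) 1, Arith Plus (32 * x) (32 * x) (tmp 0)] @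
      [Const (tmp 0) 0, JumpZero (tmp 0) (p + 1)]"
    by (simp add: lc_def Let_def)
  have at: "code_at P p [Const (32 * x) 0]"
    "code_at P (p + 1) [Arith Minus (tmp 0) (32 * y) (32 * x), JumpZero (tmp 0) (p + lc + 7)]"
    "code_at P (p + 3) (compile (p + 3) c)"
    "code_at P (p + 3 + lc) [Const (tmp 0) 1, Arith Plus (32 * x) (32 * x) (tmp 0)]"
    "code_at P (p + 5 + lc) [Const (tmp 0) 0, JumpZero (tmp 0) (p + 1)]"
    using For.prems(2) unfolding code
    by (simp_all add: lc_def numeral_3_eq_3 add.commute[of _ lc] eval_nat_numeral)
  have len: "p + length (compile p (For x y c)) = p + lc + 7"
    unfolding code by (simp add: lc_def)
  have wf: "x \<noteq> y" "x \<notin> reg_writes c" "y \<notin> reg_writes c" "wf_com c" using For.prems by auto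
  have test: "\<exists>r'. go P B 2 r r' \<and> matches s r' \<and>
      ram_pc r' = (if sc s y \<le> sc s x then p + lc + 7 else p + 3)"
    if "matches s r" "ram_pc r = p + 1" "mem_le B r" for r s
  proof -
    let ?i = "Arith Minus (tmp 0) (32 * y) (32 * x)"
    let ?r1 = "exec ?i r"
    let ?r2 = "exec (JumpZero (tmp 0) (p + lc + 7)) ?r1"
    have v: "ram_mem ?r1 (tmp 0) = sc s y - sc s x" using that by (simp add: mm_sc[of s "ram_mem r"])
    have m1: "matches s ?r1" using that(1) by simp
    have "sc s y - sc s x \<le> B" using bnd_sc[OF that(3,1), of y] by simp
    with v that(3) have b1: "mem_le B ?r1" by simp
    have b2: "mem_le B ?r2" using b1 by simp
    have "go P B (Suc (Suc 0)) r ?r2"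
      apply (rule go_Suc) using at(2) that apply simp_all[2]
      apply (rule go_Suc) using at(2) that b1 apply simp_all[2]
      using at(2) that b1 go_refl[OF b2] by simp
    moreover have "matches s ?r2" using m1 by simp
    moreover have "ram_pc ?r2 = (if sc s y \<le> sc s x then p + lc + 7 else p + 3)"
      using v that(2) by (simp add: numeral_3_eq_3)
    ultimately show ?thesis unfolding numeral_2_eq_2 by blast
  qed
  have "\<exists>r' t. t \<le> 1 + (\<Sum>i<j. time c (iter x c s i) + 6) \<and> go P B t r r' \<and> ram_pc r' = p + 1 \<and>
      matches (iter x c s j) r'" if "j \<le> sc s y" for j
    using that
  proof (induction j)
    case 0
    let ?r = "exec (Const (32 * x) 0) r"
    have "go P B (Suc 0) r ?r"
      using at(1) For.prems by (auto intro!: go_Suc go_refl)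
    moreover have "matches (setv x 0 s) ?r"
      using For.prems(3) by simp
    ultimately show ?case
      using For.prems by (intro exI[of _ ?r] exI[of _ "Suc 0"] conjI; simp)
  next
    case (Suc j)
    let ?s = "iter x c s j"
    from Suc obtain r1 t where r1: "t \<le> 1 + (\<Sum>i<j. time c (iter x c s i) + 6)" "go P B t r r1"
      "ram_pc r1 = p + 1" "matches ?s r1" by auto
    have cnt: "sc ?s x = j" "sc ?s y = sc s y" using wf by (simp_all add: iter_counter iter_frame_sc)
    obtain r2 where r2: "go P B 2 r1 r2" "matches ?s r2" "ram_pc r2 = p + 3"
      using test[OF r1(4,3) go_bnd[OF r1(2)]] cnt Suc.prems by auto
    have "safe B c ?s" using For.prems(6) Suc.prems by simp
    then obtain r3 u where r3: "u \<le> time c ?s" "go P B u r2 r3" "ram_pc r3 = p + 3 + lc"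
      "matches (sem c ?s) r3"
      using For.IH[OF wf(4) at(3) r2(2,3) go_bnd[OF r2(1)]] For.prems(7) by (auto simp: lc_def)
    let ?r4 = "exec (Const (tmp 0) 1) r3"
    let ?r5 = "exec (Arith Plus (32 * x) (32 * x) (tmp 0)) ?r4"
    have m4: "matches (sem c ?s) ?r4" using r3(4) by simp
    have v: "ram_mem ?r4 (32 * x) = j" "ram_mem ?r4 (tmp 0) = 1"
      using r3(4) cnt(1) wf by (simp_all add: mm_sc[of "sem c ?s" "ram_mem r3"] frame_sc)
    have sB: "Suc j \<le> B" using bnd_sc[OF For.prems(5,3), of y] Suc.prems by simp
    have b4: "mem_le B ?r4" using go_bnd[OF r3(2)] For.prems(7) by auto
    have b5: "mem_le B ?r5" using b4 sB v by simp
    have m5: "matches (iter x c s (Suc j)) ?r5"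
      using m4 v cnt(1) wf by (simp add: incv_def frame_sc)
    have g5: "go P B (Suc (Suc 0)) r3 ?r5"
      apply (rule go_Suc) using at(4) r3 go_bnd[OF r3(2)] apply simp_all[2]
      apply (rule go_Suc) using at(4) r3 b4 apply simp_all[2]
      using at(4) r3 go_refl[OF b5] by simp
    have pc5: "ram_pc ?r5 = p + 5 + lc" using r3 by simp
    obtain r6 where r6: "go P B 2 ?r5 r6" "ram_pc r6 = p + 1" "matches (iter x c s (Suc j)) r6"
      using jump_correct[OF at(5) m5 pc5 b5] by blast
    from go_trans[OF go_trans[OF r1(2) r2(1)] go_trans[OF go_trans[OF r3(2) g5] r6(1)]]
    show ?case using r6 r1(1) r3(1)
      by (intro exI[of _ r6] exI[of _ "t + 2 + (u + Suc (Suc 0) + 2)"] conjI; (simp; fail | auto))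
  qed
  from this[of "sc s y"] obtain r1 t where r1: "t \<le> 1 + (\<Sum>i<sc s y. time c (iter x c s i) + 6)"
    "go P B t r r1" "ram_pc r1 = p + 1" "matches (iter x c s (sc s y)) r1" by auto
  obtain r2 where r2: "go P B 2 r1 r2" "matches (iter x c s (sc s y)) r2" "ram_pc r2 = p + lc + 7"
    using test[OF r1(4,3) go_bnd[OF r1(2)]] wf by (auto simp: iter_counter iter_frame_sc)
  show ?case
    using r1 r2 go_trans[OF r1(2) r2(1)] unfolding len
    by (intro exI[of _ r2] exI[of _ "t + 2"] conjI; (simp; fail | auto))
next
  case (Rd x)
  let ?r = "exec (Read (32 * x)) r"
  have "(case inp s of [] \<Rightarrow> 0 | m # _ \<Rightarrow> m) \<le> B" using Rd.prems by (cases "inp s") auto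
  then have "mem_le B ?r" using Rd.prems by (auto simp: mm_sc)
  then have "go P B (Suc 0) r ?r" using Rd.prems by (auto intro!: go_Suc go_refl)
  moreover have "matches (sem (Rd x) s) ?r" using Rd.prems by (auto simp: mm_sc)
  ultimately show ?case using Rd.prems by (intro exI[of _ ?r] exI[of _ "Suc 0"] conjI; (simp; fail | auto))
next
  case (Wr e)
  obtain r0 where r0: "go P B (exp_time e) r r0" "ram_pc r0 = p + exp_time e" "matches s r0"
    "ram_mem r0 (tmp 0) = eval e s"
    using compE_correct[of P p 0 e s r B] Wr.prems by auto
  let ?r = "exec (Write (tmp 0)) r0"
  have "go P B (Suc 0) r0 ?r"
    using Wr.prems r0 go_bnd[OF r0(1)] by (auto intro!: go_Suc go_refl)
  moreover have "matches (sem (Wr e) s) ?r" using r0 by (auto simp: mm_sc)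
  ultimately show ?case
    using go_trans[OF r0(1), of "Suc 0" ?r] r0
    by (intro exI[of _ ?r] exI[of _ "exp_time e + Suc 0"] conjI; (simp; fail | auto))
qed

definition init :: "nat list \<Rightarrow> st" where
  "init xs = \<lparr>sc = \<lambda>_. 0, ar = \<lambda>_ _. 0, inp = xs, outp = []\<rparr>"

lemma init_simps [simp]:
  "sc (init xs) = (\<lambda>_. 0)" "ar (init xs) = (\<lambda>_ _. 0)" "inp (init xs) = xs" "outp (init xs) = []"
  by (simp_all add: init_def)

lemma comp_run:
  assumes "wf_com c" "safe B c (init xs)" "32 \<le> B"
  shows "\<exists>t\<le>time c (init xs). halted (compile 0 c) (run (compile 0 c) xs t) \<and>
    ram_out (run (compile 0 c) xs t) = outp (sem c (init xs)) \<and>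
    (\<forall>s\<le>t. \<forall>r. ram_mem (run (compile 0 c) xs s) r \<le> B)"
proof -
  let ?r = "\<lparr>ram_pc = 0, ram_mem = (\<lambda>_. 0), ram_in = xs, ram_out = []\<rparr>"
  have "code_at (compile 0 c) 0 (compile 0 c)" by (simp add: code_at_def)
  moreover have "matches (init xs) ?r" by (simp add: represents_def)
  moreover have "mem_le B ?r" by (simp add: bounded_by_def)
  ultimately obtain r' t where "t \<le> time c (init xs)" "go (compile 0 c) B t ?r r'"
    "ram_pc r' = length (compile 0 c)" "matches (sem c (init xs)) r'"
    using comp_correct[OF assms(1), of "compile 0 c" 0 "init xs" ?r B] assms by auto
  then show ?thesis
    by (intro exI[of _ t]) (auto simp: run_def go_def halted_def bounded_by_def)
qed

section \<open>Existence of value bounds for arbitrary runs\<close>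

lemma esafe_mono: "exp_safe B e s \<Longrightarrow> B \<le> B' \<Longrightarrow> exp_safe B' e s"
  by (induction e) auto

lemma safe_mono: "safe B c s \<Longrightarrow> B \<le> B' \<Longrightarrow> safe B' c s"
proof (induction c arbitrary: s)
  case (Rd x)
  then show ?case by force
qed (auto intro: esafe_mono)

lemma esafe_ex: "\<exists>B. exp_safe B e s"
proof (induction e)
  case (A a e)
  then obtain B where "exp_safe B e s" by blast
  then show ?case
    by (intro exI[of _ "max B (32 * eval e s + a)"]) (auto intro: esafe_mono)
next
  case (Bin b e f)
  then obtain B C where "exp_safe B e s" "exp_safe C f s" by blast
  then show ?case
    by (intro exI[of _ "max (max B C) (arith_op b (eval e s) (eval f s))"])
      (auto intro: esafe_mono)
next
  case (EMin e f)
  then obtain B C where "exp_safe B e s" "exp_safe C f s" by blast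
  then show ?case
    by (intro exI[of _ "max B C"]) (auto intro: esafe_mono)
qed auto

text \<open>A terminating run meets finitely many values. This yields \<open>computes\<close>
  without a time bound, as required for computable functions and for the null graph.\<close>

lemma safe_ex: "\<exists>B. safe B c s"
proof (induction c arbitrary: s)
  case (AAsg a e f)
  obtain B C where "exp_safe B e s" "exp_safe C f s" using esafe_ex by blast
  then show ?case
    by (intro exI[of _ "max (max B C) (32 * eval e s + a)"]) (auto intro: esafe_mono)
next
  case (Seq c d)
  obtain B C where "safe B c s" "safe C d (sem c s)" using Seq by blast
  then show ?case by (intro exI[of _ "max B C"]) (auto intro: safe_mono)
next
  case (IF e c d)
  obtain B C D where "exp_safe B e s" "safe C c s" "safe D d s" using IF esafe_ex by blast
  then show ?case
    by (intro exI[of _ "max B (max C D)"]) (auto intro: safe_mono esafe_mono)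
next
  case (For x y c)
  have "\<exists>B. \<forall>j<m. safe B c (iter x c s j)" for m
  proof (induction m)
    case (Suc m)
    then obtain B where "\<forall>j<m. safe B c (iter x c s j)" by blast
    moreover obtain C where "safe C c (iter x c s m)" using For by blast
    ultimately show ?case
      by (intro exI[of _ "max B C"]) (auto simp: less_Suc_eq intro: safe_mono)
  qed simp
  then show ?case by simp
next
  case (Rd x)
  then show ?case by (auto intro!: exI[of _ "Max (set (inp s))"])
qed (use esafe_ex in auto)

lemma computes_comp:
  assumes "wf_com c"
  shows "computes (compile 0 c) xs (outp (sem c (init xs)))"
proof -
  obtain B where "safe B c (init xs)" using safe_ex by blast
  then have "safe (max 32 B) c (init xs)" by (rule safe_mono) simp
  from comp_run[OF assms this] show ?thesis by (auto simp: computes_def)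
qed

lemma computes_in_time_comp:
  assumes "wf_com c" "safe T c (init xs)" "32 \<le> T" "time c (init xs) \<le> T"
  shows "computes_in_time T (compile 0 c) xs (outp (sem c (init xs)))"
proof -
  from comp_run[OF assms(1-3)] obtain t where "t \<le> time c (init xs)"
    "halted (compile 0 c) (run (compile 0 c) xs t)"
    "ram_out (run (compile 0 c) xs t) = outp (sem c (init xs))"
    "\<forall>s\<le>t. \<forall>r. ram_mem (run (compile 0 c) xs s) r \<le> T" by blast
  with assms(4) show ?thesis
    unfolding computes_in_time_def by (intro exI[of _ t]) auto
qed

section \<open>Static bounds on values and running time\<close>

text \<open>\<open>\<beta>\<close> bounds each variable and \<open>\<gamma>\<close> all cells of
  each array at once, so no knowledge about indices is required.\<close>

primrec exp_ub :: "(nat \<Rightarrow> nat) \<Rightarrow> (nat \<Rightarrow> nat) \<Rightarrow> exp \<Rightarrow> nat" where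
  "exp_ub \<beta> \<gamma> (Num m) = m"
| "exp_ub \<beta> \<gamma> (V x) = \<beta> x"
| "exp_ub \<beta> \<gamma> (A a e) = \<gamma> a"
| "exp_ub \<beta> \<gamma> (Bin b e f) = (case b of Plus \<Rightarrow> exp_ub \<beta> \<gamma> e + exp_ub \<beta> \<gamma> f | Minus \<Rightarrow> exp_ub \<beta> \<gamma> e
     | Times \<Rightarrow> exp_ub \<beta> \<gamma> e * exp_ub \<beta> \<gamma> f | Divide \<Rightarrow> exp_ub \<beta> \<gamma> e)"
| "exp_ub \<beta> \<gamma> (EMin e f) = min (exp_ub \<beta> \<gamma> e) (exp_ub \<beta> \<gamma> f)"

text \<open>The clause for \<open>Rd\<close> fits inputs of zeros and ones, which is what remains
  once \<open>k\<close> and \<open>n\<close> have been read.\<close>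

primrec keeps_bounds :: "(nat \<Rightarrow> nat) \<Rightarrow> (nat \<Rightarrow> nat) \<Rightarrow> com \<Rightarrow> bool" where
  "keeps_bounds \<beta> \<gamma> SKIP \<longleftrightarrow> True"
| "keeps_bounds \<beta> \<gamma> (Asg x e) \<longleftrightarrow> exp_ub \<beta> \<gamma> e \<le> \<beta> x"
| "keeps_bounds \<beta> \<gamma> (AAsg a e f) \<longleftrightarrow> exp_ub \<beta> \<gamma> f \<le> \<gamma> a"
| "keeps_bounds \<beta> \<gamma> (c ;; d) \<longleftrightarrow> keeps_bounds \<beta> \<gamma> c \<and> keeps_bounds \<beta> \<gamma> d"
| "keeps_bounds \<beta> \<gamma> (IF e c d) \<longleftrightarrow> keeps_bounds \<beta> \<gamma> c \<and> keeps_bounds \<beta> \<gamma> d"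
| "keeps_bounds \<beta> \<gamma> (For x y c) \<longleftrightarrow> \<beta> y \<le> \<beta> x \<and> keeps_bounds \<beta> \<gamma> c"
| "keeps_bounds \<beta> \<gamma> (Rd x) \<longleftrightarrow> 1 \<le> \<beta> x"
| "keeps_bounds \<beta> \<gamma> (Wr e) \<longleftrightarrow> True"

definition bounded :: "(nat \<Rightarrow> nat) \<Rightarrow> (nat \<Rightarrow> nat) \<Rightarrow> st \<Rightarrow> bool" where
  "bounded \<beta> \<gamma> s \<longleftrightarrow>
     (\<forall>x. sc s x \<le> \<beta> x) \<and> (\<forall>a i. ar s a i \<le> \<gamma> a) \<and> (\<forall>m\<in>set (inp s). m \<le> 1)"

lemma eval_ub: "bounded \<beta> \<gamma> s \<Longrightarrow> eval e s \<le> exp_ub \<beta> \<gamma> e"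
proof (induction e)
  case (Bin b e f)
  then have "eval e s \<le> exp_ub \<beta> \<gamma> e" "eval f s \<le> exp_ub \<beta> \<gamma> f" by auto
  then show ?case
    by (cases b) (auto intro: add_mono mult_mono le_trans[OF diff_le_self] le_trans[OF div_le_dividend])
qed (auto simp: bounded_def)

lemma bounded_loop:
  assumes "x \<notin> reg_writes c" "keeps_bounds \<beta> \<gamma> (For x y c)" "bounded \<beta> \<gamma> s" "j \<le> sc s y"
    and step: "\<And>s. bounded \<beta> \<gamma> s \<Longrightarrow> bounded \<beta> \<gamma> (sem c s)"
  shows "bounded \<beta> \<gamma> (iter x c s j)"
  using assms(4)
proof (induction j)
  case 0
  then show ?case using assms(3) by (auto simp: bounded_def)
next
  case (Suc j)
  then have "bounded \<beta> \<gamma> (sem c (iter x c s j))" by (simp add: step)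
  moreover have "sc (sem c (iter x c s j)) x = j"
    using assms(1) by (simp add: frame_sc iter_counter)
  moreover have "Suc j \<le> \<beta> x"
    using Suc.prems assms(2,3) unfolding bounded_def by (meson keeps_bounds.simps(6) le_trans)
  ultimately show ?case by (auto simp: bounded_def)
qed

lemma bounded_sem: "wf_com c \<Longrightarrow> keeps_bounds \<beta> \<gamma> c \<Longrightarrow> bounded \<beta> \<gamma> s \<Longrightarrow> bounded \<beta> \<gamma> (sem c s)"
proof (induction c arbitrary: s)
  case (Asg x e)
  then show ?case using eval_ub[OF Asg(3), of e] by (auto simp: bounded_def intro: le_trans)
next
  case (AAsg a e f)
  then show ?case using eval_ub[OF AAsg(3), of f] by (auto simp: bounded_def intro: le_trans)
next
  case (For x y c)
  then show ?case using bounded_loop[of x c \<beta> \<gamma> y s "sc s y"] by simp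
next
  case (Rd x)
  then show ?case by (cases "inp s") (auto simp: bounded_def intro: le_trans)
next
  case (Wr e)
  then show ?case by (simp add: bounded_def)
qed simp_all

text \<open>Expressions are treated like polynomials in a common bound \<open>W\<close> of all
  variables and cells: a coefficient, a degree, and in \<open>exp_peak\<close> a coefficient that
  also covers all intermediate values.\<close>

primrec exp_coeff :: "exp \<Rightarrow> nat" where
  "exp_coeff (Num m) = m"
| "exp_coeff (V x) = 1"
| "exp_coeff (A a e) = 1"
| "exp_coeff (Bin b e f) = (case b of Plus \<Rightarrow> exp_coeff e + exp_coeff f | Minus \<Rightarrow> exp_coeff e | Times \<Rightarrow> exp_coeff e * exp_coeff f
     | Divide \<Rightarrow> exp_coeff e)"
| "exp_coeff (EMin e f) = exp_coeff e"

primrec exp_degree :: "exp \<Rightarrow> nat" where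
  "exp_degree (Num m) = 0"
| "exp_degree (V x) = 1"
| "exp_degree (A a e) = 1"
| "exp_degree (Bin b e f) = (case b of Plus \<Rightarrow> max (exp_degree e) (exp_degree f) | Minus \<Rightarrow> exp_degree e | Times \<Rightarrow> exp_degree e + exp_degree f
     | Divide \<Rightarrow> exp_degree e)"
| "exp_degree (EMin e f) = exp_degree e"

primrec exp_peak :: "exp \<Rightarrow> nat" where
  "exp_peak (Num m) = m"
| "exp_peak (V x) = 0"
| "exp_peak (A a e) = exp_peak e + (32 * exp_coeff e + a)"
| "exp_peak (Bin b e f) = exp_peak e + exp_peak f + exp_coeff (Bin b e f)"
| "exp_peak (EMin e f) = exp_peak e + exp_peak f"

primrec exp_degree_le :: "nat \<Rightarrow> exp \<Rightarrow> bool" where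
  "exp_degree_le g (Num m) \<longleftrightarrow> True"
| "exp_degree_le g (V x) \<longleftrightarrow> True"
| "exp_degree_le g (A a e) \<longleftrightarrow> exp_degree_le g e \<and> exp_degree e \<le> g"
| "exp_degree_le g (Bin b e f) \<longleftrightarrow> exp_degree_le g e \<and> exp_degree_le g f \<and> exp_degree (Bin b e f) \<le> g"
| "exp_degree_le g (EMin e f) \<longleftrightarrow> exp_degree_le g e \<and> exp_degree_le g f"

primrec com_peak :: "com \<Rightarrow> nat" where
  "com_peak SKIP = 0"
| "com_peak (Asg x e) = exp_peak e"
| "com_peak (AAsg a e f) = exp_peak e + exp_peak f + (32 * exp_coeff e + a)"
| "com_peak (c ;; d) = com_peak c + com_peak d"
| "com_peak (IF e c d) = exp_peak e + com_peak c + com_peak d"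
| "com_peak (For x y c) = com_peak c"
| "com_peak (Rd x) = 1"
| "com_peak (Wr e) = exp_peak e"

primrec com_degree_le :: "nat \<Rightarrow> com \<Rightarrow> bool" where
  "com_degree_le g SKIP \<longleftrightarrow> True"
| "com_degree_le g (Asg x e) \<longleftrightarrow> exp_degree_le g e"
| "com_degree_le g (AAsg a e f) \<longleftrightarrow> exp_degree_le g e \<and> exp_degree_le g f \<and> exp_degree e \<le> g"
| "com_degree_le g (c ;; d) \<longleftrightarrow> com_degree_le g c \<and> com_degree_le g d"
| "com_degree_le g (IF e c d) \<longleftrightarrow> exp_degree_le g e \<and> com_degree_le g c \<and> com_degree_le g d"
| "com_degree_le g (For x y c) \<longleftrightarrow> com_degree_le g c"
| "com_degree_le g (Rd x) \<longleftrightarrow> True"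
| "com_degree_le g (Wr e) \<longleftrightarrow> exp_degree_le g e"

lemma ub_degree:
  assumes "\<And>x. \<beta> x \<le> W" "\<And>a. \<gamma> a \<le> W" "1 \<le> W"
  shows "exp_ub \<beta> \<gamma> e \<le> exp_coeff e * W ^ exp_degree e"
proof (induction e)
  case (Bin b e f)
  show ?case
  proof (cases b)
    case Plus
    have "exp_coeff e * W ^ exp_degree e \<le> exp_coeff e * W ^ max (exp_degree e) (exp_degree f)"
      "exp_coeff f * W ^ exp_degree f \<le> exp_coeff f * W ^ max (exp_degree e) (exp_degree f)"
      using assms(3) by (auto intro: mult_le_mono2 power_increasing)
    with Bin have "exp_ub \<beta> \<gamma> e + exp_ub \<beta> \<gamma> f \<le>
      exp_coeff e * W ^ max (exp_degree e) (exp_degree f) + exp_coeff f * W ^ max (exp_degree e) (exp_degree f)"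
      by (meson add_mono le_trans)
    then show ?thesis using Plus by (simp add: add_mult_distrib)
  next
    case Times
    have "exp_ub \<beta> \<gamma> e * exp_ub \<beta> \<gamma> f \<le> (exp_coeff e * W ^ exp_degree e) * (exp_coeff f * W ^ exp_degree f)"
      using Bin by (rule mult_mono) auto
    then show ?thesis using Times by (simp add: power_add mult_ac)
  qed (use Bin in auto)
qed (use assms in \<open>auto intro: le_trans min.coboundedI1\<close>)

lemma ub_peak:
  assumes "\<And>x. \<beta> x \<le> W" "\<And>a. \<gamma> a \<le> W" "1 \<le> W" "exp_degree e \<le> g"
  shows "exp_ub \<beta> \<gamma> e \<le> exp_coeff e * W ^ g"
  using ub_degree[of \<beta> W \<gamma> e, OF assms(1-3)] assms(3,4)
  by (meson le_trans mult_le_mono2 power_increasing)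

lemma esafe_static:
  assumes "\<And>x. \<beta> x \<le> W" "\<And>a. \<gamma> a \<le> W" "1 \<le> W" "bounded \<beta> \<gamma> s" "exp_degree_le g e"
  shows "exp_safe (exp_peak e * W ^ g) e s"
  using assms(5)
proof (induction e)
  case (A a e)
  have "32 * eval e s \<le> 32 * (exp_coeff e * W ^ g)"
    using ub_peak[of \<beta> W \<gamma> e g, OF assms(1-3)] eval_ub[OF assms(4), of e] A.prems by simp
  moreover have "a * 1 \<le> a * W ^ g" using assms(3) by (intro mult_le_mono2) simp
  ultimately have "32 * eval e s + a \<le> (32 * exp_coeff e + a) * W ^ g"
    unfolding add_mult_distrib mult.assoc by linarith
  then show ?case using A by (auto simp: add_mult_distrib intro: esafe_mono)
next
  case (Bin b e f)
  have "arith_op b (eval e s) (eval f s) \<le> exp_coeff (Bin b e f) * W ^ g"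
    using ub_peak[of \<beta> W \<gamma> "Bin b e f" g, OF assms(1-3)] eval_ub[OF assms(4), of "Bin b e f"] Bin.prems
    by simp
  then show ?case using Bin
    by (auto simp: add_mult_distrib simp del: exp_coeff.simps intro: esafe_mono)
next
  case (EMin e f)
  then show ?case by (auto simp: add_mult_distrib intro: esafe_mono)
qed (use assms(3) in auto)

lemma safe_static:
  assumes "\<And>x. \<beta> x \<le> W" "\<And>a. \<gamma> a \<le> W" "1 \<le> W"
  shows "wf_com c \<Longrightarrow> keeps_bounds \<beta> \<gamma> c \<Longrightarrow> bounded \<beta> \<gamma> s \<Longrightarrow> com_degree_le g c \<Longrightarrow> safe (com_peak c * W ^ g) c s"
proof (induction c arbitrary: s)
  case (Asg x e)
  then show ?case by (simp add: esafe_static[of \<beta> W \<gamma>, OF assms])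
next
  case (AAsg a e f)
  have "32 * eval e s \<le> 32 * (exp_coeff e * W ^ g)"
    using ub_peak[of \<beta> W \<gamma> e g, OF assms] eval_ub[OF AAsg(3), of e] AAsg.prems by simp
  moreover have "a * 1 \<le> a * W ^ g" using assms(3) by (intro mult_le_mono2) simp
  ultimately have "32 * eval e s + a \<le> (32 * exp_coeff e + a) * W ^ g"
    unfolding add_mult_distrib mult.assoc by linarith
  then show ?case
    using esafe_static[of \<beta> W \<gamma> s g e, OF assms AAsg(3)] esafe_static[of \<beta> W \<gamma> s g f, OF assms AAsg(3)] AAsg.prems
    by (auto simp: add_mult_distrib intro: esafe_mono)
next
  case (Seq c d)
  then have "safe (com_peak c * W ^ g) c s" "safe (com_peak d * W ^ g) d (sem c s)"
    by (auto simp: bounded_sem)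
  then show ?case
    by (auto simp: add_mult_distrib elim!: safe_mono)
next
  case (IF e c d)
  then have "eval e s \<noteq> 0 \<Longrightarrow> safe (com_peak c * W ^ g) c s" "eval e s = 0 \<Longrightarrow> safe (com_peak d * W ^ g) d s"
    by auto
  then show ?case using esafe_static[of \<beta> W \<gamma> s g e, OF assms IF(5)] IF.prems
    by (auto simp: add_mult_distrib elim!: safe_mono esafe_mono)
next
  case (For x y c)
  have "bounded \<beta> \<gamma> (iter x c s j)" if "j < sc s y" for j
    using bounded_loop[of x c \<beta> \<gamma> y s j] For.prems that by (auto intro: bounded_sem)
  then show ?case using For by auto
next
  case (Rd x)
  have "1 \<le> W ^ g" using assms(3) by simp
  then show ?case using Rd by (auto simp: bounded_def intro: le_trans)
next
  case (Wr e)
  then show ?case by (simp add: esafe_static[of \<beta> W \<gamma>, OF assms])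
qed simp

primrec time_coeff :: "com \<Rightarrow> nat" where
  "time_coeff SKIP = 0"
| "time_coeff (Asg x e) = exp_time e + 2"
| "time_coeff (AAsg a e f) = exp_time e + exp_time f + 5"
| "time_coeff (c ;; d) = time_coeff c + time_coeff d"
| "time_coeff (IF e c d) = exp_time e + 3 + time_coeff c + time_coeff d"
| "time_coeff (For x y c) = time_coeff c + 9"
| "time_coeff (Rd x) = 1"
| "time_coeff (Wr e) = exp_time e + 1"

text \<open>
  The nesting depth of loops is counted twice: \<open>weighted_depth\<close> adds up only the loops over a variable of
  weight one, which are the ones running up to \<open>n\<close>.
\<close>

primrec loop_depth :: "com \<Rightarrow> nat" where
  "loop_depth SKIP = 0"
| "loop_depth (Asg x e) = 0"
| "loop_depth (AAsg a e f) = 0"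
| "loop_depth (c ;; d) = max (loop_depth c) (loop_depth d)"
| "loop_depth (IF e c d) = max (loop_depth c) (loop_depth d)"
| "loop_depth (For x y c) = Suc (loop_depth c)"
| "loop_depth (Rd x) = 0"
| "loop_depth (Wr e) = 0"

primrec weighted_depth :: "(nat \<Rightarrow> nat) \<Rightarrow> com \<Rightarrow> nat" where
  "weighted_depth w SKIP = 0"
| "weighted_depth w (Asg x e) = 0"
| "weighted_depth w (AAsg a e f) = 0"
| "weighted_depth w (c ;; d) = max (weighted_depth w c) (weighted_depth w d)"
| "weighted_depth w (IF e c d) = max (weighted_depth w c) (weighted_depth w d)"
| "weighted_depth w (For x y c) = w y + weighted_depth w c"
| "weighted_depth w (Rd x) = 0"
| "weighted_depth w (Wr e) = 0"

text \<open>A loop over \<open>y\<close> runs at most \<open>Q * n ^ w y\<close> times; therefore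
  \<open>a\<close> counts the factors \<open>Q\<close> and \<open>b\<close> separately the factors
  \<open>n\<close> along the nesting.\<close>

lemma tm_static:
  assumes "\<And>x. \<beta> x \<le> Q * n ^ w x" "1 \<le> Q" "1 \<le> n"
  shows "wf_com c \<Longrightarrow> keeps_bounds \<beta> \<gamma> c \<Longrightarrow> bounded \<beta> \<gamma> s \<Longrightarrow> loop_depth c \<le> a \<Longrightarrow> weighted_depth w c \<le> b \<Longrightarrow>
    time c s \<le> time_coeff c * (Q ^ a * n ^ b)"
proof (induction c arbitrary: s a b)
  case (Asg x e)
  have "1 \<le> Q ^ a * n ^ b" using assms(2,3) by simp
  then have "(exp_time e + 2) * 1 \<le> (exp_time e + 2) * (Q ^ a * n ^ b)" by (rule mult_le_mono2)
  then show ?case by simp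
next
  case (AAsg x e f)
  have "1 \<le> Q ^ a * n ^ b" using assms(2,3) by simp
  then have "(exp_time e + exp_time f + 5) * 1 \<le> (exp_time e + exp_time f + 5) * (Q ^ a * n ^ b)"
    by (rule mult_le_mono2)
  then show ?case by simp
next
  case (Seq c d)
  have "time c s \<le> time_coeff c * (Q ^ a * n ^ b)" "time d (sem c s) \<le> time_coeff d * (Q ^ a * n ^ b)"
    using Seq by (auto intro!: Seq.IH bounded_sem)
  then show ?case by (simp add: add_mult_distrib)
next
  case (IF e c d)
  have "1 \<le> Q ^ a * n ^ b" using assms(2,3) by simp
  then have "(exp_time e + 3) * 1 \<le> (exp_time e + 3) * (Q ^ a * n ^ b)" by (rule mult_le_mono2)
  moreover have "time c s \<le> time_coeff c * (Q ^ a * n ^ b)" "time d s \<le> time_coeff d * (Q ^ a * n ^ b)"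
    using IF by (auto intro!: IF.IH)
  ultimately show ?case by (simp add: add_mult_distrib)
next
  case (For x y c)
  have wf: "x \<notin> reg_writes c" "wf_com c" "keeps_bounds \<beta> \<gamma> c" using For.prems by auto
  obtain a' where a': "a = Suc a'" "loop_depth c \<le> a'" using For.prems(4) by (cases a) auto
  define b' where "b' = b - w y"
  have b': "b = w y + b'" "weighted_depth w c \<le> b'" using For.prems(5) by (auto simp: b'_def)
  define X where "X = Q ^ a' * n ^ b'"
  have "1 \<le> X" using assms(2,3) by (simp add: X_def)
  have y: "sc s y \<le> Q * n ^ w y"
    using For.prems(3) assms(1)[of y] by (auto simp: bounded_def intro: le_trans)
  have "time c (iter x c s j) + 6 \<le> (time_coeff c + 6) * X" if "j < sc s y" for j
  proof -
    have "bounded \<beta> \<gamma> (iter x c s j)"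
      using bounded_loop[OF wf(1) For.prems(2,3), of j] that wf by (auto intro: bounded_sem)
    then have "time c (iter x c s j) \<le> time_coeff c * X"
      unfolding X_def by (rule For.IH[OF wf(2,3) _ a'(2) b'(2)])
    then show ?thesis using \<open>1 \<le> X\<close> by (simp add: add_mult_distrib)
  qed
  then have "(\<Sum>j<sc s y. time c (iter x c s j) + 6) \<le> sc s y * ((time_coeff c + 6) * X)"
    using sum_bounded_above[of "{..<sc s y}" "\<lambda>j. time c (iter x c s j) + 6"] by fastforce
  also have "\<dots> \<le> (Q * n ^ w y) * ((time_coeff c + 6) * X)" using y by (rule mult_le_mono1)
  also have "\<dots> = (time_coeff c + 6) * (Q ^ a * n ^ b)" by (simp add: X_def a' b' power_add mult_ac)
  finally have "(\<Sum>j<sc s y. time c (iter x c s j) + 6) \<le> (time_coeff c + 6) * (Q ^ a * n ^ b)" .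
  moreover have "3 * 1 \<le> 3 * (Q ^ a * n ^ b)" using assms(2,3) by (intro mult_le_mono2) simp
  ultimately show ?case unfolding time.simps time_coeff.simps add_mult_distrib by linarith
next
  case (Rd x)
  then show ?case using assms(2,3) by simp
next
  case (Wr e)
  have "1 \<le> Q ^ a * n ^ b" using assms(2,3) by simp
  then have "(exp_time e + 1) * 1 \<le> (exp_time e + 1) * (Q ^ a * n ^ b)" by (rule mult_le_mono2)
  then show ?case by simp
qed simp

section \<open>Powers of two\<close>

abbreviation pow2 :: "nat \<Rightarrow> nat \<Rightarrow> nat \<Rightarrow> com" where
  "pow2 i y x \<equiv> For i y (Asg x (Bin Plus (V x) (V x)))"

text \<open>Doubling a variable respects no positive bound in the sense of
  \<open>keeps_bounds\<close>, so these loops are evaluated exactly instead.\<close>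

lemma pow2_iter:
  assumes "x \<noteq> i"
  shows "iter i (Asg x (Bin Plus (V x) (V x))) s j = setv i j (setv x (sc s x * 2 ^ j) s)"
proof (induction j)
  case 0
  then show ?case using assms by (simp add: setv_def fun_eq_iff)
next
  case (Suc j)
  then show ?case using assms by (simp add: setv_def incv_def fun_eq_iff)
qed

lemma pow2_sem:
  assumes "x \<noteq> i"
  shows "sem (pow2 i y x) s = setv i (sc s y) (setv x (sc s x * 2 ^ sc s y) s)"
  by (simp only: sem.simps(6) pow2_iter[OF assms])

lemma pow2_safe:
  assumes "x \<noteq> i" "sc s x * 2 ^ sc s y \<le> B"
  shows "safe B (pow2 i y x) s"
proof -
  have "sc s x * 2 ^ j + sc s x * 2 ^ j \<le> B" if "j < sc s y" for j
  proof -
    have "sc s x * 2 ^ Suc j \<le> sc s x * 2 ^ sc s y"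
      using that by (intro mult_le_mono2 power_increasing) auto
    then have "sc s x * 2 ^ Suc j \<le> B" using assms(2) by (rule le_trans)
    then show ?thesis by (simp only: power_Suc mult_2 distrib_left)
  qed
  then show ?thesis using assms(1) by (simp only: safe.simps pow2_iter[OF assms(1)]) simp
qed

text \<open>The power of two bounds all quantities depending on \<open>k\<close>, such as the
  numbers of states and decoders. \<open>C\<close> and \<open>E\<close> are to be filled by
  constants of the program: its coefficients and its loop depth.\<close>

definition exp_bound :: "nat \<Rightarrow> nat \<Rightarrow> nat \<Rightarrow> nat" where
  "exp_bound C E k = C * (2 ^ ((3 * k + 3) ^ 4)) ^ E"

lemma computable_exp_bound: "computable (exp_bound C E)"
proof -
  let ?sq = "\<lambda>x. Asg x (Bin Times (V x) (V x))"
  let ?c = "Rd 0 ;; Asg 1 (Bin Plus (Bin Times (Num 3) (V 0)) (Num 3)) ;; ?sq 1 ;; ?sq 1 ;;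
    Asg 1 (Bin Times (V 1) (Num E)) ;; Asg 2 (Num C) ;; pow2 3 1 2 ;; Wr (V 2)"
  have "outp (sem ?c (init [k])) = [exp_bound C E k]" for k
  proof -
    have "(3 * k + 3) ^ 4 = (3 * k + 3) * (3 * k + 3) * ((3 * k + 3) * (3 * k + 3))"
      by (simp only: power4_eq_xxxx mult.assoc)
    then show ?thesis
      unfolding exp_bound_def by (simp only: pow2_sem sem.simps(1-5,7,8)) (simp add: power_mult)
  qed
  moreover have "computes (compile 0 ?c) [k] (outp (sem ?c (init [k])))" for k
    by (rule computes_comp) simp
  ultimately show ?thesis unfolding computable_def by metis
qed

section \<open>The program\<close>

definition lt :: "exp \<Rightarrow> exp \<Rightarrow> exp" where "lt e f = Bin Minus f e"
definition le :: "exp \<Rightarrow> exp \<Rightarrow> exp" where "le e f = Bin Minus (Bin Plus f (Num 1)) e"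
definition nt :: "exp \<Rightarrow> exp" where "nt e = Bin Minus (Num 1) e"
definition ne :: "exp \<Rightarrow> exp \<Rightarrow> exp" where "ne e f = Bin Plus (Bin Minus e f) (Bin Minus f e)"
definition eq :: "exp \<Rightarrow> exp \<Rightarrow> exp" where "eq e f = nt (ne e f)"
definition md :: "exp \<Rightarrow> exp \<Rightarrow> exp" where
  "md e f = Bin Minus e (Bin Times (Bin Divide e f) f)"

abbreviation pl :: "exp \<Rightarrow> exp \<Rightarrow> exp" (infixl \<open>\<boxplus>\<close> 65) where "e \<boxplus> f \<equiv> Bin Plus e f"
abbreviation mul :: "exp \<Rightarrow> exp \<Rightarrow> exp" (infixl \<open>\<boxtimes>\<close> 70) where "e \<boxtimes> f \<equiv> Bin Times e f"
abbreviation quo :: "exp \<Rightarrow> exp \<Rightarrow> exp" (infixl \<open>\<oslash>\<close> 70) where "e \<oslash> f \<equiv> Bin Divide e f"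

lemmas sugar = lt_def le_def nt_def ne_def eq_def md_def

lemma eval_sugar [simp]:
  "eval (lt e f) s = 0 \<longleftrightarrow> \<not> eval e s < eval f s"
  "0 < eval (lt e f) s \<longleftrightarrow> eval e s < eval f s"
  "eval (le e f) s = 0 \<longleftrightarrow> \<not> eval e s \<le> eval f s"
  "0 < eval (le e f) s \<longleftrightarrow> eval e s \<le> eval f s"
  "eval (nt e) s = of_bool (eval e s = 0)"
  "eval (ne e f) s = 0 \<longleftrightarrow> eval e s = eval f s"
  "0 < eval (ne e f) s \<longleftrightarrow> eval e s \<noteq> eval f s"
  "eval (eq e f) s = of_bool (eval e s = eval f s)"
  "eval (md e f) s = eval e s mod eval f s"
  by (auto simp: sugar minus_div_mult_eq_mod)

lemma ewf_sugar [simp]: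
  "ewf (lt e f) \<longleftrightarrow> ewf e \<and> ewf f" "ewf (le e f) \<longleftrightarrow> ewf e \<and> ewf f" "ewf (nt e) \<longleftrightarrow> ewf e"
  "ewf (ne e f) \<longleftrightarrow> ewf e \<and> ewf f" "ewf (eq e f) \<longleftrightarrow> ewf e \<and> ewf f" "ewf (md e f) \<longleftrightarrow> ewf e \<and> ewf f"
  by (auto simp: sugar)

abbreviation IFT :: "exp \<Rightarrow> com \<Rightarrow> com" where "IFT e c \<equiv> IF e c SKIP"

text \<open>
  Register 2 holds \<open>k\<close>, 3 the number \<open>K\<close> of letters in use, 4 \<open>n\<close>, 5 the number \<open>2 K + 1\<close> of
  types, 6 the number \<open>N\<close> of classes, 7 its square, 8 the number \<open>S\<close> of states of the automaton,
  9 \<open>K\<^sup>2\<close>, 10 the number of decoders; 11 is the vertex being added, 12 tells whether the graph so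
  far is realisable, 13 is the decoder being tried and 30 the one in use. In a transition, 20 is the
  old state, 32 the vertex read, 21 its letter, 27 the new state, and 29 tells whether a cycle arises.

  Array 2 is the input matrix, 3 lists the vertices by position, 4 are the letters, 5 the types,
  6 is the adjacency of types, 7 the decoder, 8 marks the states that can be completed, 18 and 9 are
  the letter and the successor state chosen there, 10 the bits of a state, 11 and 12 the arcs to and
  from the new vertex, 13 and 14 the classes that reach it and are reached from it, 15 the
  indegrees, 16 the vertices already sorted, 17 the positions.
\<close>

definition unpack :: "nat \<Rightarrow> nat \<Rightarrow> com" where
  "unpack b y = For 24 y (AAsg b (V 24) (md (V 14) (Num 2)) ;; Asg 14 (V 14 \<oslash> Num 2))"

definition arcs_com :: com where
  "arcs_com = Asg 28 (A 5 (V 32) \<boxtimes> V 3 \<boxplus> V 21) ;;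
   For 23 6
    (AAsg 11 (V 23) (ne (A 6 ((V 23 \<oslash> V 3) \<boxtimes> V 5 \<boxplus> A 5 (V 32))) (A 7 (V 21 \<boxtimes> V 3 \<boxplus> md (V 23) (V 3)))) ;;
     AAsg 12 (V 23) (ne (A 6 ((V 23 \<oslash> V 3) \<boxtimes> V 5 \<boxplus> A 5 (V 32))) (A 7 (md (V 23) (V 3) \<boxtimes> V 3 \<boxplus> V 21))) ;;
     AAsg 13 (V 23) (eq (V 23) (V 28)) ;; AAsg 14 (V 23) (eq (V 23) (V 28)))"

text \<open>One pass over all pairs suffices because the stored relation already describes whole
  paths; the arrays written here are not read in the loops.\<close>

definition inout_com :: com where
  "inout_com = Asg 29 (Num 0) ;;
   For 22 6 (For 23 6 (IFT (A 10 (V 22 \<boxtimes> V 6 \<boxplus> V 23))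
     (IFT (A 11 (V 23)) (AAsg 13 (V 22) (Num 1)) ;;
      IFT (A 12 (V 22)) (AAsg 14 (V 23) (Num 1)) ;;
      IFT (A 12 (V 22)) (IFT (A 11 (V 23)) (Asg 29 (Num 1))))))"

text \<open>Register 26 runs through the powers of two while the pairs are visited
  lexicographically. All values stay at most \<open>S\<close>, so the minima only serve the
  syntactic bound.\<close>

definition pack_com :: com where
  "pack_com = Asg 27 (Num 0) ;; Asg 26 (Num 1) ;;
   For 22 6 (For 23 6
     (IFT (A 10 (V 22 \<boxtimes> V 6 \<boxplus> V 23) \<boxplus> A 13 (V 22) \<boxtimes> A 14 (V 23)) (Asg 27 (EMin (V 27 \<boxplus> V 26) (V 8))) ;;
      Asg 26 (EMin (V 26 \<boxplus> V 26) (V 8))))"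

definition trans_com :: com where
  "trans_com = Asg 14 (V 20) ;; unpack 10 7 ;; arcs_com ;; inout_com ;; pack_com"

section \<open>Transitions of the automaton\<close>

text \<open>The invariant is indexed by the set of pairs already visited. Where only the progress of
  the count matters, it uses the cardinality of this set.\<close>

lemma For2_rule:
  assumes "x \<notin> reg_writes c" "y \<notin> reg_writes c" "v \<notin> reg_writes c" "x \<noteq> y" "y \<noteq> v" "x \<noteq> v"
    and I: "I {} s"
    and setx: "\<And>X s' i. I X s' \<Longrightarrow> I X (setv x i s')" and sety: "\<And>X s' i. I X s' \<Longrightarrow> I X (setv y i s')"
    and step: "\<And>s' i j. i < sc s u \<Longrightarrow> j < sc s v \<Longrightarrow> I ({..<i} \<times> {..<sc s v} \<union> {i} \<times> {..<j}) s' \<Longrightarrow>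
      sc s' x = i \<Longrightarrow> sc s' y = j \<Longrightarrow> agree (insert x (insert y (reg_writes c))) (arr_writes c) s s' \<Longrightarrow>
      I (insert (i, j) ({..<i} \<times> {..<sc s v} \<union> {i} \<times> {..<j})) (sem c s')"
  shows "I ({..<sc s u} \<times> {..<sc s v}) (sem (For x u (For y v c)) s)"
proof (rule For_rule[where I = "\<lambda>i s'. I ({..<i} \<times> {..<sc s v}) s'"])
  show "x \<notin> reg_writes (For y v c)" using assms by simp
  show "I ({..<0} \<times> {..<sc s v}) (setv x 0 s)" using setx[OF I] by simp
  fix i s'
  assume i: "i < sc s u" "I ({..<i} \<times> {..<sc s v}) s'" "sc s' x = i"
    and ag: "agree (insert x (reg_writes (For y v c))) (arr_writes (For y v c)) s s'"
  have v: "sc s' v = sc s v" using ag assms by (simp add: agree_def)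
  have "I ({..<i} \<times> {..<sc s v} \<union> {i} \<times> {..<sc s' v}) (sem (For y v c) s')"
  proof (rule For_rule[where I = "\<lambda>j s'. I ({..<i} \<times> {..<sc s v} \<union> {i} \<times> {..<j}) s'"])
    show "y \<notin> reg_writes c" by fact
    show "I ({..<i} \<times> {..<sc s v} \<union> {i} \<times> {..<0}) (setv y 0 s')" using sety[OF i(2)] by simp
    fix j s''
    assume j: "j < sc s' v" "I ({..<i} \<times> {..<sc s v} \<union> {i} \<times> {..<j}) s''" "sc s'' y = j"
      and ag': "agree (insert y (reg_writes c)) (arr_writes c) s' s''"
    have "sc s'' x = i" using ag' assms i(3) by (simp add: agree_def)
    moreover have "agree (insert x (insert y (reg_writes c))) (arr_writes c) s s''"
      using ag ag' by (auto simp: agree_def)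
    ultimately have "I (insert (i, j) ({..<i} \<times> {..<sc s v} \<union> {i} \<times> {..<j})) (sem c s'')"
      using step i j v by simp
    moreover have "insert (i, j) ({..<i} \<times> {..<sc s v} \<union> {i} \<times> {..<j}) =
        {..<i} \<times> {..<sc s v} \<union> {i} \<times> {..<Suc j}" by (auto simp: less_Suc_eq)
    ultimately show "I ({..<i} \<times> {..<sc s v} \<union> {i} \<times> {..<Suc j}) (incv y (sem c s''))"
      by (simp add: incv_def sety)
  qed
  moreover have "{..<i} \<times> {..<sc s v} \<union> {i} \<times> {..<sc s v} = {..<Suc i} \<times> {..<sc s v}"
    by (auto simp: less_Suc_eq)
  ultimately show "I ({..<Suc i} \<times> {..<sc s v}) (incv x (sem (For y v c) s'))"
    by (simp add: incv_def setx v del: sem.simps)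
qed

section \<open>Sets of bits as numbers, and relations as states\<close>

definition enc :: "nat \<Rightarrow> (nat \<Rightarrow> bool) \<Rightarrow> nat" where
  "enc M P = (\<Sum>j<M. of_bool (P j) * 2 ^ j)"

lemma enc_less: "enc M P < 2 ^ M"
proof (induction M)
  case (Suc M)
  then show ?case by (cases "P M") (auto simp: enc_def)
qed (simp add: enc_def)

lemma odd_enc: "j < M \<Longrightarrow> odd (enc M P div 2 ^ j) = P j"
proof (induction M)
  case (Suc M)
  have e: "enc (Suc M) P = enc M P + of_bool (P M) * 2 ^ M" by (simp add: enc_def)
  show ?case
  proof (cases "j = M")
    case True
    then show ?thesis using enc_less[of M P] by (simp add: e)
  next
    case False
    with Suc.prems have j: "j < M" by simp
    then have "(2::nat) ^ M = 2 ^ j * 2 ^ (M - j)" by (simp flip: power_add)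
    then have "enc (Suc M) P div 2 ^ j = enc M P div 2 ^ j + of_bool (P M) * 2 ^ (M - j)"
      by (simp add: e mult.left_commute)
    with Suc.IH[OF j] j show ?thesis by (cases "P M") auto
  qed
qed simp

lemma unpack_sem:
  assumes "y \<noteq> 14" "y \<noteq> 24" "i < sc s y"
  shows "ar (sem (unpack b y) s) b i = (sc s 14 div 2 ^ i) mod 2"
proof -
  define I where "I j s' \<longleftrightarrow> sc s' 14 = sc s 14 div 2 ^ j \<and> (\<forall>i<j. ar s' b i = (sc s 14 div 2 ^ i) mod 2)"
    for j and s' :: st
  have "I (sc s y) (sem (unpack b y) s)"
    unfolding unpack_def
  proof (rule For_rule)
    show "I 0 (setv 24 0 s)" by (simp add: I_def)
  next
    fix j s' assume "I j s'" "sc s' 24 = j"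
    then show "I (Suc j) (incv 24 (sem (AAsg b (V 24) (md (V 14) (Num 2)) ;; Asg 14 (V 14 \<oslash> Num 2)) s'))"
      by (auto simp: I_def less_Suc_eq div_mult2_eq[symmetric] mult.commute)
  qed simp
  with assms(3) show ?thesis by (simp add: I_def)
qed

locale alg = fixes K n :: nat
  assumes K: "0 < K"
begin

definition m :: nat where "m = Suc (2 * K)"
definition N :: nat where "N = m * K"
definition S :: nat where "S = 2 ^ (N * N)"
definition Dn :: nat where "Dn = 2 ^ (K * K)"

definition cst :: "st \<Rightarrow> bool" where
  "cst s \<longleftrightarrow> sc s 3 = K \<and> sc s 4 = n \<and> sc s 5 = m \<and> sc s 6 = N \<and> sc s 7 = N * N \<and> sc s 8 = S \<and>
     sc s 9 = K * K \<and> sc s 10 = Dn"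

lemma cst_agree:
  assumes "cst s" "agree X Y s s'" "X \<inter> {3..10} = {}"
  shows "cst s'"
proof -
  have "sc s' x = sc s x" if "x \<in> {3..10}" for x
    using assms(2,3) that by (auto simp: agree_def)
  then show ?thesis using assms(1) by (simp add: cst_def)
qed

lemma cst_sem: "cst s \<Longrightarrow> reg_writes c \<inter> {3..10} = {} \<Longrightarrow> cst (sem c s)"
  using cst_agree[OF _ agree_sem] by blast

definition rel_of :: "nat \<Rightarrow> nat rel" where
  "rel_of s = {(g, h). g < N \<and> h < N \<and> odd (s div 2 ^ (g * N + h))}"

lemma rel_of_0: "rel_of 0 = {}"
  by (simp add: rel_of_def)

definition TT :: "st \<Rightarrow> nat \<Rightarrow> nat \<Rightarrow> bool" where
  "TT s t t' \<longleftrightarrow> ar s 6 (t * m + t') \<noteq> 0"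

definition DD :: "st \<Rightarrow> nat \<Rightarrow> nat \<Rightarrow> bool" where
  "DD s a b \<longleftrightarrow> ar s 7 (a * K + b) \<noteq> 0"

definition cls :: "st \<Rightarrow> nat" where
  "cls s = ar s 5 (sc s 32) * K + sc s 21"

abbreviation fwd where "fwd s \<equiv> labelling.fwd K (TT s) (DD s)"
abbreviation bwd where "bwd s \<equiv> labelling.bwd K (TT s) (DD s)"

lemma lab_loc: "labelling K" using K by unfold_locales

lemmas fwd_def = labelling.fwd_def[OF lab_loc]
lemmas bwd_def = labelling.bwd_def[OF lab_loc]

lemma pair_less: "g < N \<Longrightarrow> h < N \<Longrightarrow> g * N + h < N * N"
proof -
  assume "g < N" "h < N"
  then have "g * N + h < Suc g * N" by simp
  also have "\<dots> \<le> N * N" using \<open>g < N\<close> by (intro mult_le_mono1) simp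
  finally show ?thesis .
qed

lemma arcs_com_sem:
  assumes "cst s" "sc s 21 < K" "ar s 5 (sc s 32) < m" "\<And>i. ar s 6 i \<le> 1" "\<And>i. ar s 7 i \<le> 1" "h < N"
  shows "ar (sem arcs_com s) 11 h \<noteq> 0 \<longleftrightarrow> fwd s (cls s) h"
    "ar (sem arcs_com s) 12 h \<noteq> 0 \<longleftrightarrow> bwd s (cls s) h"
    "ar (sem arcs_com s) 13 h \<noteq> 0 \<longleftrightarrow> h = cls s"
    "ar (sem arcs_com s) 14 h \<noteq> 0 \<longleftrightarrow> h = cls s"
proof -
  let ?s1 = "setv 28 (cls s) s"
  define I where "I j s' \<longleftrightarrow> (\<forall>h<j. (ar s' 11 h \<noteq> 0 \<longleftrightarrow> fwd s (cls s) h) \<and>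
    (ar s' 12 h \<noteq> 0 \<longleftrightarrow> bwd s (cls s) h) \<and> (ar s' 13 h \<noteq> 0 \<longleftrightarrow> h = cls s) \<and>
    (ar s' 14 h \<noteq> 0 \<longleftrightarrow> h = cls s))" for j and s' :: st
  have K3: "sc s 3 = K" and m5: "sc s 5 = m" and N6: "sc s 6 = N" using assms(1) by (auto simp: cst_def)
  have dm: "cls s div K = ar s 5 (sc s 32)" "cls s mod K = sc s 21"
    using assms(2) K by (simp_all add: cls_def)
  \<comment> \<open>\<open>ne\<close> compares numbers, \<open>fwd\<close> and \<open>bwd\<close>
    compare truth values; for entries 0 and 1 this is the same.\<close>
  have xor: "(i = j) = ((i \<noteq> 0) = (j \<noteq> 0))" if "i \<le> 1" "j \<le> 1" for i j :: nat using that by auto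
  have "I (sc ?s1 6) (sem (For 23 6
    (AAsg 11 (V 23) (ne (A 6 ((V 23 \<oslash> V 3) \<boxtimes> V 5 \<boxplus> A 5 (V 32))) (A 7 (V 21 \<boxtimes> V 3 \<boxplus> md (V 23) (V 3)))) ;;
     AAsg 12 (V 23) (ne (A 6 ((V 23 \<oslash> V 3) \<boxtimes> V 5 \<boxplus> A 5 (V 32))) (A 7 (md (V 23) (V 3) \<boxtimes> V 3 \<boxplus> V 21))) ;;
     AAsg 13 (V 23) (eq (V 23) (V 28)) ;; AAsg 14 (V 23) (eq (V 23) (V 28)))) ?s1)"
  proof (rule For_rule, goal_cases)
    case 2
    then show ?case by (simp add: I_def)
  next
    case (3 j s')
    from 3(4) have eqs: "sc s' 3 = K" "sc s' 5 = m" "sc s' 32 = sc s 32" "sc s' 21 = sc s 21"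
      "sc s' 28 = cls s" "ar s' 5 = ar s 5" "ar s' 6 = ar s 6" "ar s' 7 = ar s 7"
      by (simp_all add: agree_def K3 m5)
    show ?case
      using 3(2,3) dm xor[OF assms(4,5)]
      by (simp add: I_def less_Suc_eq eqs fwd_def bwd_def TT_def DD_def)
  qed simp
  then have "I N (sem arcs_com s)" by (simp add: arcs_com_def cls_def K3 N6 del: sem.simps(6))
  with assms(6) show "ar (sem arcs_com s) 11 h \<noteq> 0 \<longleftrightarrow> fwd s (cls s) h"
    "ar (sem arcs_com s) 12 h \<noteq> 0 \<longleftrightarrow> bwd s (cls s) h"
    "ar (sem arcs_com s) 13 h \<noteq> 0 \<longleftrightarrow> h = cls s"
    "ar (sem arcs_com s) 14 h \<noteq> 0 \<longleftrightarrow> h = cls s"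
    unfolding I_def by blast+
qed

lemma inout_com_sem:
  assumes "sc s 6 = N"
  defines "R \<equiv> {(g, h). g < N \<and> h < N \<and> ar s 10 (g * N + h) \<noteq> 0}"
  shows "ar (sem inout_com s) 13 g \<noteq> 0 \<longleftrightarrow> ar s 13 g \<noteq> 0 \<or> (\<exists>h. (g, h) \<in> R \<and> ar s 11 h \<noteq> 0)"
    "ar (sem inout_com s) 14 h \<noteq> 0 \<longleftrightarrow> ar s 14 h \<noteq> 0 \<or> (\<exists>g. ar s 12 g \<noteq> 0 \<and> (g, h) \<in> R)"
    "sc (sem inout_com s) 29 \<noteq> 0 \<longleftrightarrow> (\<exists>g h. ar s 12 g \<noteq> 0 \<and> (g, h) \<in> R \<and> ar s 11 h \<noteq> 0)"
proof -
  let ?s1 = "setv 29 0 s"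
  define I where "I X s' \<longleftrightarrow>
    (\<forall>g. ar s' 13 g \<noteq> 0 \<longleftrightarrow> ar s 13 g \<noteq> 0 \<or> (\<exists>h. (g, h) \<in> R \<inter> X \<and> ar s 11 h \<noteq> 0)) \<and>
    (\<forall>h. ar s' 14 h \<noteq> 0 \<longleftrightarrow> ar s 14 h \<noteq> 0 \<or> (\<exists>g. ar s 12 g \<noteq> 0 \<and> (g, h) \<in> R \<inter> X)) \<and>
    (sc s' 29 \<noteq> 0 \<longleftrightarrow> (\<exists>g h. ar s 12 g \<noteq> 0 \<and> (g, h) \<in> R \<inter> X \<and> ar s 11 h \<noteq> 0))" for X and s' :: st
  have "I ({..<sc ?s1 6} \<times> {..<sc ?s1 6})
    (sem (For 22 6 (For 23 6 (IFT (A 10 (V 22 \<boxtimes> V 6 \<boxplus> V 23))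
     (IFT (A 11 (V 23)) (AAsg 13 (V 22) (Num 1)) ;;
      IFT (A 12 (V 22)) (AAsg 14 (V 23) (Num 1)) ;;
      IFT (A 12 (V 22)) (IFT (A 11 (V 23)) (Asg 29 (Num 1))))))) ?s1)"
  proof (rule For2_rule, goal_cases)
    case 7
    then show ?case by (simp add: I_def)
  next
    case (8 X s' i)
    then show ?case by (simp add: I_def)
  next
    case (9 X s' i)
    then show ?case by (simp add: I_def)
  next
    case (10 s' i j)
    from 10(6) have eqs: "sc s' 6 = N" "ar s' 10 = ar s 10" "ar s' 11 = ar s 11" "ar s' 12 = ar s 12"
      by (simp_all add: agree_def assms(1))
    have R: "(i, j) \<in> R \<longleftrightarrow> ar s 10 (i * N + j) \<noteq> 0" using 10(1,2) assms(1) by (simp add: R_def)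
    let ?X = "{..<i} \<times> {..<sc ?s1 6} \<union> {i} \<times> {..<j}"
    show ?case
    proof (cases "(i, j) \<in> R")
      case False
      then have "R \<inter> insert (i, j) ?X = R \<inter> ?X" by auto
      then show ?thesis using 10(3-5) False R eqs by (simp add: I_def)
    next
      case True
      then have X: "R \<inter> insert (i, j) ?X = insert (i, j) (R \<inter> ?X)" by auto
      show ?thesis using 10(3-5) True R eqs unfolding I_def X
        by (simp split del: if_split) (auto split: if_split)
    qed
  qed simp_all
  then have I: "I ({..<N} \<times> {..<N}) (sem inout_com s)"
    by (simp add: inout_com_def assms(1) del: sem.simps(6))
  have X: "R \<inter> ({..<N} \<times> {..<N}) = R" by (auto simp: R_def)
  from I show "ar (sem inout_com s) 13 g \<noteq> 0 \<longleftrightarrow> ar s 13 g \<noteq> 0 \<or> (\<exists>h. (g, h) \<in> R \<and> ar s 11 h \<noteq> 0)"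
    "ar (sem inout_com s) 14 h \<noteq> 0 \<longleftrightarrow> ar s 14 h \<noteq> 0 \<or> (\<exists>g. ar s 12 g \<noteq> 0 \<and> (g, h) \<in> R)"
    "sc (sem inout_com s) 29 \<noteq> 0 \<longleftrightarrow> (\<exists>g h. ar s 12 g \<noteq> 0 \<and> (g, h) \<in> R \<and> ar s 11 h \<noteq> 0)"
    unfolding I_def X by blast+
qed

lemma pack_com_sem:
  assumes "sc s 6 = N" "sc s 8 = S"
  shows "sc (sem pack_com s) 27 =
    enc (N * N) (\<lambda>j. ar s 10 j \<noteq> 0 \<or> ar s 13 (j div N) \<noteq> 0 \<and> ar s 14 (j mod N) \<noteq> 0)"
proof -
  let ?s1 = "setv 26 1 (setv 27 0 s)"
  define P where "P j \<longleftrightarrow> ar s 10 j \<noteq> 0 \<or> ar s 13 (j div N) \<noteq> 0 \<and> ar s 14 (j mod N) \<noteq> 0" for j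
  define I where "I X s' \<longleftrightarrow> sc s' 26 = 2 ^ card X \<and> sc s' 27 = enc (card X) P"
    for X :: "(nat \<times> nat) set" and s' :: st
  have "I ({..<sc ?s1 6} \<times> {..<sc ?s1 6}) (sem (For 22 6 (For 23 6
     (IFT (A 10 (V 22 \<boxtimes> V 6 \<boxplus> V 23) \<boxplus> A 13 (V 22) \<boxtimes> A 14 (V 23)) (Asg 27 (EMin (V 27 \<boxplus> V 26) (V 8))) ;;
      Asg 26 (EMin (V 26 \<boxplus> V 26) (V 8))))) ?s1)"
  proof (rule For2_rule, goal_cases)
    case 7
    then show ?case by (simp add: I_def enc_def)
  next
    case (8 X s' i)
    then show ?case by (simp add: I_def)
  next
    case (9 X s' i)
    then show ?case by (simp add: I_def)
  next
    case (10 s' i j)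
    from 10(6) have eqs: "sc s' 6 = N" "sc s' 8 = S" "ar s' 10 = ar s 10" "ar s' 13 = ar s 13" "ar s' 14 = ar s 14"
      by (simp_all add: agree_def assms)
    have ij: "i < N" "j < N" using 10(1,2) assms(1) by simp_all
    let ?X = "{..<i} \<times> {..<sc ?s1 6} \<union> {i} \<times> {..<j}"
    \<comment> \<open>The number of visited pairs is the index \<open>i * N + j\<close> of the bit
      treated next.\<close>
    have "card ?X = card ({..<i} \<times> {..<N}) + card ({i} \<times> {..<j})"
      using assms(1) by (subst card_Un_disjoint) auto
    then have card: "card ?X = i * N + j" by simp
    have "(i, j) \<notin> ?X" by auto
    then have card': "card (insert (i, j) ?X) = Suc (i * N + j)" using card by simp
    have P: "P (i * N + j) \<longleftrightarrow> ar s 10 (i * N + j) \<noteq> 0 \<or> ar s 13 i \<noteq> 0 \<and> ar s 14 j \<noteq> 0"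
      using ij by (simp add: P_def)
    have e: "enc (Suc (i * N + j)) P = enc (i * N + j) P + of_bool (P (i * N + j)) * 2 ^ (i * N + j)"
      by (simp add: enc_def)
    have le: "2 ^ Suc (i * N + j) \<le> S"
      unfolding S_def using pair_less[OF ij] by (intro power_increasing) auto
    then have le1: "2 ^ (i * N + j) + 2 ^ (i * N + j) \<le> S" by (simp add: mult_2)
    have le2: "enc (i * N + j) P + 2 ^ (i * N + j) \<le> S" using enc_less[of "i * N + j" P] le1 by linarith
    show ?case
      using 10(3-5) P le1 le2 unfolding I_def card card' e
      by (auto simp: eqs min_def)
  qed simp_all
  then have "I ({..<N} \<times> {..<N}) (sem pack_com s)"
    by (simp add: pack_com_def assms(1) del: sem.simps(6))
  then show ?thesis unfolding I_def P_def by (simp only: card_cartesian_product card_lessThan)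
qed

lemma trans_com_sem:
  assumes "cst s" "sc s 21 < K" "ar s 5 (sc s 32) < m" "\<And>i. ar s 6 i \<le> 1" "\<And>i. ar s 7 i \<le> 1"
  defines "R \<equiv> rel_of (sc s 20)"
  shows "sc (sem trans_com s) 27 < S"
    "rel_of (sc (sem trans_com s) 27) = upd (fwd s (cls s)) (bwd s (cls s)) (cls s) R"
    "sc (sem trans_com s) 29 \<noteq> 0 \<longleftrightarrow> dead (fwd s (cls s)) (bwd s (cls s)) R"
proof -
  define s1 where "s1 = sem (unpack 10 7) (setv 14 (sc s 20) s)"
  define s2 where "s2 = sem arcs_com s1"
  define s3 where "s3 = sem inout_com s2"
  have s4: "sem trans_com s = sem pack_com s3"
    by (simp add: trans_com_def s1_def s2_def s3_def)
  have f1: "sc s1 x = sc s x" if "x \<noteq> 14" "x \<noteq> 24" for x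
    using that by (simp add: s1_def frame_sc unpack_def del: sem.simps)
  have g1: "ar s1 a = ar s a" if "a \<noteq> 10" for a
    using that by (simp add: s1_def frame_ar unpack_def del: sem.simps)
  have f2: "sc s2 x = sc s1 x" if "x \<notin> {23, 28}" for x
    using that by (simp add: s2_def frame_sc arcs_com_def del: sem.simps)
  have g2: "ar s2 a = ar s1 a" if "a \<notin> {11, 12, 13, 14}" for a
    using that by (simp add: s2_def frame_ar arcs_com_def del: sem.simps)
  have f3: "sc s3 x = sc s2 x" if "x \<notin> {22, 23, 29}" for x
    using that by (simp add: s3_def frame_sc inout_com_def del: sem.simps)
  have g3: "ar s3 a = ar s2 a" if "a \<notin> {13, 14}" for a
    using that by (simp add: s3_def frame_ar inout_com_def del: sem.simps)
  have c1: "cst s1" using assms(1) f1 by (simp add: cst_def)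
  have N: "sc s2 6 = N" "sc s3 6 = N" "sc s3 8 = S" using c1 f2 f3 by (simp_all add: cst_def)
  have same: "TT s1 = TT s" "DD s1 = DD s" "cls s1 = cls s"
    using f1 g1 by (simp_all add: TT_def DD_def cls_def fun_eq_iff)
  have clsN: "cls s < N"
  proof -
    have "cls s < Suc (ar s 5 (sc s 32)) * K" using assms(2) by (simp add: cls_def)
    also have "\<dots> \<le> N" unfolding N_def using assms(3) by (intro mult_le_mono1) simp
    finally show ?thesis .
  qed
  have r10: "ar s1 10 i = (sc s 20 div 2 ^ i) mod 2" if "i < N * N" for i
    unfolding s1_def using that assms(1) by (subst unpack_sem) (simp_all add: cst_def)
  have R: "{(g, h). g < N \<and> h < N \<and> ar s2 10 (g * N + h) \<noteq> 0} = R"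
    using r10 pair_less g2 by (auto simp: R_def rel_of_def odd_iff_mod_2_eq_one)
  have arcs: "ar s2 11 h \<noteq> 0 \<longleftrightarrow> fwd s (cls s) h" "ar s2 12 h \<noteq> 0 \<longleftrightarrow> bwd s (cls s) h"
    "ar s2 13 h \<noteq> 0 \<longleftrightarrow> h = cls s" "ar s2 14 h \<noteq> 0 \<longleftrightarrow> h = cls s" if "h < N" for h
    unfolding s2_def using arcs_com_sem[of s1 h] c1 assms(2-5) f1 g1 that
    by (simp_all add: same)
  have RN: "g < N" "h < N" if "(g, h) \<in> R" for g h using that by (auto simp: R_def rel_of_def)
  have in3: "ar s3 13 g \<noteq> 0 \<longleftrightarrow> g \<in> insert (cls s) {a. \<exists>c. (a, c) \<in> R \<and> fwd s (cls s) c}" if "g < N" for g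
  proof -
    have "(\<exists>h. (g, h) \<in> R \<and> ar s2 11 h \<noteq> 0) \<longleftrightarrow> (\<exists>c. (g, c) \<in> R \<and> fwd s (cls s) c)"
      using arcs(1) RN by metis
    then show ?thesis unfolding s3_def inout_com_sem(1)[OF N(1)] R using arcs(3)[OF that] by simp
  qed
  have out3: "ar s3 14 h \<noteq> 0 \<longleftrightarrow> h \<in> insert (cls s) {b. \<exists>d. bwd s (cls s) d \<and> (d, b) \<in> R}" if "h < N" for h
  proof -
    have "(\<exists>g. ar s2 12 g \<noteq> 0 \<and> (g, h) \<in> R) \<longleftrightarrow> (\<exists>d. bwd s (cls s) d \<and> (d, h) \<in> R)"
      using arcs(2) RN by metis
    then show ?thesis unfolding s3_def inout_com_sem(2)[OF N(1)] R using arcs(4)[OF that] by simp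
  qed
  have "sc s3 29 \<noteq> 0 \<longleftrightarrow> dead (fwd s (cls s)) (bwd s (cls s)) R"
  proof -
    have "ar s2 12 g \<noteq> 0 \<and> (g, h) \<in> R \<and> ar s2 11 h \<noteq> 0 \<longleftrightarrow>
        bwd s (cls s) g \<and> (g, h) \<in> R \<and> fwd s (cls s) h" for g h
      using arcs(1)[of h] arcs(2)[of g] RN[of g h] by (cases "(g, h) \<in> R") simp_all
    then show ?thesis unfolding s3_def inout_com_sem(3)[OF N(1)] R dead_def by presburger
  qed
  moreover have "sc (sem pack_com s3) 29 = sc s3 29"
    by (simp add: frame_sc pack_com_def del: sem.simps)
  ultimately show "sc (sem trans_com s) 29 \<noteq> 0 \<longleftrightarrow> dead (fwd s (cls s)) (bwd s (cls s)) R"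
    by (simp add: s4)
  define P where "P = (\<lambda>j. ar s3 10 j \<noteq> 0 \<or> ar s3 13 (j div N) \<noteq> 0 \<and> ar s3 14 (j mod N) \<noteq> 0)"
  have v: "sc (sem trans_com s) 27 = enc (N * N) P"
    unfolding s4 P_def by (rule pack_com_sem[OF N(2,3)])
  then show "sc (sem trans_com s) 27 < S" using enc_less[of "N * N" P] by (simp add: S_def)
  have "(g, h) \<in> rel_of (enc (N * N) P) \<longleftrightarrow> (g, h) \<in> upd (fwd s (cls s)) (bwd s (cls s)) (cls s) R" for g h
  proof (cases "g < N \<and> h < N")
    case True
    then have "(g, h) \<in> rel_of (enc (N * N) P) \<longleftrightarrow> P (g * N + h)"
      using odd_enc[OF pair_less] by (simp add: rel_of_def)
    also have "\<dots> \<longleftrightarrow> (g, h) \<in> R \<or> ar s3 13 g \<noteq> 0 \<and> ar s3 14 h \<noteq> 0"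
      using True g3 by (simp add: P_def flip: R)
    also have "\<dots> \<longleftrightarrow> (g, h) \<in> upd (fwd s (cls s)) (bwd s (cls s)) (cls s) R"
      unfolding upd_def Un_iff mem_Times_iff fst_conv snd_conv
      using in3[of g] out3[of h] True by blast
    finally show ?thesis .
  next
    case False
    then show ?thesis using RN clsN unfolding upd_def by (auto simp: rel_of_def)
  qed
  then show "rel_of (sc (sem trans_com s) 27) = upd (fwd s (cls s)) (bwd s (cls s)) (cls s) R"
    unfolding v by auto
qed

end

section \<open>Finding the labels\<close>

lemma agree_trans:
  "agree X Y s s' \<Longrightarrow> agree X' Y' s' s'' \<Longrightarrow> X' \<subseteq> X \<Longrightarrow> Y' \<subseteq> Y \<Longrightarrow> agree X Y s s''"
  unfolding agree_def by (metis subsetD)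

lemma agree_refl: "agree X Y s s"
  by (simp add: agree_def)

abbreviation cell :: exp where "cell \<equiv> (V 19 \<boxplus> Num 1) \<boxtimes> V 8 \<boxplus> V 20"

text \<open>Row \<open>r\<close> of the table concerns the last \<open>r\<close> positions of the
  word, with \<open>r\<close> in register 19. \<open>cell\<close> lies in row \<open>r + 1\<close>;
  row \<open>r\<close> is consulted at the successor state.\<close>

definition try_com :: com where
  "try_com = trans_com ;; IFT (nt (V 29)) (IFT (A 8 (V 19 \<boxtimes> V 8 \<boxplus> V 27))
     (AAsg 8 cell (Num 1) ;; AAsg 18 cell (V 21) ;; AAsg 9 cell (V 27)))"

definition cell_com :: com where
  "cell_com = AAsg 8 cell (Num 0) ;; For 21 3 try_com"

text \<open>The enclosing loop runs to \<open>n\<close>; the guard confines it to the current word,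
  which ends with the vertex being added.\<close>

definition row_com :: com where
  "row_com = IFT (le (V 19) (V 11)) (Asg 32 (A 3 (Bin Minus (V 11) (V 19))) ;; For 20 8 cell_com)"

definition feas_com :: com where
  "feas_com = For 20 8 (AAsg 8 (V 20) (Num 1)) ;; For 19 4 row_com"

abbreviation cell' :: exp where "cell' \<equiv> Bin Minus (V 11 \<boxplus> Num 1) (V 17) \<boxtimes> V 8 \<boxplus> V 38"

text \<open>State 0 is the empty relation, in which the automaton starts, so column 0 of the row of
  the whole word decides. The stored letters and successors are then followed down the rows.\<close>

definition extract_com :: com where
  "extract_com = IFT (A 8 ((V 11 \<boxplus> Num 1) \<boxtimes> V 8))
    (Asg 12 (Num 1) ;; Asg 30 (V 13) ;; Asg 38 (Num 0) ;;
     For 17 4 (IFT (le (V 17) (V 11)) (AAsg 4 (A 3 (V 17)) (A 18 cell') ;; Asg 38 (A 9 cell'))))"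

definition trans_ws :: "nat set" where "trans_ws = {14, 22, 23, 24, 26, 27, 28, 29}"
definition feas_ws :: "nat set" where "feas_ws = {14, 19, 20, 21, 22, 23, 24, 26, 27, 28, 29, 32}"
definition feas_wa :: "nat set" where "feas_wa = {8, 9, 10, 11, 12, 13, 14, 18}"

lemma ws_trans [simp]: "reg_writes trans_com = trans_ws" "arr_writes trans_com = {10, 11, 12, 13, 14}"
  by (auto simp: trans_com_def unpack_def arcs_com_def inout_com_def pack_com_def trans_ws_def)

lemma ws_try [simp]: "reg_writes try_com = trans_ws" "arr_writes try_com = feas_wa"
  by (auto simp: try_com_def feas_wa_def)

lemma ws_cell [simp]: "reg_writes cell_com = insert 21 trans_ws" "arr_writes cell_com = feas_wa"
  by (auto simp: cell_com_def feas_wa_def)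

lemma ws_row [simp]: "reg_writes row_com = feas_ws - {19}" "arr_writes row_com = feas_wa"
  by (auto simp: row_com_def feas_ws_def trans_ws_def)

lemma ws_feas [simp]: "reg_writes feas_com = feas_ws" "arr_writes feas_com = feas_wa"
  by (auto simp: feas_com_def feas_ws_def feas_wa_def)

lemma ws_extract [simp]: "reg_writes extract_com = {12, 17, 30, 38}" "arr_writes extract_com = {4}"
  by (auto simp: extract_com_def)

lemma cell_eq:
  assumes "\<sigma> < (S::nat)" "\<sigma>' < S"
  shows "r * S + \<sigma> = r' * S + \<sigma>' \<longleftrightarrow> r = r' \<and> \<sigma> = \<sigma>'"
proof
  assume eq: "r * S + \<sigma> = r' * S + \<sigma>'"
  have "r = (r * S + \<sigma>) div S" "r' = (r' * S + \<sigma>') div S" using assms by simp_all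
  with eq have "r = r'" by simp
  with eq show "r = r' \<and> \<sigma> = \<sigma>'" by simp
qed simp

section \<open>The table of completable states\<close>

locale dp = alg +
  fixes s0 :: st and v :: nat
  assumes c0: "cst s0" and v0: "sc s0 11 = v" and vn: "v < n"
    and ty0: "\<And>p. p \<le> v \<Longrightarrow> ar s0 5 (ar s0 3 p) < m"
    and T0: "\<And>i. ar s0 6 i \<le> 1" and D0: "\<And>i. ar s0 7 i \<le> 1"
    and ord0: "inj_on (ar s0 3) {..v}"
begin

sublocale lb: labelling K "TT s0" "DD s0" "ar s0 5"
  by (rule lab_loc)

definition suf :: "nat \<Rightarrow> nat list" where
  "suf r = map (ar s0 3) [Suc v - r..<Suc v]"

lemma suf_0: "suf 0 = []"
  by (simp add: suf_def)

lemma suf_Suc: "r \<le> v \<Longrightarrow> suf (Suc r) = ar s0 3 (v - r) # suf r"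
proof -
  assume "r \<le> v"
  then have "[v - r..<Suc v] = (v - r) # [Suc v - r..<Suc v]"
    by (simp add: upt_conv_Cons Suc_diff_le del: upt_Suc)
  then show ?thesis by (simp add: suf_def del: upt_Suc)
qed

abbreviation class_no :: "nat \<Rightarrow> nat \<Rightarrow> nat" where
  "class_no p a \<equiv> ar s0 5 (ar s0 3 p) * K + a"

definition step_ok :: "nat \<Rightarrow> nat \<Rightarrow> nat \<Rightarrow> bool" where
  "step_ok r \<sigma> a \<longleftrightarrow> \<not> lb.dies (class_no (v - r) a) (rel_of \<sigma>) \<and> lb.good (suf r) (lb.nxt (class_no (v - r) a) (rel_of \<sigma>))"

text \<open>A positive cell must also store a choice that keeps the rest completable; row 0, with
  nothing left to read, stores none.\<close>

definition entry :: "st \<Rightarrow> nat \<Rightarrow> nat \<Rightarrow> bool" where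
  "entry s r \<sigma> \<longleftrightarrow> (ar s 8 (r * S + \<sigma>) \<noteq> 0 \<longleftrightarrow> lb.good (suf r) (rel_of \<sigma>)) \<and>
     (ar s 8 (r * S + \<sigma>) \<noteq> 0 \<longrightarrow> r \<noteq> 0 \<longrightarrow>
       (let a = ar s 18 (r * S + \<sigma>); t = ar s 9 (r * S + \<sigma>) in
        a < K \<and> t < S \<and> step_ok (r - 1) \<sigma> a \<and> rel_of t = lb.nxt (class_no (Suc v - r) a) (rel_of \<sigma>)))"

abbreviation base :: "st \<Rightarrow> bool" where
  "base s \<equiv> agree feas_ws feas_wa s0 s"

lemma baseD:
  assumes "base s"
  shows "cst s" "TT s = TT s0" "DD s = DD s0" "sc s 11 = v" "sc s 3 = K" "sc s 4 = n" "sc s 8 = S"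
    "ar s 3 = ar s0 3" "ar s 5 = ar s0 5" "ar s 6 = ar s0 6" "ar s 7 = ar s0 7"
proof -
  show c: "cst s" using cst_agree[OF c0 assms] by (simp add: feas_ws_def)
  show "ar s 3 = ar s0 3" "ar s 5 = ar s0 5" and a: "ar s 6 = ar s0 6" "ar s 7 = ar s0 7"
    using assms by (simp_all add: agree_def feas_wa_def)
  show "TT s = TT s0" "DD s = DD s0" using a by (simp_all add: fun_eq_iff TT_def DD_def)
  show "sc s 11 = v" using assms v0 by (simp add: agree_def feas_ws_def)
  show "sc s 3 = K" "sc s 4 = n" "sc s 8 = S" using c by (simp_all add: cst_def)
qed

lemma try_sem:
  assumes base: "base s" and 32: "sc s 32 = ar s0 3 (v - r)" and r: "sc s 19 = r"
    and \<sigma>: "sc s 20 = \<sigma>" "\<sigma> < S" and a: "sc s 21 = a" "a < K"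
    and row: "\<forall>\<sigma><S. ar s 8 (r * S + \<sigma>) \<noteq> 0 \<longleftrightarrow> lb.good (suf r) (rel_of \<sigma>)"
  defines "i \<equiv> Suc r * S + \<sigma>"
  shows "step_ok r \<sigma> a \<Longrightarrow> \<exists>t<S. rel_of t = lb.nxt (class_no (v - r) a) (rel_of \<sigma>) \<and>
      ar (sem try_com s) 8 = (ar s 8)(i := 1) \<and> ar (sem try_com s) 18 = (ar s 18)(i := a) \<and>
      ar (sem try_com s) 9 = (ar s 9)(i := t)"
    "\<not> step_ok r \<sigma> a \<Longrightarrow> ar (sem try_com s) 8 = ar s 8 \<and> ar (sem try_com s) 18 = ar s 18 \<and>
      ar (sem try_com s) 9 = ar s 9"
proof -
  note b = baseD[OF base]
  let ?s = "sem trans_com s"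
  have cls: "cls s = class_no (v - r) a" using 32 a b by (simp add: cls_def)
  have tr: "sc ?s 27 < S" "rel_of (sc ?s 27) = lb.nxt (class_no (v - r) a) (rel_of \<sigma>)"
    "sc ?s 29 \<noteq> 0 \<longleftrightarrow> lb.dies (class_no (v - r) a) (rel_of \<sigma>)"
    using trans_com_sem[of s] b a 32 \<sigma> ty0[of "v - r"] T0 D0 unfolding cls by simp_all
  have f: "sc ?s 8 = S" "sc ?s 19 = r" "sc ?s 20 = \<sigma>" "sc ?s 21 = a"
    using b r \<sigma> a by (simp_all add: frame_sc trans_ws_def)
  have g: "ar ?s 8 = ar s 8" "ar ?s 18 = ar s 18" "ar ?s 9 = ar s 9"
    by (simp_all add: frame_ar)
  have cond: "step_ok r \<sigma> a \<longleftrightarrow> sc ?s 29 = 0 \<and> ar s 8 (r * S + sc ?s 27) \<noteq> 0"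
    using tr row[rule_format, OF tr(1)] by (auto simp: step_ok_def)
  show "\<exists>t<S. rel_of t = lb.nxt (class_no (v - r) a) (rel_of \<sigma>) \<and>
      ar (sem try_com s) 8 = (ar s 8)(i := 1) \<and> ar (sem try_com s) 18 = (ar s 18)(i := a) \<and>
      ar (sem try_com s) 9 = (ar s 9)(i := t)" if "step_ok r \<sigma> a"
  proof -
    have "sc ?s 29 = 0" "ar s 8 (r * S + sc ?s 27) \<noteq> 0" using that cond by auto
    then show ?thesis using tr(1,2) f g by (intro exI[of _ "sc ?s 27"]) (simp add: try_com_def i_def)
  qed
  show "ar (sem try_com s) 8 = ar s 8 \<and> ar (sem try_com s) 18 = ar s 18 \<and>
      ar (sem try_com s) 9 = ar s 9" if "\<not> step_ok r \<sigma> a"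
  proof -
    have "sc ?s 29 \<noteq> 0 \<or> ar s 8 (r * S + sc ?s 27) = 0" using that cond by auto
    then show ?thesis using f g by (auto simp: try_com_def)
  qed
qed

lemma good_Suc: "r \<le> v \<Longrightarrow> lb.good (suf (Suc r)) (rel_of \<sigma>) \<longleftrightarrow> (\<exists>a<K. step_ok r \<sigma> a)"
  by (simp add: suf_Suc step_ok_def)

lemma cell_sem:
  assumes base: "base s" and r: "sc s 19 = r" "r \<le> v" "sc s 32 = ar s0 3 (v - r)"
    and \<sigma>: "sc s 20 = \<sigma>" "\<sigma> < S"
    and row: "\<forall>\<sigma><S. entry s r \<sigma>"
  shows "entry (sem cell_com s) (Suc r) \<sigma>"
    "i \<noteq> Suc r * S + \<sigma> \<Longrightarrow> ar (sem cell_com s) 8 i = ar s 8 i \<and>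
      ar (sem cell_com s) 18 i = ar s 18 i \<and> ar (sem cell_com s) 9 i = ar s 9 i"
proof -
  let ?i = "Suc r * S + \<sigma>"
  define s1 where "s1 = seta 8 ?i 0 s"
  have s1: "sem (AAsg 8 cell (Num 0)) s = s1"
    using baseD[OF base] r \<sigma> by (simp add: s1_def)
  have base1: "base s1" using base by (simp add: agree_def s1_def feas_wa_def)
  define I where "I a s' \<longleftrightarrow>
    (ar s' 8 ?i \<noteq> 0 \<longleftrightarrow> (\<exists>b<a. step_ok r \<sigma> b)) \<and>
    (ar s' 8 ?i \<noteq> 0 \<longrightarrow> ar s' 18 ?i < K \<and> ar s' 9 ?i < S \<and> step_ok r \<sigma> (ar s' 18 ?i) \<and>
      rel_of (ar s' 9 ?i) = lb.nxt (class_no (v - r) (ar s' 18 ?i)) (rel_of \<sigma>)) \<and>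
    (\<forall>j. j \<noteq> ?i \<longrightarrow> ar s' 8 j = ar s 8 j \<and> ar s' 18 j = ar s 18 j \<and> ar s' 9 j = ar s 9 j)"
    for a and s' :: st
  have "I (sc s1 3) (sem (For 21 3 try_com) s1)"
  proof (rule For_rule, goal_cases)
    case 1
    then show ?case by (simp add: trans_ws_def)
  next
    case 2
    then show ?case by (simp add: I_def s1_def)
  next
    case (3 a s')
    have base': "base s'"
      by (rule agree_trans[OF base1 3(4)]) (auto simp: feas_ws_def trans_ws_def)
    have a: "a < K" using 3(1) baseD[OF base1] by simp
    have regs: "sc s' 32 = ar s0 3 (v - r)" "sc s' 19 = r" "sc s' 20 = \<sigma>"
      using 3(4) r \<sigma> by (simp_all add: agree_def trans_ws_def s1_def)
    have row': "\<forall>\<sigma>'<S. ar s' 8 (r * S + \<sigma>') \<noteq> 0 \<longleftrightarrow> lb.good (suf r) (rel_of \<sigma>')"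
    proof (intro allI impI)
      fix \<sigma>' assume that: "\<sigma>' < S"
      \<comment> \<open>The cell being filled lies in row \<open>r + 1\<close>, so the row consulted
        is left intact.\<close>
      have "r * S + \<sigma>' \<noteq> ?i" using cell_eq[OF that \<sigma>(2), of r "Suc r"] by simp
      then have "ar s' 8 (r * S + \<sigma>') = ar s 8 (r * S + \<sigma>')" using 3(2) by (simp add: I_def)
      with row that show "ar s' 8 (r * S + \<sigma>') \<noteq> 0 \<longleftrightarrow> lb.good (suf r) (rel_of \<sigma>')"
        by (simp add: entry_def)
    qed
    note t = try_sem[OF base' regs \<sigma>(2) 3(3) a row']
    show ?case
    proof (cases "step_ok r \<sigma> a")
      case True
      from t(1)[OF True] obtain t where "t < S" "rel_of t = lb.nxt (class_no (v - r) a) (rel_of \<sigma>)"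
        "ar (sem try_com s') 8 = (ar s' 8)(?i := 1)" "ar (sem try_com s') 18 = (ar s' 18)(?i := a)"
        "ar (sem try_com s') 9 = (ar s' 9)(?i := t)" by blast
      with 3(2) True a show ?thesis by (auto simp: I_def simp del: mult_Suc)
    next
      case False
      with t(2)[OF False] 3(2) show ?thesis by (simp add: I_def less_Suc_eq del: mult_Suc) blast
    qed
  qed
  then have I: "I K (sem cell_com s)"
    using baseD[OF base1] s1 by (simp add: cell_com_def del: sem.simps(3,6))
  then show "entry (sem cell_com s) (Suc r) \<sigma>"
    by (simp add: I_def entry_def good_Suc[OF r(2)] Let_def del: mult_Suc)
  show "i \<noteq> ?i \<Longrightarrow> ar (sem cell_com s) 8 i = ar s 8 i \<and>
      ar (sem cell_com s) 18 i = ar s 18 i \<and> ar (sem cell_com s) 9 i = ar s 9 i"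
    using I by (simp add: I_def)
qed

lemma entry_cong:
  "ar s' 8 (r * S + \<sigma>) = ar s 8 (r * S + \<sigma>) \<Longrightarrow> ar s' 18 (r * S + \<sigma>) = ar s 18 (r * S + \<sigma>) \<Longrightarrow>
   ar s' 9 (r * S + \<sigma>) = ar s 9 (r * S + \<sigma>) \<Longrightarrow> entry s r \<sigma> \<Longrightarrow> entry s' r \<sigma>"
  by (simp add: entry_def)

lemma row_sem:
  assumes base: "base s" and r: "sc s 19 = r"
    and rows: "\<And>r' \<sigma>. r' \<le> r \<Longrightarrow> r' \<le> Suc v \<Longrightarrow> \<sigma> < S \<Longrightarrow> entry s r' \<sigma>"
    and r': "r' \<le> Suc r" "r' \<le> Suc v" "\<sigma> < S"
  shows "entry (sem row_com s) r' \<sigma>"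
proof (cases "r \<le> v")
  case False
  then show ?thesis using rows r' r baseD[OF base] by (simp add: row_com_def)
next
  case True
  define s1 where "s1 = setv 32 (ar s0 3 (v - r)) s"
  have base1: "base s1" using base by (simp add: agree_def s1_def feas_ws_def)
  define I where "I j s' \<longleftrightarrow> (\<forall>\<sigma><j. entry s' (Suc r) \<sigma>) \<and> (\<forall>r'\<le>r. \<forall>\<sigma><S. entry s' r' \<sigma>)"
    for j and s' :: st
  have "I (sc s1 8) (sem (For 20 8 cell_com) s1)"
  proof (rule For_rule, goal_cases)
    case 1
    then show ?case by (simp add: trans_ws_def)
  next
    case 2
    then show ?case using rows True by (simp add: I_def s1_def entry_def)
  next
    case (3 j s')
    have base': "base s'"
      by (rule agree_trans[OF base1 3(4)]) (auto simp: feas_ws_def trans_ws_def)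
    have j: "j < S" using 3(1) baseD[OF base1] by simp
    have regs: "sc s' 19 = r" "sc s' 32 = ar s0 3 (v - r)"
      using 3(4) r by (simp_all add: agree_def trans_ws_def s1_def)
    have "\<forall>\<sigma><S. entry s' r \<sigma>" using 3(2) by (simp add: I_def)
    note c = cell_sem[OF base' regs(1) True regs(2) 3(3) j this]
    have keep: "entry (sem cell_com s') r' \<sigma>" if "entry s' r' \<sigma>" "\<sigma> < S" "\<not> (r' = Suc r \<and> \<sigma> = j)" for r' \<sigma>
    proof -
      have "r' * S + \<sigma> \<noteq> Suc r * S + j" using cell_eq[OF that(2) j] that(3) by blast
      then show ?thesis using c(2) that(1) by (intro entry_cong[OF _ _ _ that(1)]) auto
    qed
    have "entry (sem cell_com s') (Suc r) \<sigma>" if "\<sigma> < Suc j" for \<sigma>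
    proof (cases "\<sigma> = j")
      case False
      with that 3(2) j show ?thesis by (intro keep) (auto simp: I_def)
    qed (use c(1) in simp)
    moreover have "entry (sem cell_com s') r' \<sigma>" if "r' \<le> r" "\<sigma> < S" for r' \<sigma>
      using that 3(2) by (intro keep) (auto simp: I_def)
    ultimately show ?case by (simp add: I_def entry_def)
  qed
  then have "I S (sem row_com s)"
    using True r baseD[OF base] by (simp add: row_com_def s1_def del: sem.simps(6))
  with r' show ?thesis by (auto simp: I_def le_Suc_eq)
qed

lemma base_feas: "base (sem feas_com s0)"
  using agree_sem[of feas_com s0] by simp

lemma feas_sem:
  assumes "r \<le> Suc v" "\<sigma> < S"
  shows "entry (sem feas_com s0) r \<sigma>"
proof -
  let ?c0 = "For 20 8 (AAsg 8 (V 20) (Num 1))"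
  define s1 where "s1 = sem ?c0 s0"
  have "(\<lambda>j s'. \<forall>\<sigma><j. ar s' 8 \<sigma> \<noteq> 0) (sc s0 8) (sem ?c0 s0)"
    by (rule For_rule) (simp_all add: less_Suc_eq)
  then have one: "ar s1 8 \<sigma> \<noteq> 0" if "\<sigma> < S" for \<sigma>
    using that c0 by (simp add: s1_def cst_def del: sem.simps)
  have base1: "base s1" unfolding s1_def
    by (rule agree_trans[OF agree_refl agree_sem]) (auto simp: feas_ws_def feas_wa_def)
  define I where "I j s' \<longleftrightarrow> (\<forall>r\<le>j. r \<le> Suc v \<longrightarrow> (\<forall>\<sigma><S. entry s' r \<sigma>))" for j and s' :: st
  have "I (sc s1 4) (sem (For 19 4 row_com) s1)"
  proof (rule For_rule, goal_cases)
    case 2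
    then show ?case using one by (simp add: I_def entry_def suf_0)
  next
    case (3 j s')
    have base': "base s'"
      by (rule agree_trans[OF base1 3(4)]) (auto simp: feas_ws_def)
    show ?case using row_sem[OF base' 3(3)] 3(2) by (simp add: I_def entry_def)
  qed simp
  then have "I n (sem feas_com s0)"
    using baseD[OF base1] by (simp add: feas_com_def s1_def del: sem.simps(6))
  with assms vn show ?thesis by (simp add: I_def)
qed

abbreviation ordl :: "nat \<Rightarrow> nat list" where
  "ordl p \<equiv> map (ar s0 3) [0..<p]"

lemma suf_all: "suf (Suc v) = ordl (Suc v)"
  by (simp add: suf_def)

lemma extract_sem:
  assumes base: "base s" and entries: "\<And>r \<sigma>. r \<le> Suc v \<Longrightarrow> \<sigma> < S \<Longrightarrow> entry s r \<sigma>"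
  defines "s' \<equiv> sem extract_com s"
  shows "\<not> lb.good (ordl (Suc v)) {} \<Longrightarrow> s' = s"
    "lb.good (ordl (Suc v)) {} \<Longrightarrow> sc s' 12 = 1 \<and> sc s' 30 = sc s 13 \<and>
       (\<forall>p\<le>v. ar s' 4 (ar s0 3 p) < K) \<and> lb.alive (ar s' 4) (ordl (Suc v)) {}"
proof -
  note b = baseD[OF base]
  have S: "0 < S" by (simp add: S_def)
  have feas: "ar s 8 (Suc v * S) \<noteq> 0 \<longleftrightarrow> lb.good (ordl (Suc v)) {}"
    using entries[of "Suc v" 0] S unfolding entry_def suf_all by (simp add: rel_of_0 del: upt_Suc)
  then show "\<not> lb.good (ordl (Suc v)) {} \<Longrightarrow> s' = s"
    using b by (simp add: s'_def extract_com_def)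
  let ?s1 = "setv 38 0 (setv 30 (sc s 13) (setv 12 1 s))"
  let ?c = "IFT (le (V 17) (V 11)) (AAsg 4 (A 3 (V 17)) (A 18 cell') ;; Asg 38 (A 9 cell'))"
  \<comment> \<open>\<open>l\<close> ranges over all labellings that agree with the letters written
    so far: the array still changes at later vertices, and its final contents can be inserted in the
    end.\<close>
  define I where "I p t \<longleftrightarrow> (let q = min p (Suc v) in
     (\<forall>i<q. ar t 4 (ar s0 3 i) < K) \<and> sc t 38 < S \<and> lb.good (suf (Suc v - q)) (rel_of (sc t 38)) \<and>
     (\<forall>l ys. (\<forall>i<q. l (ar s0 3 i) = ar t 4 (ar s0 3 i)) \<longrightarrow>
        (lb.alive l (ordl q @ ys) {} \<longleftrightarrow> lb.alive l ys (rel_of (sc t 38)))))" for p and t :: st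
  assume gd: "lb.good (ordl (Suc v)) {}"
  have "I (sc ?s1 4) (sem (For 17 4 ?c) ?s1)"
  proof (rule For_rule, goal_cases)
    case 2
    then show ?case using gd S by (simp add: I_def rel_of_0 suf_all)
  next
    case (3 p t)
    have eqs: "sc t 11 = v" "sc t 8 = S" "ar t 3 = ar s0 3" "ar t 8 = ar s 8" "ar t 9 = ar s 9" "ar t 18 = ar s 18"
      using 3(4) b by (simp_all add: agree_def)
    show ?case
    proof (cases "p \<le> v")
      case False
      then have "min (Suc p) (Suc v) = min p (Suc v)" by simp
      with False 3(2,3) eqs show ?thesis by (simp add: I_def)
    next
      case True
      then have q: "min p (Suc v) = p" "min (Suc p) (Suc v) = Suc p" by simp_all
      have IH: "\<forall>i<p. ar t 4 (ar s0 3 i) < K" "sc t 38 < S" "lb.good (suf (Suc v - p)) (rel_of (sc t 38))"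
        "\<And>l ys. (\<forall>i<p. l (ar s0 3 i) = ar t 4 (ar s0 3 i)) \<Longrightarrow>
          (lb.alive l (ordl p @ ys) {} \<longleftrightarrow> lb.alive l ys (rel_of (sc t 38)))"
        using 3(2) unfolding I_def q Let_def by blast+
      let ?i = "(Suc v - p) * S + sc t 38"
      define a where "a = ar s 18 ?i"
      have "entry s (Suc v - p) (sc t 38)" using IH(2) by (intro entries) auto
      then have e: "a < K" "ar s 9 ?i < S" "step_ok (v - p) (sc t 38) a"
        "rel_of (ar s 9 ?i) = lb.nxt (class_no p a) (rel_of (sc t 38))"
        using IH(3) True by (auto simp: entry_def Let_def a_def Suc_diff_le)
      have vp: "v - (v - p) = p" using True by simp
      have so: "\<not> lb.dies (class_no p a) (rel_of (sc t 38))" "lb.good (suf (v - p)) (rel_of (ar s 9 ?i))"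
        using e(3,4) unfolding step_ok_def vp by simp_all
      let ?t = "incv 17 (sem ?c t)"
      have t4: "ar ?t 4 = (ar t 4)(ar s0 3 p := a)" and t38: "sc ?t 38 = ar s 9 ?i"
        using True 3(3) eqs by (simp_all add: a_def)
      \<comment> \<open>By injectivity of the order the new letter does not overwrite an earlier
        one.\<close>
      have neq: "ar s0 3 i \<noteq> ar s0 3 p" if "i < p" for i
        using ord0 that True by (auto dest: inj_onD)
      have "lb.alive l (ordl (Suc p) @ ys) {} \<longleftrightarrow> lb.alive l ys (rel_of (ar s 9 ?i))"
        if l: "\<forall>i<Suc p. l (ar s0 3 i) = ar ?t 4 (ar s0 3 i)" for l ys
      proof -
        have "l (ar s0 3 p) = a" "\<forall>i<p. l (ar s0 3 i) = ar t 4 (ar s0 3 i)"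
          using l neq t4 by (auto simp: less_Suc_eq)
        moreover have "ordl (Suc p) @ ys = ordl p @ (ar s0 3 p # ys)" by simp
        ultimately show ?thesis using IH(4)[of l "ar s0 3 p # ys"] so(1) e(4)
          by (simp del: upt_Suc)
      qed
      moreover have "\<forall>i<Suc p. ar ?t 4 (ar s0 3 i) < K" using IH(1) e(1) t4 by (auto simp: less_Suc_eq)
      ultimately show ?thesis unfolding I_def q Let_def t38 using e(2) so(2) by (simp del: upt_Suc sem.simps)
    qed
  qed simp
  moreover have "s' = sem (For 17 4 ?c) ?s1"
    using feas gd b by (simp add: s'_def extract_com_def del: sem.simps(6))
  moreover have "sc ?s1 4 = n" using b by simp
  ultimately have "I n s'" by simp
  moreover have mn: "min n (Suc v) = Suc v" using vn by simp
  ultimately have "\<forall>i<Suc v. ar s' 4 (ar s0 3 i) < K"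
    "lb.alive (ar s' 4) (ordl (Suc v) @ []) {} \<longleftrightarrow> lb.alive (ar s' 4) [] (rel_of (sc s' 38))"
    unfolding I_def Let_def mn by blast+
  moreover have "sc s' 12 = 1" "sc s' 30 = sc s 13"
    unfolding \<open>s' = sem (For 17 4 ?c) ?s1\<close> by (subst frame_sc; simp)+
  ultimately show "sc s' 12 = 1 \<and> sc s' 30 = sc s 13 \<and>
       (\<forall>p\<le>v. ar s' 4 (ar s0 3 p) < K) \<and> lb.alive (ar s' 4) (ordl (Suc v)) {}"
    by (simp add: less_Suc_eq_le)
qed

end

section \<open>Adding a vertex\<close>

text \<open>The type of an old vertex is twice its letter plus its adjacency to the new vertex; the
  new vertex gets the remaining value \<open>2 * K\<close>.\<close>

definition types_com :: com where
  "types_com = AAsg 3 (V 11) (V 11) ;; AAsg 5 (V 11) (Num 2 \<boxtimes> V 3) ;;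
   For 15 4 (IFT (lt (V 15) (V 11))
     (AAsg 5 (V 15) (EMin (Num 2 \<boxtimes> A 4 (V 15) \<boxplus> A 2 (V 15 \<boxtimes> V 4 \<boxplus> V 11)) (Num 2 \<boxtimes> V 3))))"

text \<open>Many pairs of positions write to the same cell; they all write the same value because
  types determine adjacency.\<close>

definition tab_com :: com where
  "tab_com = For 17 4 (For 18 4 (IFT (lt (V 18) (V 17)) (IFT (le (V 17) (V 11))
     (AAsg 6 (A 5 (A 3 (V 18)) \<boxtimes> V 5 \<boxplus> A 5 (A 3 (V 17))) (A 2 (A 3 (V 18) \<boxtimes> V 4 \<boxplus> A 3 (V 17)))))))"

text \<open>After the first success the remaining rounds are idle, so array 7 keeps the bits of the
  decoder noted in register 30.\<close>

definition decs_com :: com where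
  "decs_com = For 13 10 (IFT (nt (V 12)) (Asg 14 (V 13) ;; unpack 7 9 ;; feas_com ;; extract_com))"

definition arc_if :: "exp \<Rightarrow> exp \<Rightarrow> com \<Rightarrow> com" where
  "arc_if x y c = IFT (ne x y) (IFT (ne (A 2 (x \<boxtimes> V 4 \<boxplus> y)) (A 7 (A 4 y \<boxtimes> V 3 \<boxplus> A 4 x))) c)"

definition indeg_com :: com where
  "indeg_com = For 15 4 (AAsg 15 (V 15) (Num 0) ;; AAsg 16 (V 15) (Num 0)) ;;
   For 15 4 (For 16 4 (IFT (le (V 15) (V 11)) (IFT (le (V 16) (V 11))
     (arc_if (V 15) (V 16) (AAsg 15 (V 16) (EMin (A 15 (V 16) \<boxplus> Num 1) (V 4)))))))"

definition pick_com :: com where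
  "pick_com = Asg 25 (Num 0) ;; For 15 4 (IFT (le (V 15) (V 11)) (IFT (nt (A 16 (V 15)))
     (IFT (nt (A 15 (V 15))) (Asg 25 (V 15)))))"

definition drop_com :: com where
  "drop_com = For 16 4 (IFT (le (V 16) (V 11))
     (arc_if (V 25) (V 16) (AAsg 15 (V 16) (Bin Minus (A 15 (V 16)) (Num 1)))))"

definition place_com :: com where
  "place_com = IFT (le (V 17) (V 11))
     (pick_com ;; AAsg 16 (V 25) (Num 1) ;; AAsg 3 (V 17) (V 25) ;; drop_com)"

definition sort_com :: com where
  "sort_com = indeg_com ;; For 17 4 place_com"

definition add_com :: com where
  "add_com = types_com ;; tab_com ;; Asg 12 (Num 0) ;; decs_com ;; IFT (V 12) sort_com"

definition main_com :: com where
  "main_com = Asg 12 (Num 1) ;; For 11 4 (IFT (V 12) add_com)"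

lemma ws_parts [simp]:
  "reg_writes types_com = {15}" "arr_writes types_com = {3, 5}"
  "reg_writes tab_com = {17, 18}" "arr_writes tab_com = {6}"
  "reg_writes (arc_if x y c) = reg_writes c" "arr_writes (arc_if x y c) = arr_writes c"
  "reg_writes indeg_com = {15, 16}" "arr_writes indeg_com = {15, 16}"
  "reg_writes pick_com = {15, 25}" "arr_writes pick_com = {}"
  "reg_writes drop_com = {16}" "arr_writes drop_com = {15}"
  "reg_writes place_com = {15, 16, 25}" "arr_writes place_com = {3, 15, 16}"
  "reg_writes sort_com = {15, 16, 17, 25}" "arr_writes sort_com = {3, 15, 16}"
  "reg_writes (unpack b z) = {14, 24}" "arr_writes (unpack b z) = {b}"
  by (auto simp: types_com_def tab_com_def arc_if_def indeg_com_def pick_com_def drop_com_def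
      place_com_def sort_com_def unpack_def)

lemma ws_decs [simp]:
  "reg_writes decs_com = insert 13 ({12, 17, 24, 30, 38} \<union> feas_ws)" "arr_writes decs_com = insert 4 (insert 7 feas_wa)"
  by (auto simp: decs_com_def feas_ws_def)

lemma unpack_le:
  assumes "\<And>i. ar s b i \<le> 1"
  shows "ar (sem (unpack b y) s) b i \<le> 1"
proof -
  have "(\<lambda>j s'. \<forall>i. ar s' b i \<le> 1) (sc s y) (sem (unpack b y) s)"
    unfolding unpack_def
  proof (rule For_rule, goal_cases)
    case (3 j s')
    have "n mod 2 \<le> 1" for n :: nat by presburger
    with 3 show ?case by simp
  qed (use assms in simp_all)
  then show ?thesis by blast
qed

lemma arcs_on_cong:
  assumes "\<And>x. x \<in> W \<Longrightarrow> l x = l' x" "\<And>x y. x \<in> W \<Longrightarrow> y \<in> W \<Longrightarrow> D (l' x) (l' y) = D' (l' x) (l' y)"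
  shows "arcs_on adj D l W = arcs_on adj D' l' W"
  using assms by (auto simp: arcs_on_def arc_def)

section \<open>Types, decoders and the invariant of the main loop\<close>

locale graph_alg = alg +
  fixes adj :: "nat \<Rightarrow> nat \<Rightarrow> bool"
  assumes sym: "adj x y = adj y x"
begin

definition realizable :: "nat set \<Rightarrow> bool" where
  "realizable W \<longleftrightarrow> (\<exists>(D :: nat \<Rightarrow> nat \<Rightarrow> bool) l. (\<forall>x\<in>W. l x < K) \<and> acyclic (arcs_on adj D l W))"

lemma realizable_mono: "realizable W' \<Longrightarrow> W \<subseteq> W' \<Longrightarrow> realizable W"
  unfolding realizable_def by (meson acyclic_subset arcs_on_mono subsetD)

definition adj_ok :: "st \<Rightarrow> bool" where
  "adj_ok s \<longleftrightarrow> (\<forall>x<n. \<forall>y<n. ar s 2 (x * n + y) = of_bool (adj x y))"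

definition dec_ok :: "st \<Rightarrow> bool" where
  "dec_ok s \<longleftrightarrow> sc s 30 < Dn \<and> (\<forall>j<K * K. ar s 7 j = (sc s 30 div 2 ^ j) mod 2)"

definition Dof :: "nat \<Rightarrow> nat \<Rightarrow> nat \<Rightarrow> bool" where
  "Dof d a b \<longleftrightarrow> odd (d div 2 ^ (a * K + b))"

lemma ab_less: "a < K \<Longrightarrow> b < K \<Longrightarrow> a * K + b < K * K"
proof -
  assume "a < K" "b < K"
  then have "a * K + b < Suc a * K" by simp
  also have "\<dots> \<le> K * K" using \<open>a < K\<close> by (intro mult_le_mono1) simp
  finally show ?thesis .
qed

lemma DD_Dof: "dec_ok s \<Longrightarrow> a < K \<Longrightarrow> b < K \<Longrightarrow> DD s a b = Dof (sc s 30) a b"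
  using ab_less[of a b] by (simp add: dec_ok_def DD_def Dof_def odd_iff_mod_2_eq_one)

text \<open>Only the values of a decoder on the \<open>K * K\<close> pairs of letters matter, so the
  numbers below \<open>Dn\<close> exhaust all decoders.\<close>

lemma Dof_ex: "\<exists>d<Dn. \<forall>a<K. \<forall>b<K. Dof d a b = D a b"
proof (intro exI conjI allI impI)
  show "enc (K * K) (\<lambda>j. D (j div K) (j mod K)) < Dn" unfolding Dn_def by (rule enc_less)
  fix a b assume "a < K" "b < K"
  then show "Dof (enc (K * K) (\<lambda>j. D (j div K) (j mod K))) a b = D a b"
    using odd_enc[OF ab_less[of a b]] by (simp add: Dof_def)
qed

text \<open>Arrays 3, 4 and 7 hold order, letters and decoder of a realisation of the graph on the
  first \<open>v\<close> vertices.\<close>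

definition word :: "nat \<Rightarrow> st \<Rightarrow> bool" where
  "word v s \<longleftrightarrow> bij_betw (ar s 3) {..<v} {..<v} \<and> (\<forall>x<v. ar s 4 x < K) \<and>
     (\<forall>p<v. \<forall>q<p. adj (ar s 3 q) (ar s 3 p) = DD s (ar s 4 (ar s 3 q)) (ar s 4 (ar s 3 p))) \<and>
     dec_ok s"

definition small :: "st \<Rightarrow> bool" where
  "small s \<longleftrightarrow> cst s \<and> adj_ok s \<and> (\<forall>i. ar s 6 i \<le> 1) \<and> (\<forall>i. ar s 7 i \<le> 1)"

definition state :: "nat \<Rightarrow> st \<Rightarrow> bool" where
  "state v s \<longleftrightarrow> small s \<and> (if sc s 12 \<noteq> 0 then word v s else \<not> realizable {..<n})"

definition typed :: "nat \<Rightarrow> st \<Rightarrow> bool" where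
  "typed v s \<longleftrightarrow> bij_betw (ar s 3) {..v} {..v} \<and> (\<forall>p\<le>v. ar s 5 (ar s 3 p) < m) \<and>
     (\<forall>p\<le>v. \<forall>q<p. \<forall>p'\<le>v. \<forall>q'<p'. ar s 5 (ar s 3 q) = ar s 5 (ar s 3 q') \<longrightarrow>
        ar s 5 (ar s 3 p) = ar s 5 (ar s 3 p') \<longrightarrow> adj (ar s 3 q) (ar s 3 p) = adj (ar s 3 q') (ar s 3 p'))"

text \<open>Between two old vertices adjacency follows from their old letters by the decoder, as
  their order is kept; adjacency to the new vertex is the parity of the type. Hence the types of two
  positions determine adjacency.\<close>

lemma types_sem:
  assumes s: "small s" and w: "word v s" and v: "sc s 11 = v" "v < n"
  shows "typed v (sem types_com s)"
proof -
  let ?s1 = "seta 5 v (2 * K) (seta 3 v v s)"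
  let ?c = "IFT (lt (V 15) (V 11))
     (AAsg 5 (V 15) (EMin (Num 2 \<boxtimes> A 4 (V 15) \<boxplus> A 2 (V 15 \<boxtimes> V 4 \<boxplus> V 11)) (Num 2 \<boxtimes> V 3)))"
  define t where "t x = 2 * ar s 4 x + of_bool (adj x v)" for x
  have K3: "sc s 3 = K" "sc s 4 = n" using s by (simp_all add: small_def cst_def)
  have labK: "ar s 4 x < K" if "x < v" for x using w that by (simp add: word_def)
  define I where "I j s' \<longleftrightarrow> (\<forall>x<min j v. ar s' 5 x = t x) \<and> ar s' 5 v = 2 * K" for j and s' :: st
  have "I (sc ?s1 4) (sem (For 15 4 ?c) ?s1)"
  proof (rule For_rule, goal_cases)
    case 2
    then show ?case by (simp add: I_def)
  next
    case (3 j s')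
    have eqs: "sc s' 3 = K" "sc s' 4 = n" "sc s' 11 = v" "ar s' 4 = ar s 4" "ar s' 2 = ar s 2"
      using 3(4) K3 v by (simp_all add: agree_def)
    show ?case
    proof (cases "j < v")
      case True
      have "ar s 2 (j * n + v) = of_bool (adj j v)" using s True v by (simp add: small_def adj_ok_def)
      moreover have "min (2 * ar s 4 j + of_bool (adj j v)) (2 * K) = t j"
        using labK[OF True] by (simp add: t_def)
      ultimately show ?thesis using True 3(2,3) eqs by (auto simp: I_def less_Suc_eq)
    next
      case False
      then have "min (Suc j) v = min j v" by simp
      with False 3(2,3) eqs show ?thesis by (simp add: I_def)
    qed
  qed simp
  then have I: "I n (sem types_com s)"
    using K3 v by (simp add: types_com_def del: sem.simps(6))
  have ord: "ar (sem types_com s) 3 = (ar s 3)(v := v)"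
    using v by (simp add: types_com_def frame_ar del: sem.simps(6))
  let ?o = "(ar s 3)(v := v)" and ?t = "ar (sem types_com s) 5"
  have mn: "min n v = v" using v by simp
  have tx: "?t x = t x" if "x < v" for x using I that unfolding I_def mn by blast
  have tv: "?t v = 2 * K" using I unfolding I_def by blast
  have bij: "bij_betw (ar s 3) {..<v} {..<v}" using w by (simp add: word_def)
  then have ov: "ar s 3 p < v" if "p < v" for p using that by (auto simp: bij_betw_def)
  have "bij_betw ?o {..<v} {..<v}" using bij by (subst bij_betw_cong[of _ _ "ar s 3"]) auto
  then have "bij_betw ?o ({..<v} \<union> {v}) ({..<v} \<union> {v})"
    by (rule bij_betw_combine) (simp_all add: bij_betw_def)
  moreover have "{..<v} \<union> {v} = {..v}" by auto
  ultimately have bij': "bij_betw ?o {..v} {..v}" by simp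
  have to: "?t (?o p) = (if p < v then 2 * ar s 4 (ar s 3 p) + of_bool (adj (ar s 3 p) v) else 2 * K)"
    if "p \<le> v" for p using that tv tx ov by (auto simp: t_def)
  have less: "2 * ar s 4 (ar s 3 p) + of_bool (adj (ar s 3 p) v) < 2 * K" if "p < v" for p
    using labK[OF ov[OF that]] by simp
  have "?t (?o p) < m" if "p \<le> v" for p
  proof (cases "p < v")
    case True
    then show ?thesis unfolding to[OF that] m_def using less[OF True] by simp
  next
    case False
    then show ?thesis unfolding to[OF that] m_def by simp
  qed
  moreover have "adj (?o q) (?o p) = adj (?o q') (?o p')"
    if "p \<le> v" "q < p" "p' \<le> v" "q' < p'" "?t (?o q) = ?t (?o q')" "?t (?o p) = ?t (?o p')"
    for p q p' q'
  proof -
    have qv: "q < v" "q' < v" using that by auto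
    have teq: "2 * ar s 4 (ar s 3 q) + of_bool (adj (ar s 3 q) v) =
        2 * ar s 4 (ar s 3 q') + of_bool (adj (ar s 3 q') v)"
      using that(5) qv to[of q] to[of q'] by simp
    then have leq: "ar s 4 (ar s 3 q) = ar s 4 (ar s 3 q')" and aeq: "adj (ar s 3 q) v = adj (ar s 3 q') v"
      by (auto split: if_splits simp: of_bool_def; presburger)+
    have pv: "p = v \<longleftrightarrow> p' = v"
      using that(1,3,6) to[of p] to[of p'] less[of p] less[of p'] by (auto split: if_splits)
    show ?thesis
    proof (cases "p = v")
      case True
      with pv aeq qv show ?thesis by simp
    next
      case False
      with pv that have pp: "p < v" "p' < v" by auto
      have "2 * ar s 4 (ar s 3 p) + of_bool (adj (ar s 3 p) v) =
          2 * ar s 4 (ar s 3 p') + of_bool (adj (ar s 3 p') v)"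
        using that(6) pp to[of p] to[of p'] by simp
      then have "ar s 4 (ar s 3 p) = ar s 4 (ar s 3 p')"
        by (auto split: if_splits simp: of_bool_def; presburger)
      moreover have "adj (ar s 3 q) (ar s 3 p) = DD s (ar s 4 (ar s 3 q)) (ar s 4 (ar s 3 p))"
        "adj (ar s 3 q') (ar s 3 p') = DD s (ar s 4 (ar s 3 q')) (ar s 4 (ar s 3 p'))"
        using w pp that(2,4) by (simp_all add: word_def)
      ultimately show ?thesis using pp qv leq by simp
    qed
  qed
  ultimately show ?thesis unfolding typed_def ord using bij' by blast
qed

lemma tab_sem:
  assumes s: "small s" and t: "typed v s" and v: "sc s 11 = v" "v < n"
  shows "\<forall>i. ar (sem tab_com s) 6 i \<le> 1"
    "q < p \<Longrightarrow> p \<le> v \<Longrightarrow> TT (sem tab_com s) (ar s 5 (ar s 3 q)) (ar s 5 (ar s 3 p)) = adj (ar s 3 q) (ar s 3 p)"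
proof -
  have r: "sc s 3 = K" "sc s 4 = n" "sc s 5 = m" using s by (simp_all add: small_def cst_def)
  have bij: "bij_betw (ar s 3) {..v} {..v}" using t by (simp add: typed_def)
  have on: "ar s 3 p < n" if "p \<le> v" for p
    using bij_betw_apply[OF bij, of p] that v by simp
  define ix where "ix q p = ar s 5 (ar s 3 q) * m + ar s 5 (ar s 3 p)" for q p
  have ixeq: "adj (ar s 3 q) (ar s 3 p) = adj (ar s 3 q') (ar s 3 p')"
    if "p \<le> v" "q < p" "p' \<le> v" "q' < p'" "ix q p = ix q' p'" for p q p' q'
  proof -
    have time: "ar s 5 (ar s 3 i) < m" if "i \<le> v" for i using t that by (simp add: typed_def)
    have "ar s 5 (ar s 3 q) = ar s 5 (ar s 3 q') \<and> ar s 5 (ar s 3 p) = ar s 5 (ar s 3 p')"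
      using that(5) cell_eq[OF time[of p] time[of p']] that(1-4) by (simp add: ix_def)
    with t that(1-4) show ?thesis unfolding typed_def by blast
  qed
  define I where "I X s' \<longleftrightarrow> (\<forall>i. ar s' 6 i \<le> 1) \<and>
    (\<forall>(p, q)\<in>X. q < p \<longrightarrow> p \<le> v \<longrightarrow> ar s' 6 (ix q p) = of_bool (adj (ar s 3 q) (ar s 3 p)))"
    for X and s' :: st
  have "I ({..<sc s 4} \<times> {..<sc s 4}) (sem tab_com s)"
    unfolding tab_com_def
  proof (rule For2_rule, goal_cases)
    case 7
    then show ?case using s by (simp add: I_def small_def)
  next
    case (8 X s' i)
    then show ?case by (simp add: I_def)
  next
    case (9 X s' i)
    then show ?case by (simp add: I_def)
  next
    case (10 s' p q)
    let ?X = "{..<p} \<times> {..<sc s 4} \<union> {p} \<times> {..<q}"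
    have eqs: "sc s' 4 = n" "sc s' 5 = m" "sc s' 11 = v" "ar s' 2 = ar s 2" "ar s' 3 = ar s 3" "ar s' 5 = ar s 5"
      using 10(6) r v by (simp_all add: agree_def)
    show ?case
    proof (cases "q < p \<and> p \<le> v")
      case False
      then show ?thesis using 10(3-5) eqs by (auto simp: I_def)
    next
      case True
      have "ar s 2 (ar s 3 q * n + ar s 3 p) = of_bool (adj (ar s 3 q) (ar s 3 p))"
        using s True on[of p] on[of q] by (simp add: small_def adj_ok_def)
      then have a6: "ar (sem (IFT (lt (V 18) (V 17)) (IFT (le (V 17) (V 11))
         (AAsg 6 (A 5 (A 3 (V 18)) \<boxtimes> V 5 \<boxplus> A 5 (A 3 (V 17))) (A 2 (A 3 (V 18) \<boxtimes> V 4 \<boxplus> A 3 (V 17)))))) s') 6 =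
         (ar s' 6)(ix q p := of_bool (adj (ar s 3 q) (ar s 3 p)))"
        using True 10(4,5) eqs by (simp add: ix_def)
      show ?thesis unfolding I_def a6
      proof (intro conjI allI ballI)
        fix i show "((ar s' 6)(ix q p := of_bool (adj (ar s 3 q) (ar s 3 p)))) i \<le> 1"
          using 10(3) by (simp add: I_def)
      next
        fix z assume z: "z \<in> insert (p, q) ?X"
        obtain p' q' where pq: "z = (p', q')" by (cases z)
        have "((ar s' 6)(ix q p := of_bool (adj (ar s 3 q) (ar s 3 p)))) (ix q' p') =
            of_bool (adj (ar s 3 q') (ar s 3 p'))" if "q' < p'" "p' \<le> v"
        proof (cases "ix q' p' = ix q p")
          case eq: True
          then show ?thesis using ixeq[of p' q' p q] that True by simp
        next
          case False
          then have "(p', q') \<in> ?X" using z pq by auto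
          then show ?thesis using 10(3) that False by (auto simp: I_def)
        qed
        then show "case z of (p', q') \<Rightarrow> q' < p' \<longrightarrow> p' \<le> v \<longrightarrow>
          ((ar s' 6)(ix q p := of_bool (adj (ar s 3 q) (ar s 3 p)))) (ix q' p') =
            of_bool (adj (ar s 3 q') (ar s 3 p'))" by (simp add: pq)
      qed
    qed
  qed simp_all
  then have I: "I ({..<n} \<times> {..<n}) (sem tab_com s)" by (simp only: r)
  then show "\<forall>i. ar (sem tab_com s) 6 i \<le> 1" by (simp add: I_def)
  show "TT (sem tab_com s) (ar s 5 (ar s 3 q)) (ar s 5 (ar s 3 p)) = adj (ar s 3 q) (ar s 3 p)"
    if "q < p" "p \<le> v"
  proof -
    have "(p, q) \<in> {..<n} \<times> {..<n}" using that v by simp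
    with I that have "ar (sem tab_com s) 6 (ix q p) = of_bool (adj (ar s 3 q) (ar s 3 p))"
      unfolding I_def by fast
    then show ?thesis by (simp add: TT_def ix_def)
  qed
qed

definition found :: "nat \<Rightarrow> st \<Rightarrow> bool" where
  "found v s \<longleftrightarrow> (\<forall>x\<le>v. ar s 4 x < K) \<and> acyclic (arcs_on adj (DD s) (ar s 4) {..v}) \<and> dec_ok s"

lemma found_incv: "found v (incv 13 s) = found v s"
  by (simp add: found_def dec_ok_def DD_def[abs_def])

definition fails :: "nat \<Rightarrow> nat \<Rightarrow> bool" where
  "fails v d \<longleftrightarrow> \<not> (\<exists>l. (\<forall>x\<le>v. l x < K) \<and> acyclic (arcs_on adj (Dof d) l {..v}))"

lemma one_dec_sem:
  assumes s: "small s" and bij: "bij_betw (ar s 3) {..v} {..v}"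
    and ty: "\<And>p. p \<le> v \<Longrightarrow> ar s 5 (ar s 3 p) < m"
    and T: "\<And>q p. q < p \<Longrightarrow> p \<le> v \<Longrightarrow> TT s (ar s 5 (ar s 3 q)) (ar s 5 (ar s 3 p)) = adj (ar s 3 q) (ar s 3 p)"
    and v: "sc s 11 = v" "v < n" and d: "sc s 13 = d" "d < Dn" and ok: "sc s 12 = 0"
  defines "s' \<equiv> sem (Asg 14 (V 13) ;; unpack 7 9 ;; feas_com ;; extract_com) s"
  shows "if sc s' 12 = 0 then fails v d else found v s'"
proof -
  define s1 where "s1 = sem (unpack 7 9) (setv 14 d s)"
  have f1: "sc s1 x = sc s x" if "x \<notin> {14, 24}" for x
    using that by (simp add: s1_def frame_sc)
  have g1: "ar s1 a = ar s a" if "a \<noteq> 7" for a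
    using that by (simp add: s1_def frame_ar)
  have D1: "\<And>i. ar s1 7 i \<le> 1" using s unfolding s1_def by (intro unpack_le) (simp add: small_def)
  have bits: "ar s1 7 i = (d div 2 ^ i) mod 2" if "i < K * K" for i
    using that s unfolding s1_def by (subst unpack_sem) (simp_all add: small_def cst_def)
  have c1: "cst s1" using s f1 by (simp add: small_def cst_def)
  interpret dp K n s1 v
  proof
    show "ar s1 5 (ar s1 3 p) < m" if "p \<le> v" for p using ty[OF that] g1 by simp
    show "inj_on (ar s1 3) {..v}" using bij g1 by (simp add: bij_betw_def)
  qed (use c1 v f1 g1 s D1 in \<open>simp_all add: small_def\<close>)
  let ?xs = "ordl (Suc v)"
  have set: "set ?xs = {..v}" using bij g1 by (simp add: bij_betw_def atLeast0LessThan lessThan_Suc_atMost del: upt_Suc)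
  have dist: "distinct ?xs"
    using bij g1 by (simp add: distinct_map bij_betw_def atLeast0LessThan lessThan_Suc_atMost del: upt_Suc)
  have TTs: "TT s1 = TT s" using g1 by (simp add: TT_def fun_eq_iff)
  have srt: "sorted_wrt (\<lambda>x z. TT s1 (ar s1 5 x) (ar s1 5 z) = adj x z) ?xs"
    using T g1 by (auto simp: sorted_wrt_iff_nth_less TTs less_Suc_eq_le simp del: upt_Suc)
  have good: "lb.good ?xs {} \<longleftrightarrow>
      (\<exists>l. (\<forall>x\<in>{..v}. l x < K) \<and> acyclic (arcs_on adj (DD s1) l {..v}))"
    using lb.good_iff_acyclic[OF sym dist srt] unfolding set .
  have Dd: "DD s1 a b = Dof d a b" if "a < K" "b < K" for a b
    using bits[OF ab_less[OF that]] by (simp add: DD_def Dof_def odd_iff_mod_2_eq_one)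
  have cong: "arcs_on adj (DD s1) l {..v} = arcs_on adj (Dof d) l {..v}" if "\<forall>x\<in>{..v}. l x < K" for l
    using Dd that by (intro arcs_on_cong) auto
  have good': "lb.good ?xs {} \<longleftrightarrow> \<not> fails v d"
    unfolding good fails_def using cong by (metis atMost_iff)
  let ?s2 = "sem feas_com s1"
  have s': "s' = sem extract_com ?s2" by (simp add: s'_def s1_def d)
  note ex = extract_sem[OF base_feas feas_sem, folded s']
  have regs: "sc ?s2 12 = 0" "sc ?s2 13 = d"
    using f1 ok d by (simp_all add: frame_sc feas_ws_def)
  show ?thesis
  proof (cases "lb.good ?xs {}")
    case False
    then show ?thesis using ex(1) regs good' by simp
  next
    case True
    from ex(2)[OF _ _ True] have e: "sc s' 12 = 1" "sc s' 30 = d" "\<forall>p\<le>v. ar s' 4 (ar s1 3 p) < K"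
      "lb.alive (ar s' 4) ?xs {}" using regs by simp_all
    have lK: "ar s' 4 x < K" if "x \<in> {..v}" for x
      using that e(3) set unfolding set[symmetric] by (auto simp: less_Suc_eq_le simp del: upt_Suc)
    have "acyclic (arcs_on adj (DD s1) (ar s' 4) (set ([] @ ?xs)))"
      using lb.alive_iff_acyclic[of adj "[]" ?xs "ar s' 4"] sym dist srt lK e(4) set
      by (simp add: reach_def arcs_on_def acyclic_def del: upt_Suc)
    then have ac: "acyclic (arcs_on adj (DD s1) (ar s' 4) {..v})" by (simp only: append_Nil set)
    have "ar s' 7 = ar s1 7" by (simp add: s' frame_ar feas_wa_def)
    then have "DD s' = DD s1" "dec_ok s'"
      using bits d(2) e(2) by (simp_all add: DD_def dec_ok_def fun_eq_iff)
    with ac lK e(1) show ?thesis by (simp add: found_def)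
  qed
qed

lemma decs_sem:
  assumes s: "small s" and bij: "bij_betw (ar s 3) {..v} {..v}"
    and ty: "\<And>p. p \<le> v \<Longrightarrow> ar s 5 (ar s 3 p) < m"
    and T: "\<And>q p. q < p \<Longrightarrow> p \<le> v \<Longrightarrow> TT s (ar s 5 (ar s 3 q)) (ar s 5 (ar s 3 p)) = adj (ar s 3 q) (ar s 3 p)"
    and v: "sc s 11 = v" "v < n" and ok: "sc s 12 = 0"
  shows "\<forall>i. ar (sem decs_com s) 7 i \<le> 1"
    "if sc (sem decs_com s) 12 = 0 then \<not> realizable {..v} else found v (sem decs_com s)"
proof -
  let ?b = "Asg 14 (V 13) ;; unpack 7 9 ;; feas_com ;; extract_com"
  have Dn: "sc s 10 = Dn" using s by (simp add: small_def cst_def)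
  define I where "I d s' \<longleftrightarrow> (\<forall>i. ar s' 7 i \<le> 1) \<and>
    (if sc s' 12 = 0 then \<forall>d'<d. fails v d' else found v s')" for d and s' :: st
  have "I (sc s 10) (sem decs_com s)"
    unfolding decs_com_def
  proof (rule For_rule, goal_cases)
    case 1
    then show ?case by (simp add: feas_ws_def)
  next
    case 2
    then show ?case using s ok by (simp add: I_def small_def)
  next
    case (3 d s')
    show ?case
    proof (cases "sc s' 12 = 0")
      case False
      with 3(2) show ?thesis by (simp add: I_def found_incv)
    next
      case True
      have eqs: "sc s' x = sc s x" if "x \<in> {3..11}" for x
        using 3(4) that by (auto simp: agree_def feas_ws_def)
      have eqa: "ar s' 2 = ar s 2" "ar s' 3 = ar s 3" "ar s' 5 = ar s 5" "ar s' 6 = ar s 6"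
        using 3(4) by (simp_all add: agree_def feas_wa_def)
      have sm: "small s'" using s eqs eqa 3(2) by (simp add: small_def cst_def adj_ok_def I_def)
      have TTs: "TT s' = TT s" using eqa by (simp add: TT_def fun_eq_iff)
      have "if sc (sem ?b s') 12 = 0 then fails v d else found v (sem ?b s')"
        using sm bij ty T v True 3(1,3) eqs Dn by (intro one_dec_sem) (simp_all add: eqa TTs)
      moreover have "ar (sem ?b s') 7 i \<le> 1" for i
      proof -
        have "ar (sem ?b s') 7 = ar (sem (unpack 7 9) (setv 14 d s')) 7"
          using 3(3) by (simp add: frame_ar feas_wa_def)
        then show ?thesis using unpack_le[of "setv 14 d s'" 7] sm by (simp add: small_def)
      qed
      ultimately show ?thesis using 3(2) True
        by (simp add: I_def less_Suc_eq found_incv del: sem.simps(2,4))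
    qed
  qed
  then have I: "I Dn (sem decs_com s)" by (simp only: Dn)
  then show "\<forall>i. ar (sem decs_com s) 7 i \<le> 1" by (simp add: I_def)
  show "if sc (sem decs_com s) 12 = 0 then \<not> realizable {..v} else found v (sem decs_com s)"
  proof (cases "sc (sem decs_com s) 12 = 0")
    case True
    have "\<not> realizable {..v}"
    proof
      assume "realizable {..v}"
      then obtain D l where l: "\<forall>x\<le>v. l x < K" "acyclic (arcs_on adj D l {..v})"
        by (auto simp: realizable_def)
      obtain d where d: "d < Dn" "\<forall>a<K. \<forall>b<K. Dof d a b = D a b" using Dof_ex by blast
      have "arcs_on adj (Dof d) l {..v} = arcs_on adj D l {..v}"
        using l(1) d(2) by (intro arcs_on_cong) auto
      with l have "\<not> fails v d" by (auto simp: fails_def)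
      with I True d(1) show False by (simp add: I_def)
    qed
    with True show ?thesis by simp
  qed (use I in \<open>simp add: I_def\<close>)
qed

end

section \<open>Topological sorting\<close>

locale topsort = graph_alg +
  fixes s0 :: st and v :: nat
  assumes small0: "small s0" and found0: "found v s0" and v0: "sc s0 11 = v" and vn: "v < n"
begin

abbreviation base :: "st \<Rightarrow> bool" where
  "base s \<equiv> agree {15, 16, 17, 25} {3, 15, 16} s0 s"

definition E :: "nat \<Rightarrow> nat \<Rightarrow> bool" where
  "E x y = arc adj (DD s0) (ar s0 4) x y"

lemma baseD:
  assumes "base s"
  shows "sc s 3 = K" "sc s 4 = n" "sc s 11 = v" "ar s 2 = ar s0 2" "ar s 4 = ar s0 4" "ar s 7 = ar s0 7"
  using assms small0 v0 by (simp_all add: agree_def small_def cst_def)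

lemma arc_if_sem:
  assumes "base s" "eval x s \<le> v" "eval y s \<le> v"
  shows "sem (arc_if x y c) s = (if E (eval x s) (eval y s) then sem c s else s)"
proof -
  note b = baseD[OF assms(1)]
  have "ar s 2 (eval x s * n + eval y s) = of_bool (adj (eval x s) (eval y s))"
    using small0 assms(2,3) vn b by (simp add: small_def adj_ok_def)
  moreover have "ar s 7 i = of_bool (ar s 7 i \<noteq> 0)" for i
  proof -
    have "ar s 7 i \<le> 1" using small0 unfolding b small_def by blast
    then show ?thesis by (cases "ar s 7 i") auto
  qed
  then have "ar s 7 (ar s 4 (eval y s) * K + ar s 4 (eval x s)) =
      of_bool (DD s0 (ar s0 4 (eval y s)) (ar s0 4 (eval x s)))"
    unfolding b DD_def by simp
  ultimately show ?thesis using b by (auto simp: arc_if_def E_def arc_def)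
qed

definition indeg :: "nat set \<Rightarrow> nat \<Rightarrow> nat" where
  "indeg P y = card {x. x \<le> v \<and> x \<notin> P \<and> E x y}"

lemma indeg_sem:
  shows "\<forall>y\<le>v. ar (sem indeg_com s0) 15 y = indeg {} y" "\<forall>y\<le>v. ar (sem indeg_com s0) 16 y = 0"
proof -
  let ?init = "For 15 4 (AAsg 15 (V 15) (Num 0) ;; AAsg 16 (V 15) (Num 0))"
  let ?c = "IFT (le (V 15) (V 11)) (IFT (le (V 16) (V 11))
     (arc_if (V 15) (V 16) (AAsg 15 (V 16) (EMin (A 15 (V 16) \<boxplus> Num 1) (V 4)))))"
  have n: "sc s0 4 = n" using small0 by (simp add: small_def cst_def)
  define s1 where "s1 = sem ?init s0"
  define J where "J j s' \<longleftrightarrow> (\<forall>y<j. ar s' 15 y = 0 \<and> ar s' 16 y = 0)" for j and s' :: st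
  have "J (sc s0 4) (sem ?init s0)"
    by (rule For_rule[where I = J]) (simp_all add: J_def less_Suc_eq)
  then have z: "ar s1 15 y = 0" "ar s1 16 y = 0" if "y \<le> v" for y
    using that vn n by (simp_all add: J_def s1_def del: sem.simps)
  have base1: "base s1" unfolding s1_def
    by (rule agree_trans[OF agree_refl agree_sem]) simp_all
  note n1 = baseD(2)[OF base1]
  define I where "I X s' \<longleftrightarrow> (\<forall>y\<le>v. ar s' 15 y = card {x. (x, y) \<in> X \<and> x \<le> v \<and> E x y})"
    for X and s' :: st
  have "I ({..<sc s1 4} \<times> {..<sc s1 4}) (sem (For 15 4 (For 16 4 ?c)) s1)"
  proof (rule For2_rule, goal_cases)
    case 7
    then show ?case using z by (simp add: I_def)
  next
    case (8 X s' i)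
    then show ?case by (simp add: I_def)
  next
    case (9 X s' i)
    then show ?case by (simp add: I_def)
  next
    case (10 s' i j)
    let ?X = "{..<i} \<times> {..<sc s1 4} \<union> {i} \<times> {..<j}"
    have base': "base s'" by (rule agree_trans[OF base1 10(6)]) simp_all
    note b = baseD[OF base']
    have nX: "(i, j) \<notin> ?X" by auto
    show ?case
    proof (cases "i \<le> v \<and> j \<le> v \<and> E i j")
      case False
      have "sem ?c s' = s'" using False 10(4,5) b base' by (auto simp: arc_if_sem)
      moreover have "{x. (x, y) \<in> insert (i, j) ?X \<and> x \<le> v \<and> E x y} =
          {x. (x, y) \<in> ?X \<and> x \<le> v \<and> E x y}" if "y \<le> v" for y using False that by auto
      ultimately show ?thesis using 10(3) by (simp add: I_def del: sem.simps Un_iff insert_iff)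
    next
      case True
      let ?A = "\<lambda>X y. {x. (x, y) \<in> X \<and> x \<le> v \<and> E x y}"
      have sub: "?A X y \<subseteq> {..v}" for X y by auto
      have fin: "finite (?A X y)" for X y by (rule finite_subset[OF sub]) simp
      have eqj: "?A (insert (i, j) ?X) j = insert i (?A ?X j)" using True by auto
      have ni: "i \<notin> ?A ?X j" by simp
      have cj: "card (?A (insert (i, j) ?X) j) = Suc (card (?A ?X j))"
        unfolding eqj by (rule card_insert_disjoint[OF fin ni])
      \<comment> \<open>At most \<open>v + 1\<close> arcs enter a vertex, so the minimum with
        \<open>n\<close> in the program does not distort the count.\<close>
      have "card (?A (insert (i, j) ?X) j) \<le> card {..v}" by (intro card_mono sub) simp
      then have le: "card (?A (insert (i, j) ?X) j) \<le> n" using vn by simp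
      have cy: "?A (insert (i, j) ?X) y = ?A ?X y" if "y \<noteq> j" for y using that by auto
      have old: "ar s' 15 y = card (?A ?X y)" if "y \<le> v" for y using 10(3) that unfolding I_def by blast
      have new: "ar (sem ?c s') 15 = (ar s' 15)(j := min (Suc (card (?A ?X j))) n)"
        using True 10(4,5) b base' old[of j] by (simp add: arc_if_sem)
      show ?thesis unfolding I_def new
      proof (intro allI impI)
        fix y assume y: "y \<le> v"
        show "((ar s' 15)(j := min (Suc (card (?A ?X j))) n)) y = card (?A (insert (i, j) ?X) y)"
        proof (cases "y = j")
          case True
          show ?thesis using le unfolding True cj by (simp only: fun_upd_same min.absorb1)
        next
          case False
          then show ?thesis unfolding cy[OF False] using old[OF y] by simp
        qed
      qed
    qed
  qed simp_all
  then have I: "I ({..<n} \<times> {..<n}) (sem indeg_com s0)"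
    using n1 by (simp add: indeg_com_def s1_def del: sem.simps(6))
  have "{x. (x, y) \<in> {..<n} \<times> {..<n} \<and> x \<le> v \<and> E x y} = {x. x \<le> v \<and> x \<notin> {} \<and> E x y}" if "y \<le> v" for y
    using that vn by auto
  with I show "\<forall>y\<le>v. ar (sem indeg_com s0) 15 y = indeg {} y" by (simp add: I_def indeg_def)
  have "ar (sem indeg_com s0) 16 = ar s1 16"
    by (simp add: indeg_com_def s1_def frame_ar del: sem.simps(6))
  then show "\<forall>y\<le>v. ar (sem indeg_com s0) 16 y = 0" using z by simp
qed

lemma pick_sem:
  assumes base: "base s" and ex: "\<exists>x\<le>v. ar s 16 x = 0 \<and> ar s 15 x = 0"
  shows "sc (sem pick_com s) 25 \<le> v \<and> ar s 16 (sc (sem pick_com s) 25) = 0 \<and>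
    ar s 15 (sc (sem pick_com s) 25) = 0"
proof -
  let ?c = "IFT (le (V 15) (V 11)) (IFT (nt (A 16 (V 15))) (IFT (nt (A 15 (V 15))) (Asg 25 (V 15))))"
  define G where "G x \<longleftrightarrow> x \<le> v \<and> ar s 16 x = 0 \<and> ar s 15 x = 0" for x
  note b = baseD[OF base]
  define I where "I j s' \<longleftrightarrow> ((\<exists>x<j. G x) \<longrightarrow> G (sc s' 25))" for j and s' :: st
  have "I (sc (setv 25 0 s) 4) (sem (For 15 4 ?c) (setv 25 0 s))"
  proof (rule For_rule, goal_cases)
    case (3 j s')
    have "sc s' 11 = v" "ar s' 15 = ar s 15" "ar s' 16 = ar s 16"
      using 3(4) b by (simp_all add: agree_def)
    with 3(2,3) show ?case by (auto simp: I_def G_def less_Suc_eq)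
  qed (simp_all add: I_def)
  then have "I n (sem pick_com s)" using b by (simp add: pick_com_def del: sem.simps(6))
  moreover have "\<exists>x<n. G x" using ex vn by (auto simp: G_def intro: le_less_trans)
  ultimately show ?thesis by (simp add: I_def G_def)
qed

lemma drop_sem:
  assumes base: "base s" and z: "sc s 25 = z" "z \<le> v" and y: "y \<le> v"
  shows "ar (sem drop_com s) 15 y = ar s 15 y - of_bool (E z y)"
proof -
  let ?c = "IFT (le (V 16) (V 11)) (arc_if (V 25) (V 16) (AAsg 15 (V 16) (Bin Minus (A 15 (V 16)) (Num 1))))"
  note b = baseD[OF base]
  define I where "I j s' \<longleftrightarrow> (\<forall>y\<le>v. ar s' 15 y = ar s 15 y - of_bool (y < j \<and> E z y))" for j and s' :: st
  have "I (sc s 4) (sem drop_com s)"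
    unfolding drop_com_def
  proof (rule For_rule, goal_cases)
    case (3 j s')
    have base': "base s'" by (rule agree_trans[OF base 3(4)]) simp_all
    have zz: "sc s' 25 = z" using 3(4) z by (simp add: agree_def)
    show ?case
    proof (cases "j \<le> v \<and> E z j")
      case False
      then have "sem ?c s' = s'" using 3(3) zz z base' baseD[OF base'] by (auto simp: arc_if_sem)
      moreover have "(y < Suc j \<and> E z y) = (y < j \<and> E z y)" if "y \<le> v" for y
        using False that by (auto simp: less_Suc_eq)
      ultimately show ?thesis using 3(2) by (simp add: I_def del: sem.simps)
    next
      case True
      then have "ar (sem ?c s') 15 = (ar s' 15)(j := ar s' 15 j - 1)"
        using 3(3) zz z base' baseD[OF base'] by (simp add: arc_if_sem)
      then show ?thesis using 3(2) True by (auto simp: I_def less_Suc_eq simp del: sem.simps)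
    qed
  qed (simp_all add: I_def)
  moreover have "sc s 4 = n" using b by simp
  ultimately show ?thesis using y vn by (simp add: I_def)
qed

text \<open>The unplaced vertices still induce an acyclic relation, and a source among them is a
  vertex whose remaining indegree is zero.\<close>

lemma source_ex:
  assumes "P \<subseteq> {..v}" "card P \<le> v"
  shows "\<exists>x\<le>v. x \<notin> P \<and> indeg P x = 0"
proof -
  have "card P < card {..v}" using assms by simp
  then have "{..v} - P \<noteq> {}" using assms(1) by (metis Diff_eq_empty_iff card_mono finite_atMost not_le finite_subset)
  moreover have "acyclic (arcs_on adj (DD s0) (ar s0 4) ({..v} - P))"
    using found0 unfolding found_def by (meson acyclic_subset arcs_on_mono Diff_subset)
  ultimately obtain z where "z \<in> {..v} - P" "\<forall>x\<in>{..v} - P. \<not> E x z"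
    unfolding E_def using acyclic_source[of "{..v} - P"] by blast
  then show ?thesis by (intro exI[of _ z]) (auto simp: indeg_def)
qed

definition placed :: "st \<Rightarrow> nat set" where
  "placed s = {x. x \<le> v \<and> ar s 16 x \<noteq> 0}"

text \<open>The fourth condition is the goal. The third, that no arc leads from an unplaced vertex
  to a placed one, carries it over to the vertex placed next.\<close>

definition part :: "nat \<Rightarrow> st \<Rightarrow> bool" where
  "part p s \<longleftrightarrow> bij_betw (ar s 3) {..<p} (placed s) \<and>
     (\<forall>y\<le>v. ar s 15 y = indeg (placed s) y) \<and>
     (\<forall>q<p. \<forall>x\<le>v. x \<notin> placed s \<longrightarrow> \<not> E x (ar s 3 q)) \<and>
     (\<forall>p'<p. \<forall>q<p'. \<not> E (ar s 3 p') (ar s 3 q))"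

lemma place_sem:
  assumes base: "base s" and p: "sc s 17 = p" "p \<le> v" and part: "part p s"
  shows "part (Suc p) (sem place_com s)"
proof -
  note b = baseD[OF base]
  have bij: "bij_betw (ar s 3) {..<p} (placed s)" and deg: "\<forall>y\<le>v. ar s 15 y = indeg (placed s) y"
    using part by (simp_all add: part_def)
  have PV: "placed s \<subseteq> {..v}" by (auto simp: placed_def)
  have "card (placed s) = p" using bij_betw_same_card[OF bij] by simp
  then obtain x where "x \<le> v" "x \<notin> placed s" "indeg (placed s) x = 0"
    using source_ex[OF PV] p(2) by blast
  then have ex: "\<exists>x\<le>v. ar s 16 x = 0 \<and> ar s 15 x = 0" using deg by (auto simp: placed_def)
  define z where "z = sc (sem pick_com s) 25"
  have z: "z \<le> v" "ar s 16 z = 0" "ar s 15 z = 0" using pick_sem[OF base ex] by (simp_all add: z_def)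
  then have zP: "z \<notin> placed s" and z0: "indeg (placed s) z = 0" using deg by (auto simp: placed_def)
  have fin: "finite {x. x \<le> v \<and> x \<notin> P \<and> E x y}" for P y by (rule finite_subset[of _ "{..v}"]) auto
  have zE: "\<not> E x z" if "x \<le> v" "x \<notin> placed s" for x
    using z0 that fin unfolding indeg_def by auto
  define s1 where "s1 = seta 3 p z (seta 16 z 1 (sem pick_com s))"
  have base1: "base s1"
    by (rule agree_trans[OF base, of "{15, 25}" "{3, 16}"]) (auto simp: s1_def agree_def frame_sc frame_ar)
  have s1: "ar s1 3 = (ar s 3)(p := z)" "ar s1 16 = (ar s 16)(z := 1)" "ar s1 15 = ar s 15" "sc s1 25 = z"
    by (simp_all add: s1_def frame_ar z_def)
  have end1: "sem place_com s = sem drop_com s1"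
    using p b by (simp add: place_com_def s1_def z_def frame_sc)
  let ?s = "sem place_com s"
  have s': "ar ?s 3 = (ar s 3)(p := z)" "ar ?s 16 = (ar s 16)(z := 1)"
    unfolding end1 using s1 by (simp_all add: frame_ar)
  have P': "placed ?s = insert z (placed s)" using z by (auto simp: placed_def s')
  have "bij_betw ((ar s 3)(p := z)) ({..<p} \<union> {p}) (placed s \<union> {z})"
    using zP bij by (intro bij_betw_combine) (auto simp: bij_betw_def inj_on_def)
  moreover have "{..<p} \<union> {p} = {..<Suc p}" by auto
  ultimately have "bij_betw (ar ?s 3) {..<Suc p} (placed ?s)" unfolding s' P' by simp
  moreover have "ar ?s 15 y = indeg (placed ?s) y" if "y \<le> v" for y
  proof -
    have "ar ?s 15 y = indeg (placed s) y - of_bool (E z y)"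
      unfolding end1 drop_sem[OF base1 s1(4) z(1) that] s1(3) using deg that by simp
    also have "\<dots> = indeg (placed ?s) y"
    proof (cases "E z y")
      case True
      have "{x. x \<le> v \<and> x \<notin> placed ?s \<and> E x y} = {x. x \<le> v \<and> x \<notin> placed s \<and> E x y} - {z}"
        unfolding P' by auto
      then show ?thesis using True z(1) zP by (simp add: indeg_def card_Diff_singleton fin)
    next
      case False
      then have "{x. x \<le> v \<and> x \<notin> placed ?s \<and> E x y} = {x. x \<le> v \<and> x \<notin> placed s \<and> E x y}"
        unfolding P' by auto
      then show ?thesis using False by (simp add: indeg_def)
    qed
    finally show ?thesis .
  qed
  moreover have "\<not> E x (ar ?s 3 q)" if "q < Suc p" "x \<le> v" "x \<notin> placed ?s" for q x
    using that part zE unfolding s' P' part_def by (auto simp: less_Suc_eq)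
  moreover have "\<not> E (ar ?s 3 p') (ar ?s 3 q)" if "p' < Suc p" "q < p'" for p' q
    using that part z(1) zP unfolding s' part_def by (auto simp: less_Suc_eq)
  ultimately show ?thesis unfolding part_def by blast
qed

lemma sort_sem:
  shows "bij_betw (ar (sem sort_com s0) 3) {..v} {..v}"
    "\<forall>p\<le>v. \<forall>q<p. \<not> E (ar (sem sort_com s0) 3 p) (ar (sem sort_com s0) 3 q)"
proof -
  define s1 where "s1 = sem indeg_com s0"
  have base1: "base s1" unfolding s1_def
    by (rule agree_trans[OF agree_refl agree_sem]) simp_all
  have "placed s1 = {}" using indeg_sem(2) by (auto simp: placed_def s1_def)
  then have p0: "part 0 s1" using indeg_sem(1) by (simp add: part_def s1_def bij_betw_def)
  define I where "I p s \<longleftrightarrow> part (min p (Suc v)) s" for p s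
  have part_cong: "part p (incv 17 s) = part p s" for p s by (simp add: part_def placed_def)
  have "I (sc s1 4) (sem (For 17 4 place_com) s1)"
  proof (rule For_rule, goal_cases)
    case 2
    then show ?case using p0 by (simp add: I_def part_def placed_def)
  next
    case (3 p s)
    have base': "base s" by (rule agree_trans[OF base1 3(4)]) simp_all
    show ?case
    proof (cases "p \<le> v")
      case True
      then show ?thesis using place_sem[OF base' 3(3)] 3(2) by (simp add: I_def part_cong)
    next
      case False
      then have "sem place_com s = s" using 3(3) baseD[OF base'] by (simp add: place_com_def)
      moreover have "min (Suc p) (Suc v) = min p (Suc v)" using False by simp
      ultimately show ?thesis using 3(2) by (simp add: I_def part_cong)
    qed
  qed simp
  moreover have "min n (Suc v) = Suc v" using vn by simp
  ultimately have part: "part (Suc v) (sem sort_com s0)"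
    using baseD[OF base1] by (simp add: I_def sort_com_def s1_def del: sem.simps(6))
  then have bij: "bij_betw (ar (sem sort_com s0) 3) {..v} (placed (sem sort_com s0))"
    by (simp add: part_def lessThan_Suc_atMost)
  have "card (placed (sem sort_com s0)) = card {..v}" using bij_betw_same_card[OF bij] by simp
  then have "placed (sem sort_com s0) = {..v}"
    by (intro card_subset_eq) (auto simp: placed_def)
  with bij show "bij_betw (ar (sem sort_com s0) 3) {..v} {..v}" by simp
  show "\<forall>p\<le>v. \<forall>q<p. \<not> E (ar (sem sort_com s0) 3 p) (ar (sem sort_com s0) 3 q)"
    using part by (simp add: part_def less_Suc_eq_le)
qed

text \<open>Without an arc from a later to an earlier position, the decoder applied in order of
  positions gives the correct adjacency.\<close>

lemma word_sort: "word (Suc v) (sem sort_com s0)"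
proof -
  let ?s = "sem sort_com s0"
  have a: "ar ?s 4 = ar s0 4" "ar ?s 7 = ar s0 7" "sc ?s 30 = sc s0 30" by (simp_all add: frame_ar frame_sc)
  have D: "DD ?s = DD s0" by (simp add: DD_def[abs_def] a)
  have "adj (ar ?s 3 q) (ar ?s 3 p) = DD ?s (ar ?s 4 (ar ?s 3 q)) (ar ?s 4 (ar ?s 3 p))"
    if "p < Suc v" "q < p" for p q
  proof -
    have "ar ?s 3 p \<noteq> ar ?s 3 q"
      using sort_sem(1) that by (auto simp: bij_betw_def dest: inj_onD)
    moreover have "\<not> E (ar ?s 3 p) (ar ?s 3 q)" using sort_sem(2) that by simp
    ultimately show ?thesis using sym by (simp add: E_def arc_def D a)
  qed
  then show ?thesis using sort_sem(1) found0
    by (simp add: word_def found_def dec_ok_def a lessThan_Suc_atMost less_Suc_eq_le)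
qed

end

lemma ws_add [simp]:
  "reg_writes add_com = {12, 13, 15, 16, 17, 18, 24, 25, 30, 38} \<union> feas_ws"
  "arr_writes add_com = {3, 4, 5, 6, 7, 15, 16} \<union> feas_wa"
  by (auto simp: add_com_def feas_ws_def)

context graph_alg
begin

lemma small_cong:
  "small s \<Longrightarrow> cst s' \<Longrightarrow> ar s' 2 = ar s 2 \<Longrightarrow> ar s' 6 = ar s 6 \<Longrightarrow> ar s' 7 = ar s 7 \<Longrightarrow> small s'"
  by (simp add: small_def adj_ok_def)

lemma add_sem:
  assumes s: "small s" and w: "word v s" and v: "sc s 11 = v" "v < n"
  shows "small (sem add_com s)"
    "if sc (sem add_com s) 12 = 0 then \<not> realizable {..v} else word (Suc v) (sem add_com s)"
proof -
  define s1 where "s1 = sem types_com s"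
  define s2 where "s2 = sem tab_com s1"
  define s3 where "s3 = setv 12 0 s2"
  define s4 where "s4 = sem decs_com s3"
  have end4: "sem add_com s = (if sc s4 12 = 0 then s4 else sem sort_com s4)"
    by (simp add: add_com_def s1_def s2_def s3_def s4_def)
  have sm1: "small s1"
    by (rule small_cong[OF s]) (auto simp: s1_def frame_ar intro!: cst_sem s[unfolded small_def, THEN conjunct1])
  have v1: "sc s1 11 = v" using v by (simp add: s1_def frame_sc)
  have t1: "typed v s1" unfolding s1_def by (rule types_sem[OF s w v])
  note tab = tab_sem[OF sm1 t1 v1 v(2), folded s2_def]
  have sm2: "small s2"
  proof -
    have "cst s2" unfolding s2_def using sm1 by (intro cst_sem) (auto simp: small_def)
    moreover have "ar s2 2 = ar s1 2" "ar s2 7 = ar s1 7" by (simp_all add: s2_def frame_ar)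
    ultimately show ?thesis using sm1 tab(1) by (simp add: small_def adj_ok_def)
  qed
  have sm3: "small s3" using sm2 by (simp add: s3_def small_def cst_def adj_ok_def)
  have a3: "ar s3 3 = ar s1 3" "ar s3 5 = ar s1 5" "TT s3 = TT s2" "sc s3 11 = v" "sc s3 12 = 0"
    using v1 by (simp_all add: s3_def s2_def frame_ar frame_sc TT_def[abs_def])
  have dec: "\<forall>i. ar s4 7 i \<le> 1" "if sc s4 12 = 0 then \<not> realizable {..v} else found v s4"
  proof -
    have "bij_betw (ar s3 3) {..v} {..v}" "\<And>p. p \<le> v \<Longrightarrow> ar s3 5 (ar s3 3 p) < m"
      using t1 by (simp_all only: a3 typed_def)
    moreover have "\<And>q p. q < p \<Longrightarrow> p \<le> v \<Longrightarrow>
        TT s3 (ar s3 5 (ar s3 3 q)) (ar s3 5 (ar s3 3 p)) = adj (ar s3 3 q) (ar s3 3 p)"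
      unfolding a3 by (rule tab(2))
    ultimately show "\<forall>i. ar s4 7 i \<le> 1" "if sc s4 12 = 0 then \<not> realizable {..v} else found v s4"
      unfolding s4_def using decs_sem[OF sm3 _ _ _ a3(4) v(2) a3(5)] by blast+
  qed
  have sm4: "small s4"
  proof -
    have "cst s4" unfolding s4_def using sm3 by (intro cst_sem) (auto simp: small_def feas_ws_def)
    moreover have "ar s4 2 = ar s3 2" "ar s4 6 = ar s3 6" by (simp_all add: s4_def frame_ar feas_wa_def)
    ultimately show ?thesis using sm3 dec(1) by (simp add: small_def adj_ok_def)
  qed
  have v4: "sc s4 11 = v" using a3 by (simp add: s4_def frame_sc feas_ws_def)
  have "small (sem sort_com s4)"
    by (rule small_cong[OF sm4]) (auto simp: frame_ar intro!: cst_sem sm4[unfolded small_def, THEN conjunct1])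
  then show "small (sem add_com s)" using end4 sm4 by simp
  show "if sc (sem add_com s) 12 = 0 then \<not> realizable {..v} else word (Suc v) (sem add_com s)"
  proof (cases "sc s4 12 = 0")
    case True
    then show ?thesis using end4 dec(2) by simp
  next
    case False
    interpret topsort K n adj s4 v
      using sm4 dec(2) False v4 v(2) by unfold_locales simp_all
    show ?thesis using end4 False word_sort by (simp add: frame_sc)
  qed
qed

text \<open>The conditions on register 30 and array 7 make the empty word a valid start: decoder 0
  has only zero bits.\<close>

lemma main_sem:
  assumes "small s" "sc s 30 = 0" "\<And>i. ar s 7 i = 0"
  shows "state n (sem main_com s)"
proof -
  let ?s = "setv 12 1 s"
  have n: "sc s 4 = n" using assms(1) by (simp add: small_def cst_def)
  have cong: "state v (setv 11 i t) = state v t" for v i t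
    by (simp add: state_def small_def cst_def adj_ok_def word_def dec_ok_def DD_def[abs_def])
  have "state (sc ?s 4) (sem (For 11 4 (IFT (V 12) add_com)) ?s)"
  proof (rule For_rule, goal_cases)
    case 1
    then show ?case by (simp add: feas_ws_def)
  next
    case 2
    have "state 0 ?s" using assms
      by (simp add: state_def small_def cst_def adj_ok_def word_def dec_ok_def Dn_def bij_betw_def)
    then show ?case by (simp only: cong)
  next
    case (3 v t)
    have "state (Suc v) (sem (IFT (V 12) add_com) t)"
    proof (cases "sc t 12 = 0")
      case True
      with 3(2) show ?thesis by (simp add: state_def)
    next
      case False
      have vn: "v < n" using 3(1) n by simp
      have t: "small t" "word v t" using 3(2) False by (auto simp: state_def)
      have "{..v} \<subseteq> {..<n}" using vn by auto
      then show ?thesis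
        using False add_sem[OF t 3(3) vn] realizable_mono[of "{..<n}" "{..v}"]
        by (auto simp: state_def)
    qed
    then show ?case by (simp only: cong incv_def)
  qed
  then show ?thesis using n by (simp add: main_com_def del: sem.simps(6))
qed

end

section \<open>Input, forbidden words and output\<close>

text \<open>\<open>e\<close> selects the number of letters: \<open>V 2\<close> is the parameter just
  read, \<open>Num K\<close> a constant of the program.\<close>

definition pre_com :: "exp \<Rightarrow> com" where
  "pre_com e = Rd 2 ;; Asg 3 e ;; Rd 4 ;; Asg 5 (Num 2 \<boxtimes> V 3 \<boxplus> Num 1) ;; Asg 6 (V 5 \<boxtimes> V 3) ;;
   Asg 7 (V 6 \<boxtimes> V 6) ;; Asg 8 (Num 1) ;; pow2 31 7 8 ;; Asg 9 (V 3 \<boxtimes> V 3) ;; Asg 10 (Num 1) ;;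
   pow2 31 9 10"

definition read_com :: com where
  "read_com = For 15 4 (For 16 4 (Rd 39 ;; AAsg 2 (V 15 \<boxtimes> V 4 \<boxplus> V 16) (V 39)))"

text \<open>One step of a greedy search: register 34 is the position from which to search, 35 tells
  whether the letter has been found, and 33 whether the embedding is still alive.\<close>

definition letter_com :: "nat \<Rightarrow> com" where
  "letter_com a = Asg 35 (Num 0) ;;
   For 17 4 (IFT (nt (V 35)) (IFT (le (V 34) (V 17)) (IFT (eq (A 4 (A 3 (V 17))) (Num a))
     (Asg 35 (Num 1) ;; Asg 34 (V 17 \<boxplus> Num 1))))) ;;
   IFT (nt (V 35)) (Asg 33 (Num 0))"

primrec letters_com :: "nat list \<Rightarrow> com" where
  "letters_com [] = SKIP"
| "letters_com (a # u) = letter_com a ;; letters_com u"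

text \<open>A pair consists of the number of a decoder and a word forbidden for it; it is consulted
  only if that decoder is in use.\<close>

definition pat_com :: "nat \<times> nat list \<Rightarrow> com" where
  "pat_com f = IFT (eq (V 30) (Num (fst f)))
    (Asg 33 (Num 1) ;; Asg 34 (Num 0) ;; letters_com (snd f) ;; IFT (V 33) (Asg 12 (Num 0)))"

primrec pats_com :: "(nat \<times> nat list) list \<Rightarrow> com" where
  "pats_com [] = SKIP"
| "pats_com (f # fs) = pat_com f ;; pats_com fs"

text \<open>The answer needs an alphabet of \<open>k\<close> letters while \<open>K\<close> may be
  smaller; rows and columns of the other letters are zero.\<close>

definition dec_out :: com where
  "dec_out = For 36 2 (For 37 2 (IF (lt (V 36) (V 3)) (IF (lt (V 37) (V 3))
     (Wr (A 7 (V 36 \<boxtimes> V 3 \<boxplus> V 37))) (Wr (Num 0))) (Wr (Num 0))))"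

definition out_com :: com where
  "out_com = IF (V 12)
    (Wr (Num 1) ;; dec_out ;; For 15 4 (Wr (A 4 (V 15))) ;;
     For 17 4 (AAsg 17 (A 3 (V 17)) (V 17 \<boxplus> Num 1)) ;; For 15 4 (Wr (A 17 (V 15))))
    (Wr (Num 0))"

definition work_com :: "(nat \<times> nat list) list \<Rightarrow> com" where
  "work_com F = read_com ;; main_com ;; IFT (V 12) (pats_com F) ;; out_com"

definition prog :: "exp \<Rightarrow> (nat \<times> nat list) list \<Rightarrow> com" where
  "prog e F = pre_com e ;; work_com F"

lemma concat_map_upt:
  "concat (map (\<lambda>i. map (f i) [0..<n]) [0..<m]) = map (\<lambda>p. f (p div n) (p mod n)) [0..<m * n]"
proof (induction m)
  case (Suc m)
  have "[0..<Suc m * n] = [0..<m * n] @ map (\<lambda>j. m * n + j) [0..<n]"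
    using upt_add_eq_append[of 0 "m * n" n] by (simp add: add.commute map_add_upt)
  moreover have "map (f m) [0..<n] = map (\<lambda>j. f ((m * n + j) div n) ((m * n + j) mod n)) [0..<n]"
    by (rule map_cong) auto
  ultimately show ?case using Suc by simp
qed simp

lemma adj_matrix_eq:
  "adj_matrix n G = map (\<lambda>p. of_bool ((p div n, p mod n) \<in> parcs G)) [0..<n * n]"
  using concat_map_upt[of "\<lambda>i j. of_bool ((i, j) \<in> parcs G)" n n]
  by (simp add: adj_matrix_def of_bool_def)

lemma ws_letters: "reg_writes (letters_com u) \<subseteq> {17, 33, 34, 35}" "arr_writes (letters_com u) = {}" "io_free (letters_com u)"
  by (induction u) (auto simp: letter_com_def)

lemma ws_pats: "reg_writes (pats_com F) \<subseteq> {12, 17, 33, 34, 35}" "arr_writes (pats_com F) = {}" "io_free (pats_com F)"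
  by (induction F) (use ws_letters in \<open>auto simp: pat_com_def\<close>)

text \<open>Justifies the greedy search: the earliest match of the first letter leaves the longest
  rest.\<close>

lemma subseq_skip: "a \<notin> set xs \<Longrightarrow> subseq (a # u) (xs @ a # ys) \<longleftrightarrow> subseq u ys"
  by (induction xs) auto

section \<open>Greedy search for forbidden words\<close>

context alg
begin

definition Wd :: "st \<Rightarrow> nat list" where
  "Wd s = map (\<lambda>p. ar s 4 (ar s 3 p)) [0..<n]"

lemma subseq_first:
  assumes "st \<le> p" "p < n" "Wd s ! p = a" "\<forall>q. st \<le> q \<and> q < p \<longrightarrow> Wd s ! q \<noteq> a"
  shows "subseq (a # u) (drop st (Wd s)) \<longleftrightarrow> subseq u (drop (Suc p) (Wd s))"
proof -
  have len: "length (Wd s) = n" by (simp add: Wd_def)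
  have "drop st (Wd s) = take (p - st) (drop st (Wd s)) @ drop p (Wd s)"
    using assms(1) append_take_drop_id[of "p - st" "drop st (Wd s)"] by simp
  also have "drop p (Wd s) = a # drop (Suc p) (Wd s)"
    using assms(2,3) len by (simp add: Cons_nth_drop_Suc[symmetric])
  finally have "drop st (Wd s) = take (p - st) (drop st (Wd s)) @ a # drop (Suc p) (Wd s)" .
  moreover have "a \<notin> set (take (p - st) (drop st (Wd s)))"
    using assms len by (auto simp: in_set_conv_nth)
  ultimately show ?thesis using subseq_skip by metis
qed

lemma letter_sem:
  fixes a :: nat and u :: "nat list"
  assumes n: "sc s 4 = n"
  defines "s' \<equiv> sem (letter_com a) s"
  shows "(sc s' 33 \<noteq> 0 \<and> subseq u (drop (sc s' 34) (Wd s))) \<longleftrightarrow>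
    (sc s 33 \<noteq> 0 \<and> subseq (a # u) (drop (sc s 34) (Wd s)))"
proof -
  let ?c = "IFT (nt (V 35)) (IFT (le (V 34) (V 17)) (IFT (eq (A 4 (A 3 (V 17))) (Num a))
     (Asg 35 (Num 1) ;; Asg 34 (V 17 \<boxplus> Num 1))))"
  let ?s1 = "setv 35 0 s"
  define I where "I j t \<longleftrightarrow>
    (if sc t 35 = 0 then sc t 34 = sc s 34 \<and> (\<forall>q. sc s 34 \<le> q \<and> q < j \<longrightarrow> Wd s ! q \<noteq> a)
     else \<exists>p<j. sc s 34 \<le> p \<and> Wd s ! p = a \<and> (\<forall>q. sc s 34 \<le> q \<and> q < p \<longrightarrow> Wd s ! q \<noteq> a) \<and>
       sc t 34 = Suc p)" for j and t :: st
  define t where "t = sem (For 17 4 ?c) ?s1"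
  have "I (sc ?s1 4) t" unfolding t_def
  proof (rule For_rule[where I = I], goal_cases)
    case (3 j t)
    have eqs: "ar t 3 = ar s 3" "ar t 4 = ar s 4" using 3(4) by (simp_all add: agree_def)
    have "Wd s ! j = ar s 4 (ar s 3 j)" using 3(1) n by (simp add: Wd_def)
    with 3(2,3) eqs show ?case
      by (cases "sc t 35 = 0") (auto simp: I_def less_Suc_eq)
  qed (simp_all add: I_def)
  then have I: "I n t" using n by simp
  have s': "s' = (if sc t 35 = 0 then setv 33 0 t else t)"
    by (simp add: s'_def letter_com_def t_def del: sem.simps(6))
  have t33: "sc t 33 = sc s 33" by (simp add: t_def frame_sc del: sem.simps(6))
  have len: "length (Wd s) = n" by (simp add: Wd_def)
  show ?thesis
  proof (cases "sc t 35 = 0")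
    case True
    with I have "a \<notin> set (drop (sc s 34) (Wd s))" by (auto simp: I_def in_set_conv_nth len)
    then have "\<not> subseq (a # u) (drop (sc s 34) (Wd s))"
      by (meson list.set_intros(1) subseq_order.order_trans subseq_singleton_left subseq_Cons' list_emb_set)
    then show ?thesis using s' True by simp
  next
    case False
    with I obtain p where p: "p < n" "sc s 34 \<le> p" "Wd s ! p = a"
      "\<forall>q. sc s 34 \<le> q \<and> q < p \<longrightarrow> Wd s ! q \<noteq> a" "sc t 34 = Suc p" by (auto simp: I_def)
    then show ?thesis using s' False t33 subseq_first[OF p(2,1,3,4)] by simp
  qed
qed

lemma letters_sem:
  "sc s 4 = n \<Longrightarrow> sc (sem (letters_com u) s) 33 \<noteq> 0 \<longleftrightarrow>
     sc s 33 \<noteq> 0 \<and> subseq u (drop (sc s 34) (Wd s))"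
proof (induction u arbitrary: s)
  case (Cons a u)
  let ?s = "sem (letter_com a) s"
  have "4 \<notin> reg_writes (letter_com a)" "arr_writes (letter_com a) = {}" by (simp_all add: letter_com_def)
  then have "sc ?s 4 = n" "Wd ?s = Wd s"
    using Cons.prems by (simp_all add: frame_sc frame_ar Wd_def)
  with Cons.IH[of ?s] letter_sem[OF Cons.prems, of a u] show ?case by simp
qed simp

lemma pats_sem:
  "sc s 4 = n \<Longrightarrow> sc s 12 \<noteq> 0 \<Longrightarrow> sc (sem (pats_com F) s) 12 \<noteq> 0 \<longleftrightarrow>
    \<not> (\<exists>u. (sc s 30, u) \<in> set F \<and> subseq u (Wd s))" for s
proof (induction F arbitrary: s)
  case (Cons f F)
  let ?t = "setv 34 0 (setv 33 1 s)"
  let ?s = "sem (pat_com f) s"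
  have keep: "sc (sem (pats_com F) s) 12 = 0" if "sc s 12 = 0" for s F
    using that
  proof (induction F arbitrary: s)
    case (Cons f F)
    have "12 \<notin> reg_writes (letters_com (snd f))" using ws_letters(1)[of "snd f"] by auto
    then show ?case using Cons by (simp add: pat_com_def frame_sc)
  qed simp
  have n12: "12 \<notin> reg_writes (letters_com (snd f))" using ws_letters(1)[of "snd f"] by auto
  have "4 \<notin> reg_writes (pat_com f)" "30 \<notin> reg_writes (pat_com f)" "arr_writes (pat_com f) = {}"
    using ws_letters[of "snd f"] by (auto simp: pat_com_def)
  then have keep': "sc ?s 4 = n" "sc ?s 30 = sc s 30" "Wd ?s = Wd s"
    using Cons.prems by (simp_all add: frame_sc frame_ar Wd_def)
  have "Wd ?t = Wd s" by (simp add: Wd_def)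
  then have l: "sc (sem (letters_com (snd f)) ?t) 33 \<noteq> 0 \<longleftrightarrow> subseq (snd f) (Wd s)"
    using letters_sem[of ?t "snd f"] Cons.prems by simp
  have hit: "sc ?s 12 = 0 \<longleftrightarrow> fst f = sc s 30 \<and> subseq (snd f) (Wd s)"
    using l Cons.prems(2) n12 by (auto simp: pat_com_def frame_sc)
  show ?case
  proof (cases "sc ?s 12 = 0")
    case True
    then have "(sc s 30, snd f) \<in> set (f # F)" "subseq (snd f) (Wd s)" using hit by (auto simp: prod_eq_iff)
    then show ?thesis using keep[OF True] by auto
  next
    case False
    then show ?thesis using Cons.IH[of ?s] keep' hit by (auto simp: prod_eq_iff)
  qed
qed simp

end

section \<open>Reading the graph and writing the realisation\<close>

context graph_alg
begin

lemma read_sem: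
  assumes n: "sc s 4 = n" and inp: "inp s = map (\<lambda>p. of_bool (adj (p div n) (p mod n))) [0..<n * n]"
  shows "adj_ok (sem read_com s)" "outp (sem read_com s) = outp s"
proof -
  let ?L = "inp s"
  define I where "I X s' \<longleftrightarrow> inp s' = drop (card X) ?L \<and> outp s' = outp s \<and>
    (\<forall>(x, y)\<in>X. ar s' 2 (x * n + y) = of_bool (adj x y))" for X :: "(nat \<times> nat) set" and s' :: st
  have "I ({..<sc s 4} \<times> {..<sc s 4}) (sem read_com s)"
    unfolding read_com_def
  proof (rule For2_rule, goal_cases)
    case (10 s' x y)
    let ?X = "{..<x} \<times> {..<sc s 4} \<union> {x} \<times> {..<y}"
    have xy: "x < n" "y < n" using 10(1,2) n by simp_all
    have "card ?X = card ({..<x} \<times> {..<n}) + card ({x} \<times> {..<y})"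
      using n by (subst card_Un_disjoint) auto
    then have card: "card ?X = x * n + y" by simp
    have "(x, y) \<notin> ?X" by auto
    then have card': "card (insert (x, y) ?X) = Suc (x * n + y)" using card by simp
    have "x * n + y < Suc x * n" using xy by simp
    also have "\<dots> \<le> n * n" using xy by (intro mult_le_mono1) simp
    finally have lt: "x * n + y < n * n" .
    then have "?L ! (x * n + y) = of_bool (adj x y)" using xy by (simp add: inp)
    then have hd: "drop (x * n + y) ?L = of_bool (adj x y) # drop (Suc (x * n + y)) ?L"
      using lt by (simp add: Cons_nth_drop_Suc[symmetric] inp)
    have "sc s' 4 = n" using 10(6) n by (simp add: agree_def)
    then have s': "inp (sem (Rd 39 ;; AAsg 2 (V 15 \<boxtimes> V 4 \<boxplus> V 16) (V 39)) s') = drop (Suc (x * n + y)) ?L"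
      "ar (sem (Rd 39 ;; AAsg 2 (V 15 \<boxtimes> V 4 \<boxplus> V 16) (V 39)) s') 2 = (ar s' 2)(x * n + y := of_bool (adj x y))"
      "outp (sem (Rd 39 ;; AAsg 2 (V 15 \<boxtimes> V 4 \<boxplus> V 16) (V 39)) s') = outp s"
      using 10(3-5) hd by (simp_all add: I_def card)
    show ?case unfolding I_def s' card'
    proof (intro conjI ballI)
      fix z assume z: "z \<in> insert (x, y) ?X"
      obtain x' y' where zz: "z = (x', y')" by (cases z)
      have "y' < n" using z zz xy n by auto
      then have "x' * n + y' = x * n + y \<longleftrightarrow> x' = x \<and> y' = y" using cell_eq xy by simp
      moreover have "ar s' 2 (x' * n + y') = of_bool (adj x' y')" if "\<not> (x' = x \<and> y' = y)"
      proof -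
        have "(x', y') \<in> ?X" using z zz that by blast
        then show ?thesis using 10(3) unfolding I_def by fast
      qed
      ultimately show "case z of (x', y') \<Rightarrow>
          ((ar s' 2)(x * n + y := of_bool (adj x y))) (x' * n + y') = of_bool (adj x' y')"
        unfolding zz by (cases "x' = x \<and> y' = y") auto
    qed simp_all
  qed (simp_all add: I_def)
  then have "I ({..<n} \<times> {..<n}) (sem read_com s)" by (simp only: n)
  then show "adj_ok (sem read_com s)" "outp (sem read_com s) = outp s"
    unfolding I_def adj_ok_def by fast+
qed

lemma write_loop:
  assumes "x \<noteq> y" "A' \<noteq> 0"
  shows "outp (sem (For x y (Wr (A A' (V x)))) s) = outp s @ map (ar s A') [0..<sc s y]"
proof -
  define I where "I j t \<longleftrightarrow> outp t = outp s @ map (ar s A') [0..<j]" for j and t :: st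
  have "I (sc s y) (sem (For x y (Wr (A A' (V x)))) s)"
    by (rule For_rule[where I = I]) (simp_all add: I_def agree_def)
  then show ?thesis by (simp add: I_def)
qed

definition dec_graph :: "nat \<Rightarrow> st \<Rightarrow> nat pair_pre_digraph" where
  "dec_graph k s = \<lparr>pverts = {0..<k}, parcs = {(a, b). a < K \<and> b < K \<and> DD s a b}\<rparr>"

lemma dec_out_sem:
  assumes "sc s 3 = K" "\<And>i. ar s 7 i \<le> 1"
  shows "outp (sem dec_out s) = outp s @ adj_matrix (sc s 2) (dec_graph (sc s 2) s)"
proof -
  let ?k = "sc s 2"
  define f where "f p = (of_bool ((p div ?k, p mod ?k) \<in> parcs (dec_graph ?k s)) :: nat)" for p
  have ar7: "ar s 7 i = of_bool (ar s 7 i \<noteq> 0)" for i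
    using assms(2)[of i] by (cases "ar s 7 i") auto
  define I where "I X t \<longleftrightarrow> outp t = outp s @ map f [0..<card X]"
    for X :: "(nat \<times> nat) set" and t :: st
  have "I ({..<sc s 2} \<times> {..<sc s 2}) (sem dec_out s)"
    unfolding dec_out_def
  proof (rule For2_rule, goal_cases)
    case (10 t x y)
    let ?X = "{..<x} \<times> {..<sc s 2} \<union> {x} \<times> {..<y}"
    have "card ?X = card ({..<x} \<times> {..<sc s 2}) + card ({x} \<times> {..<y})"
      by (subst card_Un_disjoint) auto
    then have card: "card ?X = x * ?k + y" by simp
    have "(x, y) \<notin> ?X" by auto
    then have card': "card (insert (x, y) ?X) = Suc (x * ?k + y)" using card by simp
    have f: "f (x * ?k + y) = of_bool (x < K \<and> y < K \<and> DD s x y)"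
      using 10(2) by (simp add: f_def dec_graph_def)
    have eqs: "sc t 3 = K" "ar t 7 = ar s 7" using 10(6) assms(1) by (simp_all add: agree_def)
    have "ar s 7 (x * K + y) = of_bool (DD s x y)" unfolding DD_def by (rule ar7)
    with 10(3-5) eqs f show ?case unfolding I_def card card' by auto
  qed (simp_all add: I_def)
  then show ?thesis by (simp add: I_def adj_matrix_eq f_def)
qed

lemma pos_sem:
  assumes n: "sc s 4 = n" and bij: "bij_betw (ar s 3) {..<n} {..<n}" and p: "p < n"
  shows "ar (sem (For 17 4 (AAsg 17 (A 3 (V 17)) (V 17 \<boxplus> Num 1))) s) 17 (ar s 3 p) = Suc p"
proof -
  define I where "I j t \<longleftrightarrow> (\<forall>p<j. j \<le> n \<longrightarrow> ar t 17 (ar s 3 p) = Suc p)" for j and t :: st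
  have "I (sc s 4) (sem (For 17 4 (AAsg 17 (A 3 (V 17)) (V 17 \<boxplus> Num 1))) s)"
  proof (rule For_rule[where I = I], goal_cases)
    case (3 j t)
    have a3: "ar t 3 = ar s 3" using 3(4) by (simp add: agree_def)
    let ?t = "incv 17 (sem (AAsg 17 (A 3 (V 17)) (V 17 \<boxplus> Num 1)) t)"
    have "ar ?t 17 (ar s 3 p) = Suc p" if "p < Suc j" for p
    proof (cases "p = j")
      case False
      then have "p < j" using that by simp
      then have "ar s 3 p \<noteq> ar s 3 j" using bij 3(1) n inj_on_eq_iff[of "ar s 3" "{..<n}" p j]
        by (simp add: bij_betw_def)
      moreover have "ar t 17 (ar s 3 p) = Suc p" using 3(1,2) n \<open>p < j\<close> by (simp add: I_def)
      ultimately show ?thesis using 3(3) a3 by simp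
    qed (use 3(3) a3 in simp)
    then show ?case unfolding I_def by blast
  qed (simp_all add: I_def)
  then show ?thesis using n p by (simp add: I_def)
qed

lemma out_sem:
  assumes s: "small s" and w: "word n s" and ok: "sc s 12 \<noteq> 0"
  shows "\<exists>c. outp (sem out_com s) = outp s @ 1 # encode_realisation (sc s 2) n (dec_graph (sc s 2) s) (ar s 4) c \<and>
    bij_betw c {0..<n} {1..n} \<and> realises adj (DD s) (ar s 4) c {0..<n}"
proof -
  let ?s1 = "s\<lparr>outp := outp s @ [1]\<rparr>"
  let ?exp_peak = "For 17 4 (AAsg 17 (A 3 (V 17)) (V 17 \<boxplus> Num 1))"
  define s2 where "s2 = sem dec_out ?s1"
  define s3 where "s3 = sem (For 15 4 (Wr (A 4 (V 15)))) s2"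
  define s4 where "s4 = sem ?exp_peak s3"
  have n: "sc s 4 = n" and K3: "sc s 3 = K" using s by (simp_all add: small_def cst_def)
  have f2: "sc s2 4 = n" "ar s2 = ar s"
    using n by (simp_all add: s2_def frame_sc frame_ar dec_out_def fun_eq_iff del: sem.simps)
  have f3: "sc s3 4 = n" "ar s3 = ar s"
    using f2 by (simp_all add: s3_def frame_sc frame_ar fun_eq_iff del: sem.simps)
  have f4: "sc s4 4 = n" using f3 by (simp add: s4_def frame_sc del: sem.simps)
  have o2: "outp s2 = outp s @ [1] @ adj_matrix (sc s 2) (dec_graph (sc s 2) s)"
    using dec_out_sem[of ?s1] K3 s by (simp add: s2_def small_def dec_graph_def DD_def)
  have o3: "outp s3 = outp s2 @ map (ar s 4) [0..<n]"
    using write_loop[of 15 4 4 s2] f2 by (simp add: s3_def del: sem.simps)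
  have o4: "outp s4 = outp s3" using frame_io[of ?exp_peak s3] by (simp add: s4_def del: sem.simps)
  define c where "c = ar s4 17"
  have "sem out_com s = sem (For 15 4 (Wr (A 17 (V 15)))) s4"
    using ok by (simp add: out_com_def s4_def s3_def s2_def del: sem.simps(6))
  then have "outp (sem out_com s) = outp s4 @ map c [0..<n]"
    using write_loop[of 15 4 17 s4] f4 by (simp add: c_def del: sem.simps)
  then have out: "outp (sem out_com s) = outp s @ 1 # encode_realisation (sc s 2) n (dec_graph (sc s 2) s) (ar s 4) c"
    using o2 o3 o4 by (simp add: encode_realisation_def)
  have bij: "bij_betw (ar s 3) {..<n} {..<n}" using w by (simp add: word_def)
  have c: "c (ar s 3 p) = Suc p" if "p < n" for p
    using pos_sem[of s3 p] f3 bij that by (simp add: c_def s4_def del: sem.simps)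
  have "\<And>p q. p < n \<Longrightarrow> q < p \<Longrightarrow> adj (ar s 3 q) (ar s 3 p) = DD s (ar s 4 (ar s 3 q)) (ar s 4 (ar s 3 p))"
    using w by (simp add: word_def)
  note ro = realises_order[of "ar s 3" n c adj "DD s" "ar s 4", OF bij c sym this]
  from out ro show ?thesis by blast
qed

lemma labels_realizable:
  assumes "labels_exist K n G" "adj = (\<lambda>x y. (x, y) \<in> parcs G)"
  shows "realizable {..<n}"
proof -
  obtain D :: "nat \<Rightarrow> nat \<Rightarrow> bool" and l c where "\<forall>x<n. l x < K" "realises adj D l c {..<n}"
    using assms by (auto simp: labels_exist_def atLeast0LessThan)
  then show ?thesis
    unfolding realizable_def using realises_acyclic[of adj D l c "{..<n}", OF sym] by auto
qed

end

lemma pre_sem: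
  fixes k n :: nat and xs :: "nat list"
  assumes "0 < K" "e = V 2 \<and> K = k \<or> e = Num K"
  defines "s \<equiv> sem (pre_com e) (init (k # n # xs))"
  shows "alg.cst K n s" "sc s 2 = k" "sc s 30 = 0" "ar s = (\<lambda>_ _. 0)" "inp s = xs" "outp s = []"
proof -
  interpret alg K n by unfold_locales (rule assms(1))
  show "cst s" "sc s 2 = k" "sc s 30 = 0" "ar s = (\<lambda>_ _. 0)" "inp s = xs" "outp s = []"
    using assms(2)
    by (auto simp: s_def pre_com_def pow2_sem cst_def m_def N_def S_def Dn_def simp del: sem.simps(6))
qed

text \<open>\<open>no\<close> justifies the answer when no realisation over \<open>K\<close> letters
  exists. \<open>yes\<close> must hold for every realisation, since nothing is known about the one
  that the search returns.\<close>

theorem prog_correct: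
  assumes pos: "0 < K" "K \<le> k" and e: "e = V 2 \<and> K = k \<or> e = Num K"
    and G: "pair_graph G" "pverts G = {0..<n}"
    and no: "G \<in> C \<Longrightarrow> k_letter_graph K G"
    and yes: "\<And>d ord lab. d < 2 ^ (K * K) \<Longrightarrow> bij_betw ord {..<n} {..<n} \<Longrightarrow> \<forall>x<n. lab x < K \<Longrightarrow>
      (\<And>p q. p < n \<Longrightarrow> q < p \<Longrightarrow> (ord q, ord p) \<in> parcs G \<longleftrightarrow>
        odd (d div 2 ^ (lab (ord q) * K + lab (ord p)))) \<Longrightarrow>
      G \<in> C \<longleftrightarrow> \<not> (\<exists>u. (d, u) \<in> set F \<and> subseq u (map (lab \<circ> ord) [0..<n]))"
  shows "correct_answer k C n G (outp (sem (prog e F) (init (encode_input k n G))))"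
proof -
  define adj where "adj = (\<lambda>x y. (x, y) \<in> parcs G)"
  interpret graph_alg K n adj
    using pos G(1) by unfold_locales (auto simp: adj_def pair_graph_iff dest: symD)
  let ?xs = "adj_matrix n G"
  define s0 where "s0 = sem (pre_com e) (init (k # n # ?xs))"
  note s0 = pre_sem[OF pos(1) e, of n ?xs, folded s0_def]
  define s1 where "s1 = sem read_com s0"
  have s04: "sc s0 4 = n" using s0(1) by (simp add: cst_def)
  have inp0: "inp s0 = map (\<lambda>p. of_bool (adj (p div n) (p mod n))) [0..<n * n]"
    by (simp add: s0(5) adj_matrix_eq adj_def)
  have o1: "outp s1 = []" and "adj_ok s1" unfolding s1_def using read_sem[OF s04 inp0] s0(6) by simp_all
  moreover have a1: "ar s1 a = (\<lambda>_. 0)" if "a \<noteq> 2" for a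
    using that s0(4) by (simp add: s1_def frame_ar read_com_def del: sem.simps)
  moreover have "cst s1" unfolding s1_def by (rule cst_sem[OF s0(1)]) (simp add: read_com_def)
  ultimately have sm1: "small s1" by (simp add: small_def)
  have r1: "sc s1 30 = 0" "sc s1 2 = k"
    using s0 by (simp_all add: s1_def frame_sc read_com_def del: sem.simps)
  define s2 where "s2 = sem main_com s1"
  have st2: "state n s2" unfolding s2_def by (rule main_sem[OF sm1 r1(1)]) (simp add: a1)
  have wsm: "2 \<notin> reg_writes main_com" by (simp add: main_com_def feas_ws_def)
  have io: "io_free main_com"
    by (simp add: main_com_def add_com_def types_com_def tab_com_def decs_com_def sort_com_def
        indeg_com_def place_com_def pick_com_def drop_com_def arc_if_def feas_com_def row_com_def
        cell_com_def try_com_def trans_com_def unpack_def arcs_com_def inout_com_def pack_com_def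
        extract_com_def)
  have r2: "sc s2 2 = k" "outp s2 = []"
    using wsm frame_io[OF io] r1 o1 by (simp_all add: s2_def frame_sc)
  have final: "outp (sem (prog e F) (init (encode_input k n G))) =
      outp (sem (IFT (V 12) (pats_com F) ;; out_com) s2)"
    by (simp add: prog_def work_com_def encode_input_def s2_def s1_def s0_def)
  show ?thesis
  proof (cases "sc s2 12 = 0")
    case True
    then have "\<not> realizable {..<n}" using st2 by (simp add: state_def)
    then have "G \<notin> C"
      using no labels_realizable[of G] k_letter_graph_iff[OF G(2)] by (auto simp: adj_def)
    then show ?thesis
      unfolding final using True r2 by (simp add: out_com_def correct_answer_def)
  next
    case False
    then have w2: "word n s2" and sm2: "small s2" using st2 by (simp_all add: state_def)
    define s3 where "s3 = sem (pats_com F) s2"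
    have f3: "sc s3 x = sc s2 x" if "x \<notin> {12, 17, 33, 34, 35}" for x
      unfolding s3_def using ws_pats(1)[of F] that by (intro frame_sc) blast
    have g3: "ar s3 = ar s2" unfolding s3_def using ws_pats(2)[of F] by (simp add: frame_ar fun_eq_iff)
    have o3: "outp s3 = []" using frame_io[OF ws_pats(3)] r2 by (simp add: s3_def)
    have sm3: "small s3" using sm2 f3 g3 by (simp add: small_def cst_def adj_ok_def)
    have w3: "word n s3" using w2 f3 g3 by (simp add: word_def dec_ok_def DD_def)
    have n2: "sc s2 4 = n" using sm2 by (simp add: small_def cst_def)
    let ?d = "sc s2 30" and ?ord = "ar s2 3" and ?lab = "ar s2 4"
    have d: "?d < 2 ^ (K * K)" using w2 by (simp add: word_def dec_ok_def Dn_def)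
    have bij: "bij_betw ?ord {..<n} {..<n}" and lK: "\<forall>x<n. ?lab x < K" using w2 by (simp_all add: word_def)
    have on: "?ord p < n" if "p < n" for p using bij that by (auto simp: bij_betw_def)
    have "(?ord q, ?ord p) \<in> parcs G \<longleftrightarrow> odd (?d div 2 ^ (?lab (?ord q) * K + ?lab (?ord p)))"
      if "p < n" "q < p" for p q
    proof -
      have "adj (?ord q) (?ord p) = DD s2 (?lab (?ord q)) (?lab (?ord p))" using w2 that by (simp add: word_def)
      also have "\<dots> = Dof ?d (?lab (?ord q)) (?lab (?ord p))"
        using w2 lK on that by (intro DD_Dof) (auto simp: word_def)
      finally show ?thesis by (simp add: adj_def Dof_def)
    qed
    from yes[OF d bij lK this] have "G \<in> C \<longleftrightarrow> \<not> (\<exists>u. (?d, u) \<in> set F \<and> subseq u (Wd s2))"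
      by (simp add: Wd_def o_def)
    also have "\<dots> \<longleftrightarrow> sc s3 12 \<noteq> 0" unfolding s3_def using pats_sem[OF n2 False] by simp
    finally have GC: "G \<in> C \<longleftrightarrow> sc s3 12 \<noteq> 0" .
    have fin: "outp (sem (prog e F) (init (encode_input k n G))) = outp (sem out_com s3)"
      unfolding final using False by (simp add: s3_def)
    show ?thesis
    proof (cases "sc s3 12 = 0")
      case True
      then show ?thesis unfolding fin using GC o3 by (simp add: out_com_def correct_answer_def)
    next
      case ok: False
      from out_sem[OF sm3 w3 ok] obtain c where
        c: "outp (sem out_com s3) = outp s3 @ 1 # encode_realisation (sc s3 2) n (dec_graph (sc s3 2) s3) (ar s3 4) c"
        "bij_betw c {0..<n} {1..n}" "realises adj (DD s3) (ar s3 4) c {0..<n}" by blast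
      have k3: "sc s3 2 = k" using f3[of 2] r2 by simp
      have "k_letter_realisation k (dec_graph k s3) (ar s3 4) c G"
        unfolding dec_graph_def
        using c(2,3) lK pos(2) G(2) g3 by (intro realisation_from_labels[of _ n]) (simp_all add: adj_def)
      moreover have "pverts (dec_graph k s3) = {0..<k}" by (simp add: dec_graph_def)
      moreover have "outp (sem out_com s3) = 1 # encode_realisation k n (dec_graph k s3) (ar s3 4) c"
        using c(1) o3 k3 by simp
      ultimately show ?thesis unfolding fin correct_answer_def using GC ok by auto
    qed
  qed
qed

section \<open>Resource bounds\<close>

lemma ub_sugar [simp]:
  "exp_ub \<beta> \<gamma> (lt e f) = exp_ub \<beta> \<gamma> f" "exp_ub \<beta> \<gamma> (le e f) = exp_ub \<beta> \<gamma> f + 1" "exp_ub \<beta> \<gamma> (nt e) = 1"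
  "exp_ub \<beta> \<gamma> (ne e f) = exp_ub \<beta> \<gamma> e + exp_ub \<beta> \<gamma> f" "exp_ub \<beta> \<gamma> (eq e f) = 1" "exp_ub \<beta> \<gamma> (md e f) = exp_ub \<beta> \<gamma> e"
  by (simp_all add: sugar)

lemma ed_sugar [simp]:
  "exp_degree (lt e f) = exp_degree f" "exp_degree (le e f) = exp_degree f" "exp_degree (nt e) = 0" "exp_degree (ne e f) = max (exp_degree e) (exp_degree f)"
  "exp_degree (eq e f) = 0" "exp_degree (md e f) = exp_degree e"
  by (simp_all add: sugar)

lemma pd_sugar [simp]:
  "exp_degree_le g (lt e f) \<longleftrightarrow> exp_degree_le g e \<and> exp_degree_le g f \<and> exp_degree f \<le> g"
  "exp_degree_le g (le e f) \<longleftrightarrow> exp_degree_le g e \<and> exp_degree_le g f \<and> exp_degree f \<le> g"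
  "exp_degree_le g (nt e) \<longleftrightarrow> exp_degree_le g e"
  "exp_degree_le g (ne e f) \<longleftrightarrow> exp_degree_le g e \<and> exp_degree_le g f \<and> exp_degree e \<le> g \<and> exp_degree f \<le> g"
  "exp_degree_le g (eq e f) \<longleftrightarrow> exp_degree_le g e \<and> exp_degree_le g f \<and> exp_degree e \<le> g \<and> exp_degree f \<le> g"
  "exp_degree_le g (md e f) \<longleftrightarrow> exp_degree_le g e \<and> exp_degree_le g f \<and> exp_degree e + exp_degree f \<le> g"
  by (auto simp: sugar)

text \<open>Selects the registers whose bound grows with \<open>n\<close>: the size itself, vertices
  and positions.\<close>

definition weight :: "nat \<Rightarrow> nat" where
  "weight x = of_bool (x \<in> {4, 11, 15, 16, 17, 18, 19, 25, 32, 34})"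

context alg
begin

text \<open>Sums arise where a register has two uses: 14 holds a state or a decoder, while 24 and 31
  count up to \<open>N * N\<close> or \<open>K * K\<close>.\<close>

definition reg_bound :: "nat \<Rightarrow> nat \<Rightarrow> nat" where
  "reg_bound k x =
    (if x \<in> {2, 36, 37} then k else if x \<in> {3, 21} then K
     else if x \<in> {4, 11, 15, 16, 17, 18, 19, 25, 32} then n else if x = 34 then Suc n
     else if x = 5 then m else if x \<in> {6, 22, 23, 28} then N else if x = 7 then N * N
     else if x \<in> {24, 31} then N * N + K * K else if x \<in> {8, 20, 26, 27, 38} then S
     else if x = 9 then K * K else if x \<in> {10, 13, 30} then Dn else if x = 14 then S + Dn
     else if x \<in> {12, 29, 33, 35, 39} then 1 else 0)"

text \<open>These bounds are syntactic, not sharp: bits are remainders, whose bound is that of the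
  dividend in register 14, and the tests for inequality in arrays 11 and 12 are bounded by a
  sum.\<close>

definition arr_bound :: "nat \<Rightarrow> nat" where
  "arr_bound a =
    (if a \<in> {2, 6, 8, 13, 14, 16} then 1 else if a \<in> {3, 15} then n else if a \<in> {4, 18} then K
     else if a = 5 then 2 * K else if a \<in> {7, 10} then S + Dn else if a \<in> {11, 12} then 1 + (S + Dn)
     else if a = 9 then S else if a = 17 then Suc n else 0)"

definition fine :: "nat \<Rightarrow> nat \<Rightarrow> com \<Rightarrow> bool" where
  "fine k t c \<longleftrightarrow> wf_com c \<and> keeps_bounds (reg_bound k) arr_bound c \<and> com_degree_le 3 c \<and> weighted_depth weight c \<le> t"

lemma fine_simps:
  "fine k t SKIP"
  "fine k t (Asg x e) \<longleftrightarrow> ewf e \<and> exp_ub (reg_bound k) arr_bound e \<le> reg_bound k x \<and> exp_degree_le 3 e"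
  "fine k t (AAsg a e f) \<longleftrightarrow> 0 < a \<and> a < 31 \<and> ewf e \<and> ewf f \<and> exp_ub (reg_bound k) arr_bound f \<le> arr_bound a \<and>
     exp_degree_le 3 e \<and> exp_degree_le 3 f \<and> exp_degree e \<le> 3"
  "fine k t (c ;; d) \<longleftrightarrow> fine k t c \<and> fine k t d"
  "fine k t (IF e c d) \<longleftrightarrow> ewf e \<and> exp_degree_le 3 e \<and> fine k t c \<and> fine k t d"
  "weight y \<le> t \<Longrightarrow> fine k t (For x y c) \<longleftrightarrow> x \<noteq> y \<and> x \<notin> reg_writes c \<and> y \<notin> reg_writes c \<and> reg_bound k y \<le> reg_bound k x \<and>
     fine k (t - weight y) c"
  "fine k t (Rd x) \<longleftrightarrow> 1 \<le> reg_bound k x"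
  "fine k t (Wr e) \<longleftrightarrow> ewf e \<and> exp_degree_le 3 e"
  by (auto simp: fine_def)

lemma fine_trans: "fine k t trans_com"
proof -
  have "1 \<le> S" "2 * K * K + K \<le> N" by (simp_all add: S_def N_def m_def)
  then show ?thesis
    by (simp add: trans_com_def unpack_def arcs_com_def inout_com_def pack_com_def fine_simps
        reg_bound_def arr_bound_def weight_def)
qed

lemma fine_feas: "0 < t \<Longrightarrow> fine k t feas_com"
  by (simp add: feas_com_def row_com_def cell_com_def try_com_def fine_trans fine_simps
      reg_bound_def arr_bound_def weight_def trans_ws_def)

text \<open>Two nested loops up to \<open>n\<close> occur in the adjacency table and in the
  topological sort; the table of states takes one per decoder. The loop over vertices will be the
  third.\<close>

lemma fine_add: "2 \<le> t \<Longrightarrow> fine k t add_com"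
  by (simp add: add_com_def types_com_def tab_com_def decs_com_def extract_com_def sort_com_def
      indeg_com_def place_com_def pick_com_def drop_com_def arc_if_def unpack_def fine_feas fine_simps
      reg_bound_def arr_bound_def weight_def feas_ws_def)

lemma fine_main: "3 \<le> t \<Longrightarrow> fine k t main_com"
  by (simp add: main_com_def fine_add fine_simps reg_bound_def weight_def feas_ws_def)

lemma fine_letters: "0 < t \<Longrightarrow> fine k t (letters_com u)"
  by (induction u) (simp_all add: letter_com_def fine_simps reg_bound_def arr_bound_def weight_def)

lemma fine_pats: "0 < t \<Longrightarrow> fine k t (pats_com F)"
  by (induction F) (simp_all add: pat_com_def fine_letters fine_simps reg_bound_def)

lemma fine_work: "fine k 3 (work_com F)"
  by (simp add: work_com_def read_com_def out_com_def dec_out_def fine_main fine_pats fine_simps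
      reg_bound_def arr_bound_def weight_def)

end

section \<open>Numerical bounds in \<open>k\<close> and \<open>n\<close>\<close>

locale bounds = alg +
  fixes k :: nat
  assumes Kk: "K \<le> k" and n: "0 < n"
begin

definition Q :: nat where "Q = 2 ^ ((3 * k + 3) ^ 4)"

text \<open>With \<open>j = K + 1\<close> and \<open>t = j * j\<close> the left side is at most
  \<open>81 * (t * t) = (3 * j) ^ 4\<close>. The summand 4 is slack: two spare binary digits let
  \<open>S + Dn + 1\<close> fit below \<open>Q\<close>.\<close>

lemma exponent: "N * N + K * K + 4 \<le> (3 * k + 3) ^ 4"
proof -
  define j where "j = K + 1"
  define t where "t = j * j"
  have "N \<le> 2 * t" by (simp add: N_def m_def j_def t_def algebra_simps)
  then have "N * N \<le> (2 * t) * (2 * t)" by (intro mult_le_mono)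
  also have "\<dots> = 4 * (t * t)" by simp
  finally have "N * N \<le> 4 * (t * t)" .
  moreover have "K * K \<le> t" by (simp add: j_def t_def)
  moreover have t1: "1 \<le> t" by (simp add: t_def j_def)
  then have "t * 1 \<le> t * t" by (rule mult_le_mono2)
  ultimately have "N * N + K * K + 4 \<le> 81 * (t * t)" using t1 by linarith
  also have "\<dots> = (3 * j) ^ 4" by (simp add: power4_eq_xxxx t_def)
  also have "\<dots> \<le> (3 * k + 3) ^ 4" using Kk by (intro power_mono) (auto simp: j_def)
  finally show ?thesis .
qed

lemma Q_bounds: "k \<le> Q" "K \<le> Q" "m \<le> Q" "N \<le> Q" "N * N + K * K \<le> Q" "S + Dn + 1 \<le> Q" "2 \<le> Q"
proof -
  let ?X = "(3 * k + 3) ^ 4"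
  have XQ: "?X \<le> Q" unfolding Q_def using less_exp[of ?X] by simp
  have "3 * k + 3 \<le> ?X" using power_increasing[of 1 4 "3 * k + 3"] by simp
  then show "k \<le> Q" "K \<le> Q" "m \<le> Q" using XQ Kk by (simp_all add: m_def)
  show "N * N + K * K \<le> Q" using exponent XQ by simp
  moreover have "N \<le> N * N" using K by (simp add: N_def m_def)
  ultimately show "N \<le> Q" by linarith
  obtain Y where Y: "?X = Y + 2" using exponent by (metis add_leD2 le_Suc_ex add.commute numeral_Bit0)
  have "S \<le> 2 ^ Y" "Dn \<le> 2 ^ Y"
    unfolding S_def Dn_def using exponent Y by (auto intro!: power_increasing)
  moreover have "Q = 4 * 2 ^ Y" by (simp add: Q_def Y power_add)
  moreover have "1 \<le> (2::nat) ^ Y" by simp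
  ultimately show "S + Dn + 1 \<le> Q" "2 \<le> Q" by linarith+
qed

lemma if_leI: "(c \<Longrightarrow> a \<le> z) \<Longrightarrow> (\<not> c \<Longrightarrow> b \<le> z) \<Longrightarrow> (if c then a else b) \<le> (z::nat)"
  by simp

lemma reg_bound_le: "reg_bound k x \<le> Q * n ^ weight x"
proof -
  have "2 * n \<le> Q * n" using Q_bounds(7) by (rule mult_le_mono1)
  then have nQ: "n \<le> Q * n" "Suc n \<le> Q * n" using n by linarith+
  have QQ: "S \<le> Q" "Dn \<le> Q" "S + Dn \<le> Q" "1 \<le> Q" "N * N \<le> Q" "K * K \<le> Q" using Q_bounds by linarith+
  note le = Q_bounds(1-5) QQ nQ
  show ?thesis
  proof (cases "x \<in> {4, 11, 15, 16, 17, 18, 19, 25, 32, 34}")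
    case True
    then have "weight x = 1" unfolding weight_def by simp
    moreover from True have "reg_bound k x = n \<or> reg_bound k x = Suc n"
      by (elim insertE emptyE) (simp_all add: reg_bound_def)
    ultimately show ?thesis using nQ by auto
  next
    case False
    then have "weight x = 0" by (simp add: weight_def)
    moreover have "reg_bound k x \<le> Q" unfolding reg_bound_def
      by (intro if_leI le) (use False QQ in simp_all)
    ultimately show ?thesis by simp
  qed
qed

lemma reg_bound_W: "reg_bound k x \<le> Q * n"
proof -
  have "weight x \<le> 1" unfolding weight_def of_bool_def by (intro if_leI) (rule order_refl, rule zero_le)
  then have "n ^ weight x \<le> n ^ 1" using n by (intro power_increasing) simp_all
  then have "Q * n ^ weight x \<le> Q * n" by simp
  with reg_bound_le[of x] show ?thesis by (rule le_trans)
qed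

lemma arr_bound_W: "arr_bound a \<le> Q * n"
proof -
  have Qn: "Q * 1 \<le> Q * n" using n by (intro mult_le_mono2) simp
  moreover have "n \<le> Q * n" "Suc n \<le> Q * n" using reg_bound_W[of 4] reg_bound_W[of 34] by (simp_all add: reg_bound_def)
  moreover have "2 * K \<le> Q" using Q_bounds(3) by (simp add: m_def)
  ultimately have "1 \<le> Q * n" "n \<le> Q * n" "Suc n \<le> Q * n" "K \<le> Q * n" "2 * K \<le> Q * n" "S \<le> Q * n"
    "S + Dn \<le> Q * n" "1 + (S + Dn) \<le> Q * n" using Q_bounds by linarith+
  then show ?thesis unfolding arr_bound_def by (intro if_leI) simp_all
qed

lemma pre_bounded:
  assumes "e = V 2 \<and> K = k \<or> e = Num K" "\<forall>x\<in>set xs. x \<le> 1"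
  shows "bounded (reg_bound k) arr_bound (sem (pre_com e) (init (k # n # xs)))"
proof -
  let ?s = "sem (pre_com e) (init (k # n # xs))"
  note p = pre_sem[OF K assms(1), of n xs]
  have "sc ?s = (\<lambda>_. 0)(2 := k, 3 := K, 4 := n, 5 := m, 6 := N, 7 := N * N, 8 := S, 9 := K * K,
      10 := Dn, 31 := K * K)"
    using assms(1)
    by (auto simp: pre_com_def pow2_sem m_def N_def S_def Dn_def fun_eq_iff simp del: sem.simps(6))
  then have "sc ?s x \<le> reg_bound k x" for x by (auto simp: reg_bound_def)
  then show ?thesis using p(4,5) assms(2) by (simp add: bounded_def)
qed

text \<open>Values of degree three in \<open>Q * n\<close> require \<open>E\<close> to be at least
  3. The preamble, with its doublings and inputs exceeding 1, is outside the static analysis: it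
  costs 13 steps per doubling, which the constant 1000 covers.\<close>

lemma prog_in_time:
  assumes e: "e = V 2 \<and> K = k \<or> e = Num K" and xs: "\<forall>x\<in>set xs. x \<le> 1"
    and C: "time_coeff (work_com F) + com_peak (work_com F) + 1000 \<le> C" and E: "3 \<le> E" "loop_depth (work_com F) \<le> E"
  shows "computes_in_time (C * Q ^ E * n ^ 3) (compile 0 (prog e F)) (k # n # xs)
    (outp (sem (prog e F) (init (k # n # xs))))"
proof -
  let ?i = "init (k # n # xs)"
  define s where "s = sem (pre_com e) ?i"
  have b: "bounded (reg_bound k) arr_bound s" unfolding s_def by (rule pre_bounded[OF e xs])
  have fine: "wf_com (work_com F)" "keeps_bounds (reg_bound k) arr_bound (work_com F)" "com_degree_le 3 (work_com F)"
    "weighted_depth weight (work_com F) \<le> 3" using fine_work[of k F] by (simp_all add: fine_def)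
  have Q1: "1 \<le> Q" using Q_bounds(7) by simp
  define Z where "Z = Q ^ E * n ^ 3"
  have QZ: "Q * n \<le> Z" unfolding Z_def
    using power_increasing[of 1 E Q] power_increasing[of 1 3 n] E(1) Q1 n by (intro mult_le_mono) simp_all
  have Qn: "Q \<le> Q * n" "n \<le> Q * n" using n Q1 by simp_all
  then have Z: "Q \<le> Z" "n \<le> Z" using QZ by linarith+
  have CZ: "1000 * Z \<le> C * Z" "com_peak (work_com F) * Z \<le> C * Z" "(time_coeff (work_com F) + 1000) * Z \<le> C * Z"
    using C by (intro mult_le_mono1; simp)+
  have T: "C * Q ^ E * n ^ 3 = C * Z" by (simp add: Z_def mult.assoc)
  have "safe (com_peak (work_com F) * (Q * n) ^ 3) (work_com F) s"
    using n Q1 by (intro safe_static[OF reg_bound_W arr_bound_W _ fine(1,2) b fine(3)]) simp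
  moreover have "(Q * n) ^ 3 \<le> Z" unfolding Z_def power_mult_distrib
    using E(1) Q1 by (intro mult_le_mono1 power_increasing)
  then have "com_peak (work_com F) * (Q * n) ^ 3 \<le> C * Z"
    using CZ(2) by (meson le_trans mult_le_mono2)
  ultimately have safe: "safe (C * Z) (work_com F) s" by (rule safe_mono)
  define U where "U = C * Z"
  have sm: "k \<le> U" "K \<le> U" "n \<le> U" "m \<le> U" "N \<le> U" "N * N \<le> U" "S \<le> U"
    "K * K \<le> U" "Dn \<le> U" "2 \<le> U" "32 \<le> U" "2 * K \<le> U" "1 \<le> U"
    using Z Q_bounds CZ(1) m_def unfolding U_def by linarith+
  have sxs: "\<forall>x\<in>set xs. x \<le> U" using xs sm(10) by fastforce
  have pre: "safe U (pre_com e) ?i"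
    using e sm sxs
    by (auto simp: pre_com_def pow2_sem m_def N_def S_def Dn_def intro!: pow2_safe
        simp del: sem.simps(6) safe.simps(6))
  then have "safe (C * Z) (prog e F) ?i" using safe by (simp add: prog_def s_def U_def)
  moreover have "time (prog e F) ?i \<le> C * Z"
  proof -
    have "time (work_com F) s \<le> time_coeff (work_com F) * Z" unfolding Z_def
      by (rule tm_static[OF reg_bound_le _ _ fine(1,2) b E(2) fine(4)]) (use Q1 n in simp_all)
    moreover have "time (pre_com e) ?i \<le> 13 * (N * N + K * K) + 200"
      using e by (auto simp: pre_com_def pow2_sem m_def N_def simp del: sem.simps(6))
    moreover have "13 * (N * N + K * K) + 200 \<le> 1000 * Z" using Q_bounds(5,7) Z(1) by simp
    ultimately have "time (prog e F) ?i \<le> (time_coeff (work_com F) + 1000) * Z"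
      by (simp add: prog_def s_def add_mult_distrib)
    then show ?thesis using CZ(3) by (rule le_trans)
  qed
  moreover have "wf_com (prog e F)" using fine(1) e by (auto simp: prog_def pre_com_def)
  ultimately show ?thesis unfolding T by (intro computes_in_time_comp sm(11)[unfolded U_def])
qed

end

section \<open>Deciding lettericity and hereditary classes\<close>

lemma decidesI:
  assumes K: "0 < K" "K \<le> k" and e: "e = V 2 \<and> K = k \<or> e = Num K"
    and no: "\<And>G n. pair_graph G \<Longrightarrow> pverts G = {0..<n} \<Longrightarrow> G \<in> C \<Longrightarrow> k_letter_graph K G"
    and yes: "\<And>G n d ord lab. pair_graph G \<Longrightarrow> pverts G = {0..<n} \<Longrightarrow>
      d < 2 ^ (K * K) \<Longrightarrow> bij_betw ord {..<n} {..<n} \<Longrightarrow> \<forall>x<n. lab x < K \<Longrightarrow>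
      (\<And>p q. p < n \<Longrightarrow> q < p \<Longrightarrow> (ord q, ord p) \<in> parcs G \<longleftrightarrow>
        odd (d div 2 ^ (lab (ord q) * K + lab (ord p)))) \<Longrightarrow>
      G \<in> C \<longleftrightarrow> \<not> (\<exists>u. (d, u) \<in> set F \<and> subseq u (map (lab \<circ> ord) [0..<n]))"
  shows "decides_with_realisation (compile 0 (prog e F))
    (exp_bound (time_coeff (work_com F) + com_peak (work_com F) + 1000) (max 3 (loop_depth (work_com F)))) k C"
  unfolding decides_with_realisation_def
proof (intro allI impI)
  fix n and G :: "nat pair_pre_digraph"
  assume "pair_graph G \<and> pverts G = {0..<n}"
  then have G: "pair_graph G" "pverts G = {0..<n}" by auto
  let ?ys = "outp (sem (prog e F) (init (encode_input k n G)))"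
  have "correct_answer k C n G ?ys"
    by (rule prog_correct[OF K e G no[OF G] yes[OF G]])
  moreover have "wf_com (prog e F)"
    using alg.fine_work[of K n 0 F] K e by (auto simp: alg_def alg.fine_def prog_def pre_com_def)
  then have "computes (compile 0 (prog e F)) (encode_input k n G) ?ys" by (rule computes_comp)
  moreover have "computes_in_time
      (exp_bound (time_coeff (work_com F) + com_peak (work_com F) + 1000) (max 3 (loop_depth (work_com F))) k * n ^ 3)
      (compile 0 (prog e F)) (encode_input k n G) ?ys" if "0 < n"
  proof -
    interpret bounds K n k using K that by unfold_locales
    have "\<forall>x\<in>set (adj_matrix n G). x \<le> 1" by (auto simp: adj_matrix_eq)
    from prog_in_time[OF e this order_refl max.cobounded1 max.cobounded2]
    show ?thesis by (simp add: exp_bound_def Q_def encode_input_def)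
  qed
  ultimately show "\<exists>ys. correct_answer k C n G ys \<and>
      computes (compile 0 (prog e F)) (encode_input k n G) ys \<and>
      (0 < n \<longrightarrow> computes_in_time
        (exp_bound (time_coeff (work_com F) + com_peak (work_com F) + 1000) (max 3 (loop_depth (work_com F))) k * n ^ 3)
        (compile 0 (prog e F)) (encode_input k n G) ys)" by blast
qed

text \<open>A single program serves all \<open>k\<close>, since the number of letters is taken from
  the input. No word is forbidden, because every realisation found proves membership.\<close>

lemma lettericity_decidable:
  "\<exists>f P. computable f \<and>
     (\<forall>k>0. decides_with_realisation P f k {G. pair_graph G \<and> lettericity G \<le> k})"
proof (intro exI conjI allI impI)
  fix k :: nat assume "0 < k"
  then show "decides_with_realisation (compile 0 (prog (V 2) []))
    (exp_bound (time_coeff (work_com []) + com_peak (work_com []) + 1000) (max 3 (loop_depth (work_com [])))) k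
    {G. pair_graph G \<and> lettericity G \<le> k}"
  proof (rule decidesI[OF _ order_refl])
    fix G :: "nat pair_pre_digraph" and n
    assume G: "pair_graph G" "pverts G = {0..<n}"
    show "k_letter_graph k G" if "G \<in> {G. pair_graph G \<and> lettericity G \<le> k}"
      using that lettericity_le_iff[OF G] by simp
    fix d :: nat and ord lab :: "nat \<Rightarrow> nat"
    assume w: "bij_betw ord {..<n} {..<n}" "\<forall>x<n. lab x < k"
      "\<And>p q. p < n \<Longrightarrow> q < p \<Longrightarrow> (ord q, ord p) \<in> parcs G \<longleftrightarrow>
        odd (d div 2 ^ (lab (ord q) * k + lab (ord p)))"
    have "labels_exist k n G"
      by (rule word_labels[OF G(1) w(1,2), of "\<lambda>a b. odd (d div 2 ^ (a * k + b))"]) (rule w(3))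
    then have "lettericity G \<le> k" using lettericity_le_iff[OF G] k_letter_graph_iff[OF G(2)] by simp
    then show "(G \<in> {G. pair_graph G \<and> lettericity G \<le> k}) =
        (\<not> (\<exists>u. (d, u) \<in> set [] \<and> subseq u (map (lab \<circ> ord) [0..<n])))"
      using G(1) by simp
  qed simp
qed (rule computable_exp_bound)

text \<open>The program may depend on the class but not on \<open>k\<close>. The least admissible
  number of letters is therefore built in together with its forbidden words, and a larger
  \<open>k\<close> only pads the decoder in the output.\<close>

lemma class_decidable:
  assumes C: "graph_class C" "hereditary C"
  shows "\<exists>f P. computable f \<and>
    (\<forall>k>0. (\<forall>G\<in>C. k_letter_graph k G) \<longrightarrow> decides_with_realisation P f k C)"
proof (cases "\<exists>k>0. \<forall>G\<in>C. k_letter_graph k G")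
  \<comment> \<open>No \<open>k\<close> satisfies the premise, so any program will do.\<close>
  case False
  then show ?thesis using computable_exp_bound by blast
next
  case True
  define K where "K = (LEAST k. 0 < k \<and> (\<forall>G\<in>C. k_letter_graph k G))"
  have K: "0 < K" "\<forall>G\<in>C. k_letter_graph K G"
    using LeastI_ex[of "\<lambda>k. 0 < k \<and> (\<forall>G\<in>C. k_letter_graph k G)"] True by (auto simp: K_def)
  define D where "D d a b \<longleftrightarrow> odd (d div 2 ^ (a * K + b))" for d a b :: nat
  have "\<forall>d. \<exists>F. finite F \<and>
      (\<forall>w\<in>lists {..<K}. word_graph (D d) w \<in> C \<longleftrightarrow> \<not> (\<exists>u\<in>F. subseq u w))"
    using forbidden_words[OF C] by blast
  then obtain F where F: "\<And>d. finite (F d)"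
    "\<And>d w. w \<in> lists {..<K} \<Longrightarrow> word_graph (D d) w \<in> C \<longleftrightarrow> \<not> (\<exists>u\<in>F d. subseq u w)"
    by metis
  have "finite (SIGMA d:{..<2 ^ (K * K)}. F d)" using F(1) by simp
  then obtain Fs where Fs: "set Fs = (SIGMA d:{..<2 ^ (K * K)}. F d)" using finite_list by blast
  show ?thesis
  proof (intro exI conjI allI impI)
    fix k :: nat assume k: "0 < k" "\<forall>G\<in>C. k_letter_graph k G"
    then have "K \<le> k" unfolding K_def by (intro Least_le) simp
    with K(1) show "decides_with_realisation (compile 0 (prog (Num K) Fs))
      (exp_bound (time_coeff (work_com Fs) + com_peak (work_com Fs) + 1000) (max 3 (loop_depth (work_com Fs)))) k C"
    proof (rule decidesI)
      fix G :: "nat pair_pre_digraph" and n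
      assume G: "pair_graph G" "pverts G = {0..<n}"
      show "k_letter_graph K G" if "G \<in> C" using that K(2) by blast
      fix d :: nat and ord lab :: "nat \<Rightarrow> nat"
      assume w: "d < 2 ^ (K * K)" "bij_betw ord {..<n} {..<n}" "\<forall>x<n. lab x < K"
        "\<And>p q. p < n \<Longrightarrow> q < p \<Longrightarrow> (ord q, ord p) \<in> parcs G \<longleftrightarrow>
          odd (d div 2 ^ (lab (ord q) * K + lab (ord p)))"
      have "G \<in> C \<longleftrightarrow> word_graph (D d) (map (lab \<circ> ord) [0..<n]) \<in> C"
        by (rule word_class_iff[OF C(1) G w(2)]) (simp add: D_def w(4))
      moreover have "map (lab \<circ> ord) [0..<n] \<in> lists {..<K}"
        using bij_betw_apply[OF w(2)] w(3) by auto
      ultimately show "G \<in> C \<longleftrightarrow> \<not> (\<exists>u. (d, u) \<in> set Fs \<and> subseq u (map (lab \<circ> ord) [0..<n]))"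
        using F(2) w(1) by (auto simp: Fs)
    qed simp
  qed (rule computable_exp_bound)
qed

theorem theorem3p5:
  shows "(\<exists>f P. computable f \<and>
            (\<forall>k>0. decides_with_realisation P f k {G. pair_graph G \<and> lettericity G \<le> k})) \<and>
         (\<forall>C. graph_class C \<and> hereditary C \<and> mso_definable C \<longrightarrow>
            (\<exists>f P. computable f \<and>
               (\<forall>k>0. (\<forall>G\<in>C. k_letter_graph k G) \<longrightarrow> decides_with_realisation P f k C)))"
  using lettericity_decidable class_decidable by blast

end
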